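(* Let $\Omega\subset\mathbb{R}^n$ be (non-empty) open and bounded, and let $\Sigma\subset\partial\Omega$ be non-empty. Then the map $Diff^1_c(\mathbb{R}^n)\to\mathbb{R}$, $\varphi\mapsto H(\varphi(\Omega),\varphi(\Sigma))$, is continuous with respect to the weak $C^1$ topology.
   Context: For an open set $\Omega\subset\mathbb{R}^n$ and non-empty $\Sigma\subset\partial\Omega$, put $d_\Sigma(x)=\mathrm{dist}(x,\Sigma)$ (Euclidean distance). The Hardy constant is $$H(\Omega,\Sigma)=\inf_{u\in H^1_0(\Omega),\,u\ne0}\frac{\int_\Omega|\nabla u|^2dx}{\int_\Omega u^2/d_\Sigma^2\,dx},$$ the quotient being $0$ when the denominator is $+\infty$. $Diff^1_c(\mathbb{R}^n)$ is the group of $C^1$ diffeomorphisms of $\mathbb{R}^n$ (with $C^1$ inverse) that have compact support, i.e. the closure of $\{x:\varphi(x)\ne x\}$ is compact. The weak $C^1$ topology on it is generated by the sets $\mathcal{N}_\varphi(K,\epsilon)=\{\psi\in Diff^1_c(\mathbb{R}^n):\|\psi-\varphi\|_{C^1(K)}<\epsilon\}$ with $\varphi\in Diff^1_c(\mathbb{R}^n)$, $\epsilon>0$, $K\subset\mathbb{R}^n$ compact, where $\|\varphi\|_{C^1(K)}=\sum_{0\le|\alpha|\le1}\|\partial^\alpha\varphi\|_{L^\infty(K)}$. *)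

theory Defs
  imports "HOL-Analysis.Analysis" "HOL-Probability.Essential_Supremum"
begin

section \<open>Functions of class $C^k$ on the whole space\<close>

definition partial_deriv :: "'n::finite \<Rightarrow> (real^'n \<Rightarrow> 'b::real_normed_vector) \<Rightarrow> real^'n \<Rightarrow> 'b"
  where "partial_deriv i f x = frechet_derivative f (at x) (axis i 1)"

primrec Ck :: "nat \<Rightarrow> (real^'n::finite \<Rightarrow> 'b::real_normed_vector) \<Rightarrow> bool"
  where
    "Ck 0 f \<longleftrightarrow> continuous_on UNIV f"
  | "Ck (Suc k) f \<longleftrightarrow> (\<forall>x. f differentiable (at x)) \<and> (\<forall>i. Ck k (partial_deriv i f))"


section \<open>The space $H^1_0$\<close>

text \<open>Sobolev functions are represented by total functions on the whole space, of which only the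
  restriction to \<open>\<Omega>\<close> matters, up to null sets.\<close>

definition test_functions :: "(real^'n::finite) set \<Rightarrow> (real^'n \<Rightarrow> real) set"
  where "test_functions \<Omega> =
    {\<eta>. (\<forall>k. Ck k \<eta>) \<and> compact (closure {x. \<eta> x \<noteq> 0}) \<and> closure {x. \<eta> x \<noteq> 0} \<subseteq> \<Omega>}"

definition L2 :: "(real^'n::finite) set \<Rightarrow> (real^'n \<Rightarrow> real) set"
  where "L2 \<Omega> =
    {u. u \<in> borel_measurable (lebesgue_on \<Omega>) \<and> integrable (lebesgue_on \<Omega>) (\<lambda>x. (u x)\<^sup>2)}"

definition has_weak_partial ::
    "(real^'n::finite) set \<Rightarrow> 'n \<Rightarrow> (real^'n \<Rightarrow> real) \<Rightarrow> (real^'n \<Rightarrow> real) \<Rightarrow> bool"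
  where "has_weak_partial \<Omega> i u v \<longleftrightarrow>
    (\<forall>\<eta>\<in>test_functions \<Omega>.
       (LINT x|lebesgue_on \<Omega>. u x * partial_deriv i \<eta> x) = - (LINT x|lebesgue_on \<Omega>. v x * \<eta> x))"

definition H1 :: "(real^'n::finite) set \<Rightarrow> (real^'n \<Rightarrow> real) set"
  where "H1 \<Omega> = {u \<in> L2 \<Omega>. \<forall>i. \<exists>v\<in>L2 \<Omega>. has_weak_partial \<Omega> i u v}"

text \<open>For \<open>u \<in> H1 \<Omega>\<close> with \<open>\<Omega>\<close> open, the chosen components exist and are unique up to null sets;
  for other \<open>u\<close> the value is unspecified and never used.\<close>

definition weak_grad :: "(real^'n::finite) set \<Rightarrow> (real^'n \<Rightarrow> real) \<Rightarrow> real^'n \<Rightarrow> real^'n"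
  where "weak_grad \<Omega> u x = (\<chi> i. (SOME v. v \<in> L2 \<Omega> \<and> has_weak_partial \<Omega> i u v) x)"

definition H1_norm :: "(real^'n::finite) set \<Rightarrow> (real^'n \<Rightarrow> real) \<Rightarrow> real"
  where "H1_norm \<Omega> u =
    sqrt ((LINT x|lebesgue_on \<Omega>. (u x)\<^sup>2) + (LINT x|lebesgue_on \<Omega>. (norm (weak_grad \<Omega> u x))\<^sup>2))"

definition H1_0 :: "(real^'n::finite) set \<Rightarrow> (real^'n \<Rightarrow> real) set"
  where "H1_0 \<Omega> =
    {u \<in> H1 \<Omega>. \<forall>\<epsilon>>0. \<exists>\<eta>\<in>test_functions \<Omega>. H1_norm \<Omega> (\<lambda>x. u x - \<eta> x) < \<epsilon>}"


section \<open>The Hardy constant\<close>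

text \<open>The denominator is an extended nonnegative integral because it may be infinite. If
  \<open>\<Omega>\<close> is open and \<open>S \<subseteq> frontier \<Omega>\<close> is nonempty, then \<open>infdist x S > 0\<close> on \<open>\<Omega>\<close>.\<close>

definition hardy_denominator ::
    "(real^'n::finite) set \<Rightarrow> (real^'n) set \<Rightarrow> (real^'n \<Rightarrow> real) \<Rightarrow> ennreal"
  where "hardy_denominator \<Omega> S u = (\<integral>\<^sup>+x. ennreal ((u x)\<^sup>2 / (infdist x S)\<^sup>2) \<partial>lebesgue_on \<Omega>)"

definition hardy_quotient ::
    "(real^'n::finite) set \<Rightarrow> (real^'n) set \<Rightarrow> (real^'n \<Rightarrow> real) \<Rightarrow> real"
  where "hardy_quotient \<Omega> S u =
    (if hardy_denominator \<Omega> S u = \<infinity> then 0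
     else (LINT x|lebesgue_on \<Omega>. (norm (weak_grad \<Omega> u x))\<^sup>2) / enn2real (hardy_denominator \<Omega> S u))"

definition hardy_constant :: "(real^'n::finite) set \<Rightarrow> (real^'n) set \<Rightarrow> real"
  where "hardy_constant \<Omega> S =
    Inf {hardy_quotient \<Omega> S u |u. u \<in> H1_0 \<Omega> \<and> \<not> (AE x in lebesgue_on \<Omega>. u x = 0)}"


section \<open>Compactly supported diffeomorphisms and the weak $C^1$ topology\<close>

definition Diff1_c :: "(real^'n::finite \<Rightarrow> real^'n) set"
  where "Diff1_c = {\<phi>. bij \<phi> \<and> Ck 1 \<phi> \<and> Ck 1 (inv \<phi>) \<and> compact (closure {x. \<phi> x \<noteq> x})}"

text \<open>If \<open>K\<close> is a null set, the essential supremum is \<open>-\<infinity>\<close>, which \<open>real_of_ereal\<close> sends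
  to the correct value \<open>0\<close>. The value \<open>\<infinity>\<close> does not occur below, where \<open>f\<close> is continuous and
  \<open>K\<close> is compact.\<close>

definition Linf_norm :: "(real^'n::finite) set \<Rightarrow> (real^'n \<Rightarrow> 'b::real_normed_vector) \<Rightarrow> real"
  where "Linf_norm K f = real_of_ereal (esssup (lebesgue_on K) (\<lambda>x. ereal (norm (f x))))"

definition C1_norm :: "(real^'n::finite) set \<Rightarrow> (real^'n \<Rightarrow> 'b::real_normed_vector) \<Rightarrow> real"
  where "C1_norm K f = Linf_norm K f + (\<Sum>i\<in>UNIV. Linf_norm K (partial_deriv i f))"

definition C1_nbhd ::
    "(real^'n::finite \<Rightarrow> real^'n) \<Rightarrow> (real^'n) set \<Rightarrow> real \<Rightarrow> (real^'n \<Rightarrow> real^'n) set"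
  where "C1_nbhd \<phi> K \<epsilon> = {\<psi> \<in> Diff1_c. C1_norm K (\<lambda>x. \<psi> x - \<phi> x) < \<epsilon>}"

definition weak_C1_topology :: "(real^'n::finite \<Rightarrow> real^'n) topology"
  where "weak_C1_topology =
    topology_generated_by {C1_nbhd \<phi> K \<epsilon> |\<phi> K \<epsilon>. \<phi> \<in> Diff1_c \<and> compact K \<and> \<epsilon> > 0}"

lemma topspace_weak_C1_topology:
  "topspace (weak_C1_topology :: (real^'n::finite \<Rightarrow> real^'n) topology) = Diff1_c"
proof -
  have zero: "Linf_norm {} f = 0" for f :: "real^'n \<Rightarrow> real^'n"
  proof -
    have "AE x in lebesgue_on {}. ereal (norm (f x)) \<le> -\<infinity>"
      by (rule AE_I2) simp
    then have "esssup (lebesgue_on {}) (\<lambda>x. ereal (norm (f x))) \<le> -\<infinity>"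
      by (rule esssup_I[rotated]) (simp add: measurable_def)
    then show ?thesis by (simp add: Linf_norm_def)
  qed
  have "\<phi> \<in> C1_nbhd \<phi> {} 1" if "\<phi> \<in> Diff1_c" for \<phi> :: "real^'n \<Rightarrow> real^'n"
    using that by (simp add: C1_nbhd_def C1_norm_def zero)
  moreover have "C1_nbhd \<phi> K \<epsilon> \<subseteq> Diff1_c" for \<phi> :: "real^'n \<Rightarrow> real^'n" and K \<epsilon>
    by (auto simp: C1_nbhd_def)
  ultimately show ?thesis
    unfolding weak_C1_topology_def topology_generated_by_topspace
    by (intro equalityI subsetI) (blast intro: zero_less_one compact_empty)+
qed

end

theory Submission
  imports Defs
begin

text \<open>
  For two diffeomorphisms \<open>\<phi>\<close> and \<open>\<psi>\<close> the Hardy constants of the image pairs are compared along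
  \<open>T = \<psi> \<circ> \<phi>\<inverse>\<close>. Suppose that \<open>T\<close> changes the distances between points of \<open>\<phi> ` (\<Omega> \<union> \<Sigma>)\<close> by factors
  between \<open>a\<close> and \<open>b\<close>. If \<open>u\<close> is an admissible function on the image of \<open>T\<close>, then passing from \<open>u\<close>
  to \<open>u \<circ> T\<close> multiplies gradients, distances to the boundary part and volumes by controlled powers
  of \<open>a\<close> and \<open>b\<close>. Hence the two Hardy constants differ at most by the factor \<open>(b / a) ^ (n + 2)\<close>,
  where two powers come from the gradient and the weight and \<open>n\<close> from the volume
  (\<open>hardy_constant_bilipschitz\<close>). If \<open>\<psi>\<close> is \<open>C\<^sup>1\<close>-close to \<open>\<phi>\<close> on a large ball, then \<open>T - id\<close> is
  Lipschitz with a small constant \<open>\<delta>\<close> (\<open>C1_close_imp_relative_lipschitz\<close>), so \<open>a = 1 - \<delta>\<close> and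
  \<open>b = 1 + \<delta>\<close> are possible and the factor tends to \<open>1\<close>.

  The comparison needs a class of functions that determines the Hardy constant and is preserved by
  composition with \<open>C\<^sup>1\<close> maps; smooth test functions are not preserved. A number \<open>c \<ge> 0\<close> is at most
  the Hardy constant if and only if the inequality \<open>c \<integral> u\<^sup>2 / d\<^sup>2 \<le> \<integral> |\<nabla>u|\<^sup>2\<close> holds for all test functions, and then it holds for
  all compactly supported \<open>C\<^sup>1\<close> functions (\<open>hardy_constant_imp_C1_inequality\<close>,
  \<open>test_inequality_imp_hardy_constant\<close>). Compactly supported \<open>C\<^sup>1\<close> functions are preserved by
  composition with \<open>T\<close>. Both implications rest on one fact, \<open>hardy_inequality_closure\<close>: by Fatou's
  lemma the inequality survives limits in which functions and gradients converge in \<open>L\<^sup>2\<close>.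
  Mollification provides such approximations of \<open>C\<^sup>1\<close> functions by test functions
  (\<open>test_function_approximation\<close>). The fundamental lemma of the calculus of variations
  (\<open>orthogonal_imp_zero\<close>) shows that the gradient chosen in the definition of \<open>H\<^sup>1\<close> agrees almost
  everywhere with every other weak gradient.

  Volumes are compared through coverings: by the Vitali covering theorem an open set is, up to a
  null set, a disjoint union of balls, and a \<open>b\<close>-Lipschitz map sends a ball of radius \<open>r\<close>
  into a ball of radius \<open>b r\<close> (\<open>lborel_lipschitz_image_open\<close>).
\<close>

section \<open>Functions of class $C^k$\<close>

lemma partial_deriv_eq:
  assumes "(f has_derivative f') (at x)"
  shows "partial_deriv i f x = f' (axis i 1)"
  using frechet_derivative_at[OF assms] by (simp add: partial_deriv_def)

lemma has_derivative_frechet: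
  assumes "f differentiable (at x)"
  shows "(f has_derivative frechet_derivative f (at x)) (at x)"
  using assms frechet_derivative_works by blast

lemma Ck_imp_continuous: "Ck k f \<Longrightarrow> continuous_on UNIV f"
  by (cases k) (auto simp: differentiable_imp_continuous_within intro!: continuous_at_imp_continuous_on)

lemma Ck_SucD: "Ck (Suc k) f \<Longrightarrow> Ck k f"
proof (induction k arbitrary: f)
  case 0
  then show ?case using Ck_imp_continuous[of "Suc 0" f] by simp
next
  case (Suc k)
  from Suc.prems have "f differentiable (at x)" "Ck (Suc k) (partial_deriv i f)" for x i
    by simp_all
  with Suc.IH show ?case
    by simp
qed

lemma Ck_1I:
  assumes "\<And>x. (f has_derivative f' x) (at x)"
    and "\<And>i. continuous_on UNIV (\<lambda>x. f' x (axis i 1))"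
  shows "Ck 1 f"
proof -
  have "partial_deriv i f = (\<lambda>x. f' x (axis i 1))" for i
    using partial_deriv_eq[OF assms(1)] by auto
  then show ?thesis
    using assms by (auto simp: differentiable_def)
qed

lemma Ck_1_partial_continuous: "Ck 1 f \<Longrightarrow> continuous_on UNIV (partial_deriv i f)"
  by simp

lemma Ck_const: "Ck k (\<lambda>x. c)"
proof (induction k arbitrary: c)
  case (Suc k)
  have "partial_deriv i (\<lambda>x. c) = (\<lambda>x. 0)" for i :: 'a
    using partial_deriv_eq[OF has_derivative_const[of c]] by auto
  with Suc show ?case by simp
qed simp

lemma Ck_add:
  assumes "Ck k f" "Ck k g"
  shows "Ck k (\<lambda>x. f x + g x)"
  using assms
proof (induction k arbitrary: f g)
  case (Suc k)
  then have d: "f differentiable (at x)" "g differentiable (at x)" for x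
    by auto
  have "partial_deriv i (\<lambda>x. f x + g x) = (\<lambda>x. partial_deriv i f x + partial_deriv i g x)" for i
    using partial_deriv_eq[OF has_derivative_add[OF d[THEN has_derivative_frechet]]]
    by (auto simp: partial_deriv_def)
  with Suc d show ?case by simp
qed (auto intro: continuous_intros)

lemma Ck_mult:
  fixes f g :: "real^'n::finite \<Rightarrow> real"
  assumes "Ck k f" "Ck k g"
  shows "Ck k (\<lambda>x. f x * g x)"
  using assms
proof (induction k arbitrary: f g)
  case (Suc k)
  then have d: "f differentiable (at x)" "g differentiable (at x)" for x
    by auto
  have "partial_deriv i (\<lambda>x. f x * g x) = (\<lambda>x. f x * partial_deriv i g x + partial_deriv i f x * g x)" for i
    using partial_deriv_eq[OF has_derivative_mult[OF d[THEN has_derivative_frechet]]]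
    by (auto simp: partial_deriv_def)
  moreover have "Ck k (\<lambda>x. f x * partial_deriv i g x + partial_deriv i f x * g x)" for i
    using Suc by (intro Ck_add Suc.IH) (auto intro: Ck_SucD)
  ultimately show ?case
    using Suc d by simp
qed (auto intro: continuous_intros)

lemma Ck_linear:
  fixes l :: "real^'n::finite \<Rightarrow> real"
  assumes "bounded_linear l"
  shows "Ck k l"
proof (cases k)
  case 0
  then show ?thesis
    using assms by (simp add: linear_continuous_on)
next
  case (Suc m)
  have "(l has_derivative l) (at x)" for x
    using assms by (rule bounded_linear_imp_has_derivative)
  then have "partial_deriv i l = (\<lambda>x. l (axis i 1))" "l differentiable (at x)" for i x
    using partial_deriv_eq by (force simp: differentiable_def)+
  then show ?thesis
    using Suc by (simp add: Ck_const)
qed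

lemma Ck_sum:
  fixes f :: "'i \<Rightarrow> real^'n::finite \<Rightarrow> real"
  assumes "\<And>i. i \<in> A \<Longrightarrow> Ck k (f i)"
  shows "Ck k (\<lambda>x. \<Sum>i\<in>A. f i x)"
  using assms
  by (induction A rule: infinite_finite_induct) (auto intro: Ck_const Ck_add)

lemma Ck_radial: "Ck k (\<lambda>x::real^'n::finite. c - x \<bullet> x)"
proof -
  have *: "(\<lambda>x::real^'n. c - x \<bullet> x) = (\<lambda>x. c + (\<Sum>i\<in>UNIV. (-1) * (x $ i * (x $ i))))"
    by (auto simp: inner_vec_def sum_negf)
  show ?thesis
    unfolding *
    by (intro Ck_add Ck_const Ck_sum Ck_mult Ck_linear bounded_linear_vec_nth)
qed

section \<open>Smooth functions that vanish on a half-line\<close>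

text \<open>The profile \<open>e\<^bsup>-1/t\<^esup>\<close> together with polynomial factors in \<open>1/t\<close>. With these factors the class is
  closed under differentiation, so that smoothness of all its members is proved simultaneously.\<close>

definition flat_exp :: "real poly \<Rightarrow> real \<Rightarrow> real"
  where "flat_exp p t = (if t > 0 then poly p (1 / t) * exp (- 1 / t) else 0)"

text \<open>The polynomial factor of the derivative: for \<open>t > 0\<close>, the derivative of \<open>p(1/t) e\<^bsup>-1/t\<^esup>\<close> is
  \<open>t\<^sup>-\<^sup>2 (p(1/t) - p'(1/t)) e\<^bsup>-1/t\<^esup>\<close>.\<close>

definition flat_exp_next :: "real poly \<Rightarrow> real poly"
  where "flat_exp_next p = monom 1 2 * (p - pderiv p)"

lemma poly_exp_decay: "((\<lambda>s::real. poly p s * exp (- s)) \<longlongrightarrow> 0) at_top"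
proof -
  have "((\<lambda>s. \<Sum>i\<le>degree p. coeff p i * (s ^ i / exp s)) \<longlongrightarrow> (\<Sum>i\<le>degree p. coeff p i * 0)) at_top"
    by (intro tendsto_sum tendsto_mult_left tendsto_power_div_exp_0)
  moreover have "poly p s * exp (- s) = (\<Sum>i\<le>degree p. coeff p i * (s ^ i / exp s))" for s
    by (simp add: poly_altdef exp_minus divide_inverse sum_distrib_right mult.assoc)
  ultimately show ?thesis
    by simp
qed

text \<open>Only the point \<open>0\<close> matters. With \<open>s = 1/h\<close> the difference quotient from the right is
  \<open>s p(s) e\<^bsup>-s\<^esup>\<close>, which decays for every polynomial \<open>p\<close>.\<close>

lemma flat_exp_has_derivative:
  "(flat_exp p has_real_derivative flat_exp (flat_exp_next p) t) (at t)"
proof (cases t "0::real" rule: linorder_cases)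
  case greater
  have "((\<lambda>t. poly p (1 / t) * exp (- 1 / t)) has_real_derivative
      poly (flat_exp_next p) (1 / t) * exp (- 1 / t)) (at t)"
  proof -
    have inv: "((\<lambda>t. 1 / t) has_real_derivative - 1 / t ^ 2) (at t)"
      using greater by (auto intro!: derivative_eq_intros simp: power2_eq_square)
    have pol: "((\<lambda>t. poly p (1 / t)) has_real_derivative poly (pderiv p) (1 / t) * (- 1 / t ^ 2)) (at t)"
      using DERIV_chain2[OF poly_DERIV inv] .
    have ex: "((\<lambda>t. exp (- 1 / t)) has_real_derivative exp (- 1 / t) * (1 / t ^ 2)) (at t)"
      using DERIV_chain2[OF DERIV_exp DERIV_minus[OF inv]] by simp
    show ?thesis
      by (rule DERIV_cong[OF DERIV_mult[OF pol ex]])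
        (simp add: flat_exp_next_def poly_monom power_inverse divide_inverse algebra_simps)
  qed
  then have "((\<lambda>t. poly p (1 / t) * exp (- 1 / t)) has_real_derivative
      flat_exp (flat_exp_next p) t) (at t)"
    using greater by (simp add: flat_exp_def)
  then show ?thesis
    by (rule has_field_derivative_transform_within_open[OF _ open_greaterThan[of 0]])
      (use greater in \<open>auto simp: flat_exp_def\<close>)
next
  case less
  have "((\<lambda>t. 0) has_real_derivative flat_exp (flat_exp_next p) t) (at t)"
    using less by (simp add: flat_exp_def)
  then show ?thesis
    by (rule has_field_derivative_transform_within_open[OF _ open_lessThan[of 0]])
      (use less in \<open>auto simp: flat_exp_def\<close>)
next
  case equal
  have "((\<lambda>h. poly (pCons 0 p) (inverse h) * exp (- inverse h)) \<longlongrightarrow> 0) (at_right 0)"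
    using filterlim_compose[OF poly_exp_decay[of "pCons 0 p"] filterlim_inverse_at_top_right] .
  moreover have "eventually (\<lambda>h. poly (pCons 0 p) (inverse h) * exp (- inverse h) = flat_exp p h / h) (at_right 0)"
    by (auto simp: eventually_at_filter flat_exp_def field_simps)
  ultimately have r: "((\<lambda>h. flat_exp p h / h) \<longlongrightarrow> 0) (at_right 0)"
    by (rule Lim_transform_eventually)
  have "eventually (\<lambda>h. flat_exp p h / h = 0) (at_left 0)"
    by (auto simp: eventually_at_filter flat_exp_def)
  then have l: "((\<lambda>h. flat_exp p h / h) \<longlongrightarrow> 0) (at_left 0)"
    by (rule tendsto_eventually)
  have "((\<lambda>h. flat_exp p h / h) \<longlongrightarrow> 0) (at 0)"
    using l r by (rule filterlim_split_at)
  then show ?thesis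
    using equal by (simp add: has_field_derivative_iff flat_exp_def)
qed

text \<open>The polynomial is generalised in the induction, because the derivative of one flat function is
  another one.\<close>

lemma Ck_flat_exp:
  fixes g :: "real^'n::finite \<Rightarrow> real"
  assumes "\<And>k. Ck k g"
  shows "Ck k (\<lambda>x. flat_exp p (g x))"
proof (induction k arbitrary: p)
  case 0
  have "continuous_on UNIV (flat_exp p)"
    using flat_exp_has_derivative by (intro DERIV_continuous_on) (auto intro: DERIV_subset)
  with assms[of 0] show ?case
    by (auto intro: continuous_on_compose2)
next
  case (Suc k)
  have g: "g differentiable (at x)" for x
    using assms[of "Suc 0"] by simp
  have d: "((\<lambda>x. flat_exp p (g x)) has_derivative
      (\<lambda>h. frechet_derivative g (at x) h * flat_exp (flat_exp_next p) (g x))) (at x)" for x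
    by (rule has_derivative_compose[OF has_derivative_frechet[OF g]
        flat_exp_has_derivative[unfolded has_field_derivative_def], THEN has_derivative_eq_rhs])
      (simp add: mult.commute fun_eq_iff)
  have "partial_deriv i (\<lambda>x. flat_exp p (g x))
      = (\<lambda>x. partial_deriv i g x * flat_exp (flat_exp_next p) (g x))" for i
    using partial_deriv_eq[OF d] by (auto simp: partial_deriv_def)
  moreover have "Ck k (\<lambda>x. partial_deriv i g x * flat_exp (flat_exp_next p) (g x))" for i
    using assms[of "Suc k"] by (intro Ck_mult Suc) simp
  ultimately show ?case
    using d by (auto simp: differentiable_def)
qed

section \<open>Gradients\<close>

definition grad :: "(real^'n::finite \<Rightarrow> real) \<Rightarrow> real^'n \<Rightarrow> real^'n"
  where "grad f x = (\<chi> i. partial_deriv i f x)"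

lemma grad_nth [simp]: "grad f x $ i = partial_deriv i f x"
  by (simp add: grad_def)

lemma linear_axis_expansion:
  fixes l :: "real^'n::finite \<Rightarrow> 'b::real_normed_vector"
  assumes "linear l"
  shows "l h = (\<Sum>i\<in>UNIV. h $ i *\<^sub>R l (axis i 1))"
proof -
  have "l h = l (\<Sum>i\<in>UNIV. h $ i *\<^sub>R axis i 1)"
    using basis_expansion[of h] by (simp add: scalar_mult_eq_scaleR)
  then show ?thesis
    using assms by (simp add: linear_sum linear_cmul)
qed

lemma grad_has_derivative:
  assumes "f differentiable (at x)"
  shows "(f has_derivative (\<lambda>h. grad f x \<bullet> h)) (at x)"
proof -
  have d: "(f has_derivative frechet_derivative f (at x)) (at x)"
    using assms by (rule has_derivative_frechet)
  have "frechet_derivative f (at x) h = grad f x \<bullet> h" for h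
    using linear_axis_expansion[OF has_derivative_linear[OF d], of h]
    by (simp add: inner_vec_def partial_deriv_def mult.commute)
  then have "frechet_derivative f (at x) = (\<lambda>h. grad f x \<bullet> h)"
    by auto
  with d show ?thesis by simp
qed

lemma grad_eqI:
  assumes "(f has_derivative (\<lambda>h. g \<bullet> h)) (at x)"
  shows "grad f x = g"
  using partial_deriv_eq[OF assms] by (simp add: vec_eq_iff inner_axis)

lemma continuous_grad:
  assumes "Ck 1 f"
  shows "continuous_on UNIV (grad f)"
  unfolding grad_def
  using assms by (intro continuous_on_vec_lambda) simp

text \<open>Off its closed support a function is locally zero, so it is differentiable there even if it is
  not differentiable elsewhere.\<close>

lemma grad_outside_support:
  assumes "x \<notin> closure {x. f x \<noteq> 0}"
  shows "grad f x = 0"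
proof (rule grad_eqI)
  have "((\<lambda>x. 0) has_derivative (\<lambda>h. 0 \<bullet> h)) (at x)"
    by simp
  then show "(f has_derivative (\<lambda>h. 0 \<bullet> h)) (at x)"
    by (rule has_derivative_transform_within_open[of _ _ _ _ "- closure {x. f x \<noteq> 0}"])
      (use assms closure_subset[of "{x. f x \<noteq> 0}"] in auto)
qed

section \<open>Mollification\<close>

lemma ball_subset_cube:
  fixes x :: "real^'n::finite"
  assumes "norm x \<le> r"
  shows "x \<in> cbox (\<chi> i. - r) (\<chi> i. r)"
proof -
  have "\<bar>x $ i\<bar> \<le> r" for i
    using component_le_norm_cart[of x i] assms by linarith
  then show ?thesis
    by (auto simp: mem_box_cart abs_le_iff minus_le_iff)
qed

text \<open>The flat function of \<open>r\<^sup>2 - |x|\<^sup>2\<close>, divided by its integral. The integral is taken over a cube,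
  since differentiation under the integral sign is used on boxes.\<close>

lemma mollifier_exists:
  assumes "r > 0"
  obtains \<rho> :: "real^'n::finite \<Rightarrow> real" where "\<And>k. Ck k \<rho>" "\<And>x. 0 \<le> \<rho> x"
    "\<And>x. \<rho> x \<noteq> 0 \<Longrightarrow> norm x < r" "integral (cbox (\<chi> i. - r) (\<chi> i. r)) \<rho> = 1"
proof -
  define b where "b = (\<lambda>x::real^'n. flat_exp 1 (r\<^sup>2 - x \<bullet> x))"
  define C :: "(real^'n) set" where "C = cbox (\<chi> i. - r) (\<chi> i. r)"
  have b: "Ck k b" for k
    unfolding b_def by (intro Ck_flat_exp Ck_radial)
  have nonneg: "0 \<le> b x" for x
    by (simp add: b_def flat_exp_def)
  have supp: "norm x < r" if "b x \<noteq> 0" for x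
  proof -
    have "(norm x)\<^sup>2 < r\<^sup>2"
      using that by (auto simp: b_def flat_exp_def power2_norm_eq_inner split: if_splits)
    then show ?thesis
      using assms by (auto intro: power2_less_imp_less)
  qed
  have cont: "continuous_on C b"
    using b[of 0] by (auto intro: continuous_on_subset)
  have "b 0 > 0"
    using assms by (simp add: b_def flat_exp_def)
  moreover have "0 \<in> C"
    unfolding C_def using assms by (intro ball_subset_cube) simp
  moreover have "box (\<chi> i. - r) (\<chi> i. r) \<noteq> ({} :: (real^'n) set)"
    using assms by (auto simp: interval_ne_empty_cart)
  ultimately have "integral C b \<noteq> 0"
    using integral_cbox_eq_0_iff[of "\<chi> i. - r" "\<chi> i. r" b] cont nonneg
    unfolding C_def by force
  moreover have "0 \<le> integral C b"
    using nonneg by (intro integral_nonneg integrable_continuous[of _ _ b, folded C_def] cont[unfolded C_def]) (auto simp: C_def cont[unfolded C_def] intro: integrable_continuous)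
  ultimately have pos: "0 < integral C b"
    by simp
  show ?thesis
  proof
    show "Ck k (\<lambda>x. inverse (integral C b) * b x)" for k
      by (intro Ck_mult Ck_const b)
    show "0 \<le> inverse (integral C b) * b x" for x
      using nonneg pos by simp
    show "norm x < r" if "inverse (integral C b) * b x \<noteq> 0" for x
      using that supp by auto
    show "integral (cbox (\<chi> i. - r) (\<chi> i. r)) (\<lambda>x. inverse (integral C b) * b x) = 1"
      using pos by (simp add: C_def)
  qed
qed

text \<open>The derivative falls on the second factor, so the first factor only needs to be continuous. By
  \<open>convolution_commute\<close> either factor can be made the differentiable one: differentiating the
  mollifier shows that a mollified function is smooth, and differentiating the given function shows
  that the gradients are mollified as well.\<close>

lemma convolution_has_derivative:
  fixes f g :: "real^'n::finite \<Rightarrow> real"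
  assumes f: "continuous_on (cbox a b) f" and g: "Ck 1 g"
  shows "((\<lambda>x. integral (cbox a b) (\<lambda>t. f t * g (x - t))) has_derivative
      (\<lambda>h. integral (cbox a b) (\<lambda>t. f t *\<^sub>R grad g (x - t)) \<bullet> h)) (at x)"
proof -
  define D where "D = (\<lambda>x t. f t *\<^sub>R blinfun_inner_left (grad g (x - t)))"
  have gd: "g differentiable (at x)" for x
    using g by simp
  have gc: "continuous_on UNIV (grad g)" "continuous_on UNIV g"
    using continuous_grad[OF g] Ck_imp_continuous[OF g] by auto
  have "((\<lambda>x. integral (cbox a b) (\<lambda>t. f t * g (x - t))) has_derivative
      blinfun_apply (integral (cbox a b) (D x))) (at x within UNIV)"
  proof (rule leibniz_rule)
    fix x t
    have "((\<lambda>x. f t * g (x - t)) has_derivative (\<lambda>h. f t * (grad g (x - t) \<bullet> h))) (at x)"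
      by (rule has_derivative_mult_right has_derivative_compose[OF _ grad_has_derivative[OF gd]]
          derivative_eq_intros)+ auto
    moreover have "blinfun_apply (D x t) = (\<lambda>h. f t * (grad g (x - t) \<bullet> h))"
      by (auto simp: D_def blinfun.scaleR_left inner_commute)
    ultimately show "((\<lambda>x. f t * g (x - t)) has_derivative blinfun_apply (D x t)) (at x within UNIV)"
      by simp
  next
    show "(\<lambda>t. f t * g (x - t)) integrable_on cbox a b" for x
      by (intro integrable_continuous continuous_intros f continuous_on_compose2[OF gc(2)]) auto
  next
    show "continuous_on (UNIV \<times> cbox a b) (\<lambda>(x, t). D x t)"
      unfolding D_def split_beta
      by (intro continuous_intros continuous_on_compose2[OF f] continuous_on_compose2[OF gc(1)]
          bounded_linear.continuous_on[OF bounded_linear_blinfun_inner_left]) auto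
  qed auto
  moreover have "integral (cbox a b) (D x)
      = blinfun_inner_left (integral (cbox a b) (\<lambda>t. f t *\<^sub>R grad g (x - t)))"
  proof -
    have "(\<lambda>t. f t *\<^sub>R grad g (x - t)) integrable_on cbox a b"
      by (intro integrable_continuous continuous_intros f continuous_on_compose2[OF gc(1)]) auto
    from integral_linear[OF this bounded_linear_blinfun_inner_left] show ?thesis
      by (simp add: D_def o_def linear_cmul bounded_linear.linear[OF bounded_linear_blinfun_inner_left])
  qed
  ultimately show ?thesis
    by (simp add: inner_commute)
qed

lemma convolution_grad:
  fixes f g :: "real^'n::finite \<Rightarrow> real"
  assumes "continuous_on (cbox a b) f" "Ck 1 g"
  shows "grad (\<lambda>x. integral (cbox a b) (\<lambda>t. f t * g (x - t))) x
    = integral (cbox a b) (\<lambda>t. f t *\<^sub>R grad g (x - t))"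
  by (rule grad_eqI[OF convolution_has_derivative[OF assms]])

text \<open>Partial derivatives of the convolution are convolutions with partial derivatives of \<open>g\<close>; hence
  \<open>g\<close> is generalised in the induction.\<close>

lemma convolution_smooth:
  fixes f g :: "real^'n::finite \<Rightarrow> real"
  assumes f: "continuous_on (cbox a b) f" and "\<And>k. Ck k g"
  shows "Ck k (\<lambda>x. integral (cbox a b) (\<lambda>t. f t * g (x - t)))"
  using assms(2)
proof (induction k arbitrary: g)
  case 0
  have "(\<lambda>x. integral (cbox a b) (\<lambda>t. f t * g (x - t))) differentiable (at x)" for x
    using convolution_has_derivative[OF f 0[of 1]] by (auto simp: differentiable_def)
  then show ?case
    by (auto intro!: continuous_at_imp_continuous_on differentiable_imp_continuous_within)
next
  case (Suc k)
  have gc: "continuous_on UNIV (grad g)"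
    using continuous_grad Suc.prems by blast
  have "partial_deriv i (\<lambda>x. integral (cbox a b) (\<lambda>t. f t * g (x - t))) x
      = integral (cbox a b) (\<lambda>t. f t * partial_deriv i g (x - t))" for i x
  proof -
    have "(\<lambda>t. f t *\<^sub>R grad g (x - t)) integrable_on cbox a b"
      by (intro integrable_continuous continuous_intros f continuous_on_compose2[OF gc]) auto
    then have "integral (cbox a b) (\<lambda>t. (f t *\<^sub>R grad g (x - t)) $ i)
        = integral (cbox a b) (\<lambda>t. f t *\<^sub>R grad g (x - t)) $ i"
      by (rule integral_component_eq_cart)
    then show ?thesis
      using arg_cong[OF convolution_grad[OF f Suc.prems[of 1]], of "\<lambda>v. v $ i" x] by simp
  qed
  then have "partial_deriv i (\<lambda>x. integral (cbox a b) (\<lambda>t. f t * g (x - t)))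
      = (\<lambda>x. integral (cbox a b) (\<lambda>t. f t * partial_deriv i g (x - t)))" for i
    by auto
  moreover have "Ck j (partial_deriv i g)" for i j
    using Suc.prems[of "Suc j"] by simp
  moreover have "(\<lambda>x. integral (cbox a b) (\<lambda>t. f t * g (x - t))) differentiable (at x)" for x
    using convolution_has_derivative[OF f Suc.prems[of 1]] by (auto simp: differentiable_def)
  ultimately show ?case
    using Suc.IH by simp
qed

text \<open>The bounded set \<open>K\<close> reduces the claim to the affine substitution on boxes.\<close>

lemma has_integral_reflect_translate:
  fixes f :: "real^'n::finite \<Rightarrow> 'b::banach"
  assumes "(f has_integral I) UNIV" and "bounded K" and "\<And>x. x \<notin> K \<Longrightarrow> f x = 0"
  shows "((\<lambda>t. f (x - t)) has_integral I) UNIV"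
proof -
  obtain a where a: "K \<subseteq> cbox (- a) a"
    using bounded_subset_cbox_symmetric[OF \<open>bounded K\<close>] by blast
  have "f x = 0" if "x \<notin> cbox (- a) a" for x
    using that a assms(3) by blast
  then have "(\<lambda>x. if x \<in> cbox (- a) a then f x else 0) = f"
    by auto
  then have "(f has_integral I) (cbox (- a) a)"
    using assms(1) has_integral_restrict_UNIV[of "cbox (- a) a" f I] by simp
  from has_integral_affinity[OF this, of "- 1" x]
  have "((\<lambda>t. f (x - t)) has_integral I) ((\<lambda>t. x - t) ` cbox (- a) a)"
    by simp
  then show ?thesis
  proof (rule has_integral_on_superset)
    fix t assume t: "t \<notin> (\<lambda>t. x - t) ` cbox (- a) a"
    have "x - t \<notin> K"
    proof
      assume "x - t \<in> K"
      then have "x - (x - t) \<in> (\<lambda>t. x - t) ` cbox (- a) a"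
        using a by blast
      with t show False by simp
    qed
    with assms(3) show "f (x - t) = 0" by simp
  qed simp
qed

lemma has_integral_UNIV_of_support:
  fixes f :: "real^'n::finite \<Rightarrow> 'b::banach"
  assumes "continuous_on UNIV f" "\<And>x. x \<notin> cbox a b \<Longrightarrow> f x = 0"
  shows "(f has_integral integral (cbox a b) f) UNIV"
  by (rule has_integral_on_superset[of _ _ "cbox a b"])
    (use assms in \<open>auto intro!: integrable_integral integrable_continuous intro: continuous_on_subset\<close>)

lemma convolution_commute:
  fixes f g :: "real^'n::finite \<Rightarrow> real"
  assumes f: "continuous_on UNIV f" "\<And>t. t \<notin> cbox a b \<Longrightarrow> f t = 0"
    and g: "continuous_on UNIV g" "\<And>t. t \<notin> cbox c d \<Longrightarrow> g t = 0"
  shows "integral (cbox a b) (\<lambda>t. f t * g (x - t)) = integral (cbox c d) (\<lambda>t. g t * f (x - t))"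
proof -
  have "((\<lambda>t. f t * g (x - t)) has_integral integral (cbox a b) (\<lambda>t. f t * g (x - t))) UNIV"
    by (intro has_integral_UNIV_of_support continuous_intros f continuous_on_compose2[OF g(1)])
      (auto simp: f)
  from has_integral_reflect_translate[OF this bounded_cbox[of a b], of x]
  have "((\<lambda>t. g t * f (x - t)) has_integral integral (cbox a b) (\<lambda>t. f t * g (x - t))) UNIV"
    using f by (simp add: mult.commute)
  moreover have "((\<lambda>t. g t * f (x - t)) has_integral integral (cbox c d) (\<lambda>t. g t * f (x - t))) UNIV"
    by (intro has_integral_UNIV_of_support continuous_intros g continuous_on_compose2[OF f(1)])
      (auto simp: g)
  ultimately show ?thesis
    by (rule has_integral_unique)
qed

text \<open>Integrals over the whole space are translation invariant, so the convolution of \<open>h\<close> with the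
  constant \<open>1\<close> over a large box is constant near the origin. Its gradient at the origin is the
  integral of the reflected gradient of \<open>h\<close>.\<close>

lemma integral_grad_zero:
  fixes h :: "real^'n::finite \<Rightarrow> real"
  assumes h: "Ck 1 h" and K: "compact (closure {x. h x \<noteq> 0})"
  shows "(grad h has_integral 0) UNIV"
proof -
  let ?K = "closure {x. h x \<noteq> 0}"
  have hc: "continuous_on UNIV h" "continuous_on UNIV (grad h)"
    using Ck_imp_continuous[OF h] continuous_grad[OF h] by auto
  have h0: "h x = 0" "grad h x = 0" if "x \<notin> ?K" for x
    using that closure_subset[of "{x. h x \<noteq> 0}"] grad_outside_support by auto
  obtain R where R: "\<And>x. x \<in> ?K \<Longrightarrow> norm x \<le> R"
    using compact_imp_bounded[OF K] unfolding bounded_iff by blast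
  define A :: "real^'n" where "A = (\<chi> i. - (R + 1))"
  define B :: "real^'n" where "B = (\<chi> i. R + 1)"
  have AB: "x - t \<notin> ?K" if "t \<notin> cbox A B" "norm x < 1" for x t
  proof
    assume "x - t \<in> ?K"
    then have "norm t \<le> R + 1"
      using R[of "x - t"] that(2) norm_triangle_ineq4[of x "x - t"] by simp
    then show False
      using that(1) ball_subset_cube unfolding A_def B_def by blast
  qed
  have AB0: "t \<notin> ?K" if "t \<notin> cbox A B" for t
  proof
    assume "t \<in> ?K"
    then have "norm t \<le> R + 1"
      using R by fastforce
    then show False
      using that ball_subset_cube unfolding A_def B_def by blast
  qed
  have hI: "(h has_integral integral (cbox A B) h) UNIV"
    by (rule has_integral_UNIV_of_support[OF hc(1)]) (rule h0(1), rule AB0)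
  \<comment> \<open>The box exceeds the support by the margin \<open>1\<close>, so shifts by less than \<open>1\<close> stay inside.\<close>
  have const: "integral (cbox A B) (\<lambda>t. 1 * h (x - t)) = integral (cbox A B) h" if "norm x < 1" for x
  proof (rule has_integral_unique)
    show "((\<lambda>t. 1 * h (x - t)) has_integral integral (cbox A B) h) UNIV"
      using has_integral_reflect_translate[OF hI compact_imp_bounded[OF K] h0(1), of x] by simp
    show "((\<lambda>t. 1 * h (x - t)) has_integral integral (cbox A B) (\<lambda>t. 1 * h (x - t))) UNIV"
    proof (rule has_integral_UNIV_of_support)
      show "continuous_on UNIV (\<lambda>t. 1 * h (x - t))"
        by (intro continuous_intros continuous_on_compose2[OF hc(1)]) auto
      show "1 * h (x - t) = 0" if "t \<notin> cbox A B" for t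
        using h0(1)[OF AB[OF that \<open>norm x < 1\<close>]] by simp
    qed
  qed
  have "((\<lambda>x. integral (cbox A B) h) has_derivative (\<lambda>v. 0 \<bullet> v)) (at 0)"
    by simp
  then have "((\<lambda>x. integral (cbox A B) (\<lambda>t. 1 * h (x - t))) has_derivative (\<lambda>v. 0 \<bullet> v)) (at 0)"
    by (rule has_derivative_transform_within_open[of _ _ _ _ "ball 0 1"]) (use const in auto)
  then have "grad (\<lambda>x. integral (cbox A B) (\<lambda>t. 1 * h (x - t))) 0 = 0"
    by (rule grad_eqI)
  then have "integral (cbox A B) (\<lambda>t. grad h (0 - t)) = 0"
    using convolution_grad[OF continuous_on_const[of _ 1] h, of A B 0] by simp
  moreover have "((\<lambda>t. grad h (0 - t)) has_integral integral (cbox A B) (\<lambda>t. grad h (0 - t))) UNIV"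
  proof (rule has_integral_UNIV_of_support)
    show "continuous_on UNIV (\<lambda>t. grad h (0 - t))"
      by (intro continuous_intros continuous_on_compose2[OF hc(2)]) auto
    show "grad h (0 - t) = 0" if "t \<notin> cbox A B" for t
      using AB[OF that, of 0] by (intro h0(2)) simp
  qed
  ultimately have "((\<lambda>t. grad h (- t)) has_integral 0) UNIV"
    by simp
  then have "((\<lambda>t. grad h (- (0 - t))) has_integral 0) UNIV"
  proof (rule has_integral_reflect_translate)
    show "bounded (uminus ` ?K)"
      using compact_imp_bounded[OF K] by simp
    show "grad h (- x) = 0" if "x \<notin> uminus ` ?K" for x
    proof (rule h0(2))
      show "- x \<notin> ?K"
        using that by (metis image_eqI minus_minus)
    qed
  qed
  then show ?thesis
    by simp
qed

text \<open>A mollified function is a weighted mean of values of \<open>g\<close> at nearby points.\<close>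

lemma mollification_close:
  fixes g :: "real^'n::finite \<Rightarrow> 'b::euclidean_space"
  assumes g: "continuous_on UNIV g" and \<rho>: "continuous_on UNIV \<rho>" "\<And>t. 0 \<le> \<rho> t"
    "integral (cbox a b) \<rho> = 1"
    and close: "\<And>t. \<rho> t \<noteq> 0 \<Longrightarrow> norm (g (x - t) - g x) \<le> e"
  shows "norm (integral (cbox a b) (\<lambda>t. \<rho> t *\<^sub>R g (x - t)) - g x) \<le> e"
proof -
  have i\<rho>: "\<rho> integrable_on cbox a b"
    using \<rho> by (auto intro!: integrable_continuous intro: continuous_on_subset)
  have gc: "continuous_on (cbox a b) (\<lambda>t. g (x - t))"
    by (intro continuous_intros continuous_on_compose2[OF g]) auto
  have \<rho>c: "continuous_on (cbox a b) \<rho>"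
    using \<rho>(1) by (rule continuous_on_subset) simp
  have "integral (cbox a b) (\<lambda>t. \<rho> t *\<^sub>R g (x - t)) - g x
      = integral (cbox a b) (\<lambda>t. \<rho> t *\<^sub>R g (x - t)) - integral (cbox a b) (\<lambda>t. \<rho> t *\<^sub>R g x)"
    using integral_linear[OF i\<rho> bounded_linear_scaleR_left[of "g x"]] \<rho>(3) by (simp add: o_def)
  also have "\<dots> = integral (cbox a b) (\<lambda>t. \<rho> t *\<^sub>R g (x - t) - \<rho> t *\<^sub>R g x)"
    by (rule integral_diff[symmetric])
      (intro integrable_continuous continuous_intros gc \<rho>c)+
  also have "norm \<dots> \<le> integral (cbox a b) (\<lambda>t. e * \<rho> t)"
  proof (rule integral_norm_bound_integral)
    show "(\<lambda>t. \<rho> t *\<^sub>R g (x - t) - \<rho> t *\<^sub>R g x) integrable_on cbox a b"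
      by (intro integrable_continuous continuous_intros gc \<rho>c)
    show "(\<lambda>t. e * \<rho> t) integrable_on cbox a b"
      by (intro integrable_continuous continuous_intros \<rho>c)
    show "norm (\<rho> t *\<^sub>R g (x - t) - \<rho> t *\<^sub>R g x) \<le> e * \<rho> t" for t
      using close[of t] \<rho>(2)[of t]
      by (cases "\<rho> t = 0") (auto simp: scaleR_diff_right[symmetric] mult.commute intro: mult_right_mono)
  qed
  finally show ?thesis
    using \<rho>(3) by simp
qed

lemma compact_support_uniformly_continuous:
  fixes f :: "real^'n::finite \<Rightarrow> 'b::real_normed_vector"
  assumes f: "continuous_on UNIV f" and "bounded K" "\<And>x. x \<notin> K \<Longrightarrow> f x = 0" and "e > 0"
  obtains d where "d > 0" "\<And>x t. norm t < d \<Longrightarrow> norm (f (x - t) - f x) \<le> e"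
proof -
  obtain R where R: "\<And>x. x \<in> K \<Longrightarrow> norm x \<le> R"
    using \<open>bounded K\<close> unfolding bounded_iff by blast
  have "uniformly_continuous_on (cball 0 (R + 2)) f"
    using f by (intro compact_uniformly_continuous) (auto intro: continuous_on_subset)
  then obtain d where d: "d > 0" "\<And>x y. x \<in> cball 0 (R + 2) \<Longrightarrow> y \<in> cball 0 (R + 2) \<Longrightarrow>
      dist y x < d \<Longrightarrow> dist (f y) (f x) < e"
    unfolding uniformly_continuous_on_def using \<open>e > 0\<close> by metis
  show ?thesis
  proof
    show "min d 1 > 0" using d by simp
    fix x t :: "real^'n" assume t: "norm t < min d 1"
    show "norm (f (x - t) - f x) \<le> e"
    proof (cases "norm x \<le> R + 1")
      case True
      then have "x \<in> cball 0 (R + 2)" "x - t \<in> cball 0 (R + 2)"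
        using t norm_triangle_ineq4[of x t] by simp_all
      from d(2)[OF this] t show ?thesis
        by (simp add: dist_norm)
    next
      case False
      then have "x - t \<notin> K" "x \<notin> K"
        using R[of x] R[of "x - t"] t norm_triangle_ineq[of "x - t" t] by auto
      then show ?thesis
        using assms(3) \<open>e > 0\<close> by simp
    qed
  qed
qed

text \<open>Smooth functions are dense in the compactly supported continuous and \<open>C\<^sup>1\<close> functions, with uniform
  convergence of the functions and, in the second case, of their gradients. The mollification radius
  is smaller than the distance of the support to the complement of \<open>\<Omega>\<close>.\<close>

lemma test_function_approximation:
  fixes f :: "real^'n::finite \<Rightarrow> real"
  assumes "open \<Omega>" and f: "continuous_on UNIV f" and K: "compact (closure {x. f x \<noteq> 0})"
    and sub: "closure {x. f x \<noteq> 0} \<subseteq> \<Omega>" and "e > 0"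
  obtains \<eta> where "\<eta> \<in> test_functions \<Omega>" "\<And>x. \<bar>\<eta> x - f x\<bar> \<le> e"
    "Ck 1 f \<Longrightarrow> \<forall>x. norm (grad \<eta> x - grad f x) \<le> e"
proof -
  let ?K = "closure {x. f x \<noteq> 0}"
  have f0: "f x = 0" "grad f x = 0" if "x \<notin> ?K" for x
    using that closure_subset[of "{x. f x \<noteq> 0}"] grad_outside_support by auto
  obtain d0 where d0: "d0 > 0" "(\<Union>x\<in>?K. ball x d0) \<subseteq> \<Omega>"
    using compact_subset_open_imp_ball_epsilon_subset[OF K \<open>open \<Omega>\<close> sub] by blast
  obtain d1 where d1: "d1 > 0" "\<And>x t. norm t < d1 \<Longrightarrow> norm (f (x - t) - f x) \<le> e"
    by (rule compact_support_uniformly_continuous[OF f compact_imp_bounded[OF K] f0(1) \<open>e > 0\<close>])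
      (assumption, rule that)
  obtain d2 where d2: "d2 > 0"
    "\<And>x t. Ck 1 f \<Longrightarrow> norm t < d2 \<Longrightarrow> norm (grad f (x - t) - grad f x) \<le> e"
  proof (cases "Ck 1 f")
    case True
    show ?thesis
      by (rule compact_support_uniformly_continuous[OF continuous_grad[OF True] compact_imp_bounded[OF K]
            f0(2) \<open>e > 0\<close>]) (assumption, rule that)
  next
    case False
    then show ?thesis
      by (intro that[of 1]) auto
  qed
  define r where "r = min (d0 / 2) (min d1 d2)"
  have r: "r > 0" "r < d0" "r \<le> d1" "r \<le> d2"
    using d0 d1 d2 by (auto simp: r_def)
  define A :: "real^'n" where "A = (\<chi> i. - r)"
  define B :: "real^'n" where "B = (\<chi> i. r)"
  obtain \<rho> :: "real^'n \<Rightarrow> real" where \<rho>: "\<And>k. Ck k \<rho>" "\<And>x. 0 \<le> \<rho> x"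
      "\<And>x. \<rho> x \<noteq> 0 \<Longrightarrow> norm x < r" "integral (cbox A B) \<rho> = 1"
    using mollifier_exists[OF r(1)] unfolding A_def B_def by metis
  have \<rho>c: "continuous_on UNIV \<rho>"
    using \<rho>(1)[of 0] by simp
  have \<rho>0: "\<rho> t = 0" if "t \<notin> cbox A B" for t
    using that \<rho>(3)[of t] ball_subset_cube[of t r] unfolding A_def B_def by fastforce
  obtain c where c: "?K \<subseteq> cbox (- c) c"
    using bounded_subset_cbox_symmetric[OF compact_imp_bounded[OF K]] by blast
  have fc: "f t = 0" if "t \<notin> cbox (- c) c" for t
    using that c f0(1) by blast
  define \<eta> where "\<eta> = (\<lambda>x. integral (cbox (- c) c) (\<lambda>t. f t * \<rho> (x - t)))"
  have \<eta>': "\<eta> = (\<lambda>x. integral (cbox A B) (\<lambda>t. \<rho> t * f (x - t)))"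
    unfolding \<eta>_def by (rule ext) (rule convolution_commute[OF f fc \<rho>c \<rho>0])
  let ?S = "{k + t |k t. k \<in> ?K \<and> t \<in> cball 0 r}"
  have S: "compact ?S"
    by (rule compact_sums[OF K compact_cball])
  have supp: "x \<in> ?S" if "\<eta> x \<noteq> 0" for x
  proof -
    have "\<exists>t\<in>cbox A B. \<rho> t * f (x - t) \<noteq> 0"
    proof (rule ccontr)
      assume "\<not> ?thesis"
      then have "integral (cbox A B) (\<lambda>t. \<rho> t * f (x - t)) = integral (cbox A B) (\<lambda>t. 0)"
        by (intro integral_cong) auto
      with that show False by (simp add: \<eta>')
    qed
    then obtain t where t: "\<rho> t \<noteq> 0" "f (x - t) \<noteq> 0" by auto
    then have "x - t \<in> ?K"
      using f0(1) by blast
    moreover have "t \<in> cball 0 r"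
      using \<rho>(3)[OF t(1)] by simp
    moreover have "x = (x - t) + t"
      by simp
    ultimately show ?thesis by blast
  qed
  then have cl: "closure {x. \<eta> x \<noteq> 0} \<subseteq> ?S"
    by (intro closure_minimal compact_imp_closed[OF S] subsetI, intro supp) simp
  have "?S \<subseteq> \<Omega>"
  proof
    fix x assume "x \<in> ?S"
    then obtain k t where "x = k + t" "k \<in> ?K" "norm t \<le> r"
      by auto
    then have "x \<in> ball k d0"
      using r(2) by (simp add: dist_norm)
    with \<open>k \<in> ?K\<close> show "x \<in> \<Omega>"
      using d0(2) by blast
  qed
  show ?thesis
  proof
    have "Ck k \<eta>" for k
      unfolding \<eta>_def using f \<rho>(1) by (intro convolution_smooth) (auto intro: continuous_on_subset)
    moreover have "compact (closure {x. \<eta> x \<noteq> 0})"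
    proof -
      have "{x. \<eta> x \<noteq> 0} \<subseteq> ?S"
        by (rule subsetI, rule supp) simp
      with compact_imp_bounded[OF S] have "bounded {x. \<eta> x \<noteq> 0}"
        by (rule bounded_subset)
      then show ?thesis
        by (rule compact_closure[THEN iffD2])
    qed
    ultimately show "\<eta> \<in> test_functions \<Omega>"
      using order_trans[OF cl \<open>?S \<subseteq> \<Omega>\<close>] unfolding test_functions_def by simp
    show "\<bar>\<eta> x - f x\<bar> \<le> e" for x
    proof -
      have "norm (f (x - t) - f x) \<le> e" if "\<rho> t \<noteq> 0" for t
        using d1(2) \<rho>(3)[OF that] r(3) by simp
      from mollification_close[OF f \<rho>c \<rho>(2,4) this] show ?thesis
        by (simp add: \<eta>')
    qed
    show "\<forall>x. norm (grad \<eta> x - grad f x) \<le> e" if "Ck 1 f"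
    proof
      fix x
      have "grad \<eta> x = integral (cbox A B) (\<lambda>t. \<rho> t *\<^sub>R grad f (x - t))"
        unfolding \<eta>' using \<rho>c that by (intro convolution_grad) (auto intro: continuous_on_subset)
      moreover have "norm (grad f (x - t) - grad f x) \<le> e" if "\<rho> t \<noteq> 0" for t
        using d2(2)[OF \<open>Ck 1 f\<close>] \<rho>(3)[OF that] r(4) by simp
      ultimately show "norm (grad \<eta> x - grad f x) \<le> e"
        using mollification_close[OF continuous_grad[OF that] \<rho>c \<rho>(2,4)] by simp
    qed
  qed
qed

section \<open>Weak gradients on bounded open sets\<close>

lemma compact_closure_subset:
  fixes A B :: "'a::t2_space set"
  assumes "closure A \<subseteq> B" "compact B"
  shows "compact (closure A)"
proof -
  have "B \<inter> closure A = closure A"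
    using assms(1) by blast
  then show ?thesis
    using compact_Int_closed[OF assms(2) closed_closure, of A] by simp
qed

text \<open>The functions \<open>1 - c\<^sub>m dist(x, K)\<close>, cut off at \<open>0\<close>, with slopes \<open>c\<^sub>m\<close> that tend to infinity. The
  summand \<open>2 / d\<close> in the slopes keeps all supports within distance \<open>d / 2\<close> of \<open>K\<close>, hence in \<open>\<Omega>\<close>.\<close>

lemma approximate_indicator:
  fixes K :: "(real^'n::finite) set"
  assumes "compact K" "open \<Omega>" "K \<subseteq> \<Omega>" "K \<noteq> {}"
  obtains f :: "nat \<Rightarrow> real^'n \<Rightarrow> real"
  where "\<And>m. continuous_on UNIV (f m)" "\<And>m. compact (closure {x. f m x \<noteq> 0})"
    "\<And>m. closure {x. f m x \<noteq> 0} \<subseteq> \<Omega>" "\<And>m x. 0 \<le> f m x" "\<And>m x. f m x \<le> 1"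
    "\<And>x. (\<lambda>m. f m x) \<longlonglongrightarrow> indicator K x"
proof -
  obtain d where d: "d > 0" "(\<Union>x\<in>K. ball x d) \<subseteq> \<Omega>"
    using compact_subset_open_imp_ball_epsilon_subset[OF assms(1-3)] by blast
  define c where "c m = real m + 2 / d" for m
  define f where "f m x = max 0 (1 - c m * infdist x K)" for m x
  have cpos: "c m > 0" and c2: "1 / c m \<le> d / 2" for m
    using d(1) by (auto simp: c_def field_simps add_pos_nonneg add_nonneg_pos)
  have supp: "closure {x. f m x \<noteq> 0} \<subseteq> {x. infdist x K \<le> 1 / c m}" for m
  proof (rule closure_minimal)
    show "closed {x. infdist x K \<le> 1 / c m}"
      using cpos[of m] by (intro compact_imp_closed compact_infdist_le assms) simp
    show "{x. f m x \<noteq> 0} \<subseteq> {x. infdist x K \<le> 1 / c m}"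
      using cpos[of m] by (auto simp: f_def max_def field_simps split: if_splits)
  qed
  have comp: "compact {x. infdist x K \<le> 1 / c m}" for m
    using cpos[of m] by (intro compact_infdist_le assms) simp
  have sub: "{x. infdist x K \<le> 1 / c m} \<subseteq> \<Omega>" for m
  proof
    fix x assume "x \<in> {x. infdist x K \<le> 1 / c m}"
    then have "infdist x K < d"
      using c2[of m] d(1) by simp
    moreover obtain k where "k \<in> K" "infdist x K = dist x k"
      using infdist_attains_inf[OF compact_imp_closed[OF assms(1)] assms(4)] by blast
    ultimately have "x \<in> ball k d"
      by (simp add: dist_commute)
    with \<open>k \<in> K\<close> show "x \<in> \<Omega>"
      using d(2) by blast
  qed
  show ?thesis
  proof
    show "continuous_on UNIV (f m)" for m
      unfolding f_def by (intro continuous_intros)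
    show "compact (closure {x. f m x \<noteq> 0})" for m
      using supp[of m] comp[of m] by (rule compact_closure_subset)
    show "closure {x. f m x \<noteq> 0} \<subseteq> \<Omega>" for m
      using supp[of m] sub[of m] by (rule order_trans)
    show "0 \<le> f m x" for m x
      by (simp add: f_def)
    show "f m x \<le> 1" for m x
      using cpos[of m] infdist_nonneg[of x K] by (simp add: f_def)
    show "(\<lambda>m. f m x) \<longlonglongrightarrow> indicator K x" for x
    proof (cases "x \<in> K")
      case True
      then show ?thesis by (simp add: f_def)
    next
      case False
      then have pos: "infdist x K > 0"
        using in_closed_iff_infdist_zero[OF compact_imp_closed[OF assms(1)] assms(4)] infdist_nonneg[of x K]
        by (simp add: less_le)
      have "eventually (\<lambda>m. f m x = 0) sequentially"
      proof -
        obtain N where N: "real N > 1 / infdist x K"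
          using reals_Archimedean2 by blast
        have "f m x = 0" if "N \<le> m" for m
        proof -
          have "real N \<le> real m" "0 < 2 / d"
            using that d(1) by simp_all
          then have "c m > 1 / infdist x K"
            using N unfolding c_def by linarith
          then show ?thesis
            using pos by (simp add: f_def field_simps)
        qed
        then show ?thesis
          by (auto simp: eventually_sequentially)
      qed
      then show ?thesis
        using False by (simp add: tendsto_eventually)
    qed
  qed
qed

text \<open>On a bounded open set every continuous function on the whole space is square integrable, and \<open>L\<^sup>2\<close> is
  contained in \<open>L\<^sup>1\<close>. Hence products with test functions are integrable throughout.\<close>

locale bounded_open_set =
  fixes \<Omega> :: "(real^'n::finite) set"
  assumes open_dom: "open \<Omega>" and bounded_dom: "bounded \<Omega>"
begin

lemma dom_lebesgue [simp]: "\<Omega> \<in> sets lebesgue"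
  using borel_open[OF open_dom] by (intro sets_completionI_sets) simp

lemma dom_sets_iff: "A \<in> sets (lebesgue_on \<Omega>) \<longleftrightarrow> A \<subseteq> \<Omega> \<and> A \<in> sets lebesgue"
  by (rule sets_restrict_space_iff) simp

lemma compact_sets_dom:
  assumes "compact K" "K \<subseteq> \<Omega>"
  shows "K \<in> sets (lebesgue_on \<Omega>)"
proof -
  have "K \<in> sets lebesgue"
    using borel_compact[OF assms(1)] by (intro sets_completionI_sets) simp
  with assms(2) show ?thesis
    unfolding dom_sets_iff by blast
qed

lemma dom_lmeasurable: "\<Omega> \<in> lmeasurable"
  using bounded_set_imp_lmeasurable[OF bounded_dom] by simp

lemma dom_finite_measure: "finite_measure (lebesgue_on \<Omega>)"
  by (rule finite_measure_lebesgue_on[OF dom_lmeasurable])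

lemma continuous_measurable:
  assumes "continuous_on UNIV f"
  shows "f \<in> borel_measurable (lebesgue_on \<Omega>)"
  by (rule continuous_imp_measurable_on_sets_lebesgue[OF continuous_on_subset[OF assms subset_UNIV] dom_lebesgue])

lemma continuous_integrable:
  fixes f :: "real^'n \<Rightarrow> real"
  assumes "continuous_on UNIV f"
  shows "integrable (lebesgue_on \<Omega>) f"
proof -
  have "compact (f ` closure \<Omega>)"
    using bounded_dom by (intro compact_continuous_image continuous_on_subset[OF assms]) auto
  from compact_imp_bounded[OF this] obtain B where B: "\<forall>y\<in>f ` closure \<Omega>. norm y \<le> B"
    unfolding bounded_iff by blast
  have "norm (f x) \<le> B" if "x \<in> \<Omega>" for x
    using B closure_subset[of \<Omega>] that by blast
  then have "AE x in lebesgue_on \<Omega>. norm (f x) \<le> B"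
    by (intro AE_I2) simp
  then show ?thesis
    by (rule finite_measure.integrable_const_bound[OF dom_finite_measure])
      (rule continuous_measurable[OF assms])
qed

lemma L2_borel: "u \<in> L2 \<Omega> \<Longrightarrow> u \<in> borel_measurable (lebesgue_on \<Omega>)"
  and L2_square_integrable: "u \<in> L2 \<Omega> \<Longrightarrow> integrable (lebesgue_on \<Omega>) (\<lambda>x. (u x)\<^sup>2)"
  unfolding L2_def mem_Collect_eq by (rule conjunct1, assumption) (rule conjunct2)

lemma continuous_L2: "continuous_on UNIV f \<Longrightarrow> f \<in> L2 \<Omega>"
  unfolding L2_def mem_Collect_eq
  by (intro conjI continuous_measurable continuous_integrable continuous_on_power)

lemma L2_mult_integrable:
  assumes "u \<in> L2 \<Omega>" "v \<in> L2 \<Omega>"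
  shows "integrable (lebesgue_on \<Omega>) (\<lambda>x. u x * v x)"
proof (rule Bochner_Integration.integrable_bound)
  show "integrable (lebesgue_on \<Omega>) (\<lambda>x. (u x)\<^sup>2 + (v x)\<^sup>2)"
    using assms by (intro Bochner_Integration.integrable_add L2_square_integrable)
  show "(\<lambda>x. u x * v x) \<in> borel_measurable (lebesgue_on \<Omega>)"
    using assms by (intro borel_measurable_times L2_borel)
  have "norm (a * b) \<le> norm (a\<^sup>2 + b\<^sup>2)" for a b :: real
  proof -
    have "2 * \<bar>a\<bar> * \<bar>b\<bar> \<le> a\<^sup>2 + b\<^sup>2" "0 \<le> \<bar>a\<bar> * \<bar>b\<bar>"
      using sum_squares_bound[of "\<bar>a\<bar>" "\<bar>b\<bar>"] by simp_all
    moreover have "norm (a * b) = \<bar>a\<bar> * \<bar>b\<bar>" "norm (a\<^sup>2 + b\<^sup>2) = a\<^sup>2 + b\<^sup>2"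
      by (simp_all add: abs_mult)
    ultimately show ?thesis
      by linarith
  qed
  then show "AE x in lebesgue_on \<Omega>. norm (u x * v x) \<le> norm ((u x)\<^sup>2 + (v x)\<^sup>2)"
    by (intro AE_I2)
qed

lemma L2_diff:
  assumes "u \<in> L2 \<Omega>" "v \<in> L2 \<Omega>"
  shows "(\<lambda>x. u x - v x) \<in> L2 \<Omega>"
proof -
  have "integrable (lebesgue_on \<Omega>) (\<lambda>x. (u x)\<^sup>2 + (v x)\<^sup>2 - 2 * (u x * v x))"
    using assms by (intro Bochner_Integration.integrable_add Bochner_Integration.integrable_diff
        integrable_mult_right L2_square_integrable L2_mult_integrable)
  then have "integrable (lebesgue_on \<Omega>) (\<lambda>x. (u x - v x)\<^sup>2)"
    by (simp add: power2_diff mult.assoc)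
  then show ?thesis
    using assms by (simp add: L2_def borel_measurable_diff)
qed

lemma L2_integrable:
  assumes "u \<in> L2 \<Omega>"
  shows "integrable (lebesgue_on \<Omega>) u"
  using L2_mult_integrable[OF assms continuous_L2[OF continuous_on_const[of _ 1]]] by simp

lemma test_functionsD:
  assumes "\<eta> \<in> test_functions \<Omega>"
  shows "Ck k \<eta>" "continuous_on UNIV \<eta>" "continuous_on UNIV (grad \<eta>)"
    "continuous_on UNIV (partial_deriv i \<eta>)"
proof -
  show Ck: "Ck k \<eta>" for k
    using assms by (simp add: test_functions_def)
  show "continuous_on UNIV \<eta>" "continuous_on UNIV (grad \<eta>)"
    "continuous_on UNIV (partial_deriv i \<eta>)"
    by (rule Ck_imp_continuous[OF Ck[of 1]] continuous_grad[OF Ck] Ck_1_partial_continuous[OF Ck])+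
qed

text \<open>Integration by parts: the integral of the gradient of \<open>\<eta> \<zeta>\<close> vanishes.\<close>

lemma test_function_has_weak_partial:
  assumes \<eta>: "\<eta> \<in> test_functions \<Omega>"
  shows "has_weak_partial \<Omega> i \<eta> (partial_deriv i \<eta>)"
  unfolding has_weak_partial_def
proof
  fix \<zeta> assume \<zeta>: "\<zeta> \<in> test_functions \<Omega>"
  note D = test_functionsD[OF \<eta>] test_functionsD[OF \<zeta>]
  let ?h = "\<lambda>x. \<eta> x * \<zeta> x"
  have supp: "closure {x. ?h x \<noteq> 0} \<subseteq> closure {x. \<zeta> x \<noteq> 0}"
    by (rule closure_mono) auto
  have h: "Ck 1 ?h"
    using D by (intro Ck_mult)
  have K: "compact (closure {x. \<zeta> x \<noteq> 0})" "closure {x. \<zeta> x \<noteq> 0} \<subseteq> \<Omega>"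
    using \<zeta> by (simp_all add: test_functions_def)
  have "compact (closure {x. ?h x \<noteq> 0})"
    using supp K(1) by (rule compact_closure_subset)
  from integral_grad_zero[OF h this]
  have "(grad ?h has_integral 0) UNIV" .
  then have "grad ?h integrable_on UNIV" "integral UNIV (grad ?h) = 0"
    by (auto simp: has_integral_integrable_integral)
  then have "integral UNIV (\<lambda>x. grad ?h x $ i) = 0"
    by (simp only: integral_component_eq_cart zero_index)
  moreover have "grad ?h x $ i = (if x \<in> \<Omega> then partial_deriv i ?h x else 0)" for x
  proof (cases "x \<in> \<Omega>")
    case False
    then have "x \<notin> closure {x. ?h x \<noteq> 0}"
      using supp K(2) by blast
    from grad_outside_support[OF this] False show ?thesis
      by (simp only: zero_index if_False)
  qed simp
  ultimately have "integral \<Omega> (partial_deriv i ?h) = 0"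
    by (simp only: integral_restrict_UNIV)
  moreover have "integrable (lebesgue_on \<Omega>) (partial_deriv i ?h)"
    using h by (intro continuous_integrable) simp
  ultimately have "(LINT x|lebesgue_on \<Omega>. partial_deriv i ?h x) = 0"
    by (simp add: lebesgue_integral_eq_integral)
  moreover have "partial_deriv i ?h x = \<eta> x * partial_deriv i \<zeta> x + partial_deriv i \<eta> x * \<zeta> x" for x
  proof -
    have "\<eta> differentiable (at x)" "\<zeta> differentiable (at x)"
      using D(1)[of 1] D(5)[of 1] by auto
    from partial_deriv_eq[OF has_derivative_mult[OF this[THEN has_derivative_frechet]]]
    show ?thesis by (simp add: partial_deriv_def)
  qed
  moreover have "(LINT x|lebesgue_on \<Omega>. \<eta> x * partial_deriv i \<zeta> x + partial_deriv i \<eta> x * \<zeta> x)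
      = (LINT x|lebesgue_on \<Omega>. \<eta> x * partial_deriv i \<zeta> x) + (LINT x|lebesgue_on \<Omega>. partial_deriv i \<eta> x * \<zeta> x)"
    using D by (intro Bochner_Integration.integral_add continuous_integrable continuous_intros)
  ultimately show "(LINT x|lebesgue_on \<Omega>. \<eta> x * partial_deriv i \<zeta> x)
      = - (LINT x|lebesgue_on \<Omega>. partial_deriv i \<eta> x * \<zeta> x)"
    by simp
qed

text \<open>Replacing \<open>f\<close> by a uniformly \<open>e\<close>-close test function changes the integral by at most \<open>e\<close> times the
  \<open>L\<^sup>1\<close> norm of \<open>v\<close>, which is finite because \<open>\<Omega>\<close> is bounded.\<close>

lemma orthogonal_to_continuous:
  assumes v: "v \<in> L2 \<Omega>" and orth: "\<And>\<eta>. \<eta> \<in> test_functions \<Omega> \<Longrightarrow> (LINT x|lebesgue_on \<Omega>. v x * \<eta> x) = 0"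
    and f: "continuous_on UNIV f" "compact (closure {x. f x \<noteq> 0})" "closure {x. f x \<noteq> 0} \<subseteq> \<Omega>"
  shows "(LINT x|lebesgue_on \<Omega>. v x * f x) = 0"
proof -
  let ?I = "LINT x|lebesgue_on \<Omega>. \<bar>v x\<bar>"
  have iv: "integrable (lebesgue_on \<Omega>) (\<lambda>x. \<bar>v x\<bar>)"
    using L2_integrable[OF v] by simp
  have "\<bar>LINT x|lebesgue_on \<Omega>. v x * f x\<bar> \<le> e * ?I" if e: "e > 0" for e :: real
  proof -
    obtain \<eta> where \<eta>: "\<eta> \<in> test_functions \<Omega>" "\<And>x. \<bar>\<eta> x - f x\<bar> \<le> e"
      using test_function_approximation[OF open_dom f e] by metis
    have vf: "integrable (lebesgue_on \<Omega>) (\<lambda>x. v x * f x)" "integrable (lebesgue_on \<Omega>) (\<lambda>x. v x * \<eta> x)"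
      using f(1) \<eta>(1) v by (auto intro!: L2_mult_integrable continuous_L2 test_functionsD)
    have "(LINT x|lebesgue_on \<Omega>. v x * f x) = (LINT x|lebesgue_on \<Omega>. v x * f x - v x * \<eta> x)"
      using Bochner_Integration.integral_diff[OF vf] orth[OF \<eta>(1)] by simp
    also have "\<bar>\<dots>\<bar> \<le> (LINT x|lebesgue_on \<Omega>. e * \<bar>v x\<bar>)"
    proof (rule integral_abs_bound_integral)
      show "integrable (lebesgue_on \<Omega>) (\<lambda>x. v x * f x - v x * \<eta> x)"
        using vf by (rule Bochner_Integration.integrable_diff)
      show "integrable (lebesgue_on \<Omega>) (\<lambda>x. e * \<bar>v x\<bar>)"
        using iv by simp
      show "\<bar>v x * f x - v x * \<eta> x\<bar> \<le> e * \<bar>v x\<bar>" for x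
      proof -
        have "v x * f x - v x * \<eta> x = v x * (f x - \<eta> x)"
          by (simp add: right_diff_distrib)
        then show ?thesis
          using mult_left_mono[OF \<eta>(2)[of x], of "\<bar>v x\<bar>"]
          by (simp only: abs_mult abs_minus_commute[of "f x"] mult.commute[of e])
      qed
    qed
    finally show ?thesis by simp
  qed
  then have "eventually (\<lambda>e. \<bar>LINT x|lebesgue_on \<Omega>. v x * f x\<bar> \<le> e * ?I) (at_right 0)"
    by (intro eventually_mono[OF eventually_at_right_less])
  moreover have "((\<lambda>e. e * ?I) \<longlongrightarrow> 0 * ?I) (at_right 0)"
    by (intro tendsto_mult_right tendsto_ident_at)
  ultimately have "\<bar>LINT x|lebesgue_on \<Omega>. v x * f x\<bar> \<le> 0 * ?I"
    by (intro tendsto_lowerbound) auto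
  then show ?thesis by simp
qed

lemma orthogonal_to_compact_indicator:
  assumes v: "v \<in> L2 \<Omega>" and orth: "\<And>\<eta>. \<eta> \<in> test_functions \<Omega> \<Longrightarrow> (LINT x|lebesgue_on \<Omega>. v x * \<eta> x) = 0"
    and K: "compact K" "K \<subseteq> \<Omega>"
  shows "(LINT x|lebesgue_on \<Omega>. v x * indicator K x) = 0"
proof (cases "K = {}")
  case False
  obtain f :: "nat \<Rightarrow> real^'n \<Rightarrow> real" where f: "\<And>m. continuous_on UNIV (f m)" "\<And>m. compact (closure {x. f m x \<noteq> 0})"
    "\<And>m. closure {x. f m x \<noteq> 0} \<subseteq> \<Omega>" "\<And>m x. 0 \<le> f m x" "\<And>m x. f m x \<le> 1"
    "\<And>x. (\<lambda>m. f m x) \<longlonglongrightarrow> indicator K x"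
    using approximate_indicator[OF K(1) open_dom K(2) False] by metis
  have KL: "K \<in> sets (lebesgue_on \<Omega>)"
    using K by (rule compact_sets_dom)
  have "(\<lambda>m. LINT x|lebesgue_on \<Omega>. v x * f m x) \<longlonglongrightarrow> (LINT x|lebesgue_on \<Omega>. v x * indicator K x)"
  proof (rule integral_dominated_convergence[where w = "\<lambda>x. \<bar>v x\<bar>"])
    show "(\<lambda>x. v x * indicator K x) \<in> borel_measurable (lebesgue_on \<Omega>)"
      using L2_borel[OF v] KL by measurable
    show "(\<lambda>x. v x * f m x) \<in> borel_measurable (lebesgue_on \<Omega>)" for m
      using L2_borel[OF v] continuous_measurable[OF f(1)[of m]] by measurable
    show "integrable (lebesgue_on \<Omega>) (\<lambda>x. \<bar>v x\<bar>)"
      using L2_integrable[OF v] by simp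
    show "AE x in lebesgue_on \<Omega>. (\<lambda>m. v x * f m x) \<longlonglongrightarrow> v x * indicator K x"
      by (intro AE_I2 tendsto_mult_left f(6))
    show "AE x in lebesgue_on \<Omega>. norm (v x * f m x) \<le> \<bar>v x\<bar>" for m
      using f(4,5) by (intro AE_I2) (simp add: abs_mult mult_left_le)
  qed
  moreover have "(LINT x|lebesgue_on \<Omega>. v x * f m x) = 0" for m
    by (rule orthogonal_to_continuous[OF v orth f(1-3)])
  ultimately have "(\<lambda>m::nat. 0) \<longlonglongrightarrow> (LINT x|lebesgue_on \<Omega>. v x * indicator K x)"
    by simp
  then show ?thesis
    by (rule LIMSEQ_unique[OF _ tendsto_const])
qed simp

text \<open>Up to a null set \<open>{v > 0}\<close> is a countable union of compact sets. The integral of \<open>v\<close> over each of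
  them is zero although \<open>v\<close> is positive there, so each of them is a null set.\<close>

lemma orthogonal_imp_nonpos:
  assumes v: "v \<in> L2 \<Omega>" and orth: "\<And>\<eta>. \<eta> \<in> test_functions \<Omega> \<Longrightarrow> (LINT x|lebesgue_on \<Omega>. v x * \<eta> x) = 0"
  shows "AE x in lebesgue_on \<Omega>. v x \<le> 0"
proof -
  let ?A = "{x \<in> \<Omega>. v x > 0}"
  have "{x \<in> space (lebesgue_on \<Omega>). v x > 0} \<in> sets (lebesgue_on \<Omega>)"
    using L2_borel[OF v] by measurable
  then have A: "?A \<in> sets lebesgue"
    by (simp add: dom_sets_iff)
  obtain C N where C: "fsigma C" "N \<in> null_sets lebesgue" "C \<union> N = ?A" "disjnt C N"
    using lebesgue_set_almost_fsigma[OF A] .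
  from C(1) obtain F :: "nat \<Rightarrow> (real^'n) set" where rF: "range F \<subseteq> Collect compact" "C = (\<Union>n. F n)"
    unfolding fsigma_Union_compact by blast
  then have F: "compact (F n)" for n
    by blast
  have "F n \<in> null_sets lebesgue" for n
  proof -
    have FA: "F n \<subseteq> ?A"
      using rF(2) C(3) by blast
    then have Fs: "F n \<in> sets (lebesgue_on \<Omega>)"
      by (intro compact_sets_dom F) blast
    have "(LINT x|lebesgue_on \<Omega>. v x * indicator (F n) x) = 0"
      using FA by (intro orthogonal_to_compact_indicator v orth F) auto
    moreover have "integrable (lebesgue_on \<Omega>) (\<lambda>x. v x * indicator (F n) x)"
      using Fs by (intro integrable_real_mult_indicator L2_integrable v)
    moreover have "AE x in lebesgue_on \<Omega>. 0 \<le> v x * indicator (F n) x"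
      using FA by (intro AE_I2) (auto simp: indicator_def)
    ultimately have "AE x in lebesgue_on \<Omega>. v x * indicator (F n) x = 0"
      using integral_nonneg_eq_0_iff_AE by blast
    then have "AE x in lebesgue_on \<Omega>. x \<notin> F n"
      by eventually_elim (use FA in \<open>auto simp: indicator_def split: if_splits\<close>)
    then have "F n \<in> null_sets (lebesgue_on \<Omega>)"
      using AE_iff_null_sets[OF Fs] by blast
    then show ?thesis
      by (simp add: null_sets_restrict_space)
  qed
  then have "C \<in> null_sets lebesgue"
    unfolding rF(2) by (rule null_sets_UN)
  then have "?A \<in> null_sets lebesgue"
    using null_sets.Un[OF _ C(2), of C] C(3) by simp
  then have "?A \<in> null_sets (lebesgue_on \<Omega>)"
    by (simp add: null_sets_restrict_space)
  then have "AE x in lebesgue_on \<Omega>. x \<notin> ?A"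
    by (rule AE_not_in)
  then show ?thesis
    using AE_space by eventually_elim auto
qed

text \<open>The fundamental lemma of the calculus of variations.\<close>

lemma orthogonal_imp_zero:
  assumes v: "v \<in> L2 \<Omega>" and orth: "\<And>\<eta>. \<eta> \<in> test_functions \<Omega> \<Longrightarrow> (LINT x|lebesgue_on \<Omega>. v x * \<eta> x) = 0"
  shows "AE x in lebesgue_on \<Omega>. v x = 0"
proof -
  have "(\<lambda>x. - v x) \<in> L2 \<Omega>"
    using v by (simp add: L2_def)
  then have "AE x in lebesgue_on \<Omega>. - v x \<le> 0"
    by (rule orthogonal_imp_nonpos) (simp add: orth)
  moreover have "AE x in lebesgue_on \<Omega>. v x \<le> 0"
    using v by (rule orthogonal_imp_nonpos) (rule orth)
  ultimately show ?thesis
    by eventually_elim auto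
qed

lemma weak_partial_unique:
  assumes "v \<in> L2 \<Omega>" "has_weak_partial \<Omega> i u v" "w \<in> L2 \<Omega>" "has_weak_partial \<Omega> i u w"
  shows "AE x in lebesgue_on \<Omega>. v x = w x"
proof -
  have "AE x in lebesgue_on \<Omega>. v x - w x = 0"
  proof (rule orthogonal_imp_zero)
    show "(\<lambda>x. v x - w x) \<in> L2 \<Omega>"
      using assms by (intro L2_diff)
    fix \<eta> assume \<eta>: "\<eta> \<in> test_functions \<Omega>"
    then have "\<eta> \<in> L2 \<Omega>"
      by (intro continuous_L2 test_functionsD)
    then have "(LINT x|lebesgue_on \<Omega>. v x * \<eta> x - w x * \<eta> x)
        = (LINT x|lebesgue_on \<Omega>. v x * \<eta> x) - (LINT x|lebesgue_on \<Omega>. w x * \<eta> x)"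
      using assms by (intro Bochner_Integration.integral_diff L2_mult_integrable)
    also have "\<dots> = 0"
      using assms \<eta> unfolding has_weak_partial_def by force
    finally show "(LINT x|lebesgue_on \<Omega>. (v x - w x) * \<eta> x) = 0"
      by (simp add: left_diff_distrib)
  qed
  then show ?thesis by eventually_elim simp
qed

text \<open>The components of \<^const>\<open>weak_grad\<close> are picked by a choice operator. This lemma identifies them
  with any weak partial derivatives that are at hand.\<close>

lemma weak_grad_unique:
  assumes "\<And>i. v i \<in> L2 \<Omega>" "\<And>i. has_weak_partial \<Omega> i u (v i)"
  shows "AE x in lebesgue_on \<Omega>. weak_grad \<Omega> u x = (\<chi> i. v i x)"
proof -
  have "AE x in lebesgue_on \<Omega>. \<forall>i\<in>UNIV. weak_grad \<Omega> u x $ i = v i x"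
  proof (rule AE_finite_allI)
    show "AE x in lebesgue_on \<Omega>. weak_grad \<Omega> u x $ i = v i x" for i
    proof -
      let ?P = "\<lambda>v. v \<in> L2 \<Omega> \<and> has_weak_partial \<Omega> i u v"
      have "?P (SOME v. ?P v)"
        using assms by (intro someI_ex[of ?P]) blast
      then have "AE x in lebesgue_on \<Omega>. (SOME v. ?P v) x = v i x"
        by (elim conjE) (rule weak_partial_unique[OF _ _ assms])
      then show ?thesis
        by (simp add: weak_grad_def)
    qed
  qed simp
  then show ?thesis
    by eventually_elim (simp add: vec_eq_iff)
qed

lemma weak_grad_H1:
  assumes "u \<in> H1 \<Omega>"
  shows "(\<lambda>x. weak_grad \<Omega> u x $ i) \<in> L2 \<Omega>" "has_weak_partial \<Omega> i u (\<lambda>x. weak_grad \<Omega> u x $ i)"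
proof -
  let ?P = "\<lambda>v. v \<in> L2 \<Omega> \<and> has_weak_partial \<Omega> i u v"
  have "?P (SOME v. ?P v)"
    using assms by (intro someI_ex[of ?P]) (auto simp: H1_def)
  then show "(\<lambda>x. weak_grad \<Omega> u x $ i) \<in> L2 \<Omega>" "has_weak_partial \<Omega> i u (\<lambda>x. weak_grad \<Omega> u x $ i)"
    by (simp_all add: weak_grad_def)
qed

lemma weak_grad_test_function:
  assumes "\<eta> \<in> test_functions \<Omega>"
  shows "AE x in lebesgue_on \<Omega>. weak_grad \<Omega> \<eta> x = grad \<eta> x"
proof -
  have "AE x in lebesgue_on \<Omega>. weak_grad \<Omega> \<eta> x = (\<chi> i. partial_deriv i \<eta> x)"
  proof (rule weak_grad_unique)
    show "partial_deriv i \<eta> \<in> L2 \<Omega>" for i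
      using assms by (intro continuous_L2 test_functionsD(4))
    show "has_weak_partial \<Omega> i \<eta> (partial_deriv i \<eta>)" for i
      using assms by (rule test_function_has_weak_partial)
  qed
  then show ?thesis
    by (simp only: grad_def)
qed

lemma weak_partial_diff_test_function:
  assumes u: "u \<in> H1 \<Omega>" and \<eta>: "\<eta> \<in> test_functions \<Omega>"
  shows "(\<lambda>x. weak_grad \<Omega> u x $ i - partial_deriv i \<eta> x) \<in> L2 \<Omega>"
    and "has_weak_partial \<Omega> i (\<lambda>x. u x - \<eta> x) (\<lambda>x. weak_grad \<Omega> u x $ i - partial_deriv i \<eta> x)"
proof -
  have c: "partial_deriv i \<eta> \<in> L2 \<Omega>"
    using \<eta> by (intro continuous_L2 test_functionsD)
  show "(\<lambda>x. weak_grad \<Omega> u x $ i - partial_deriv i \<eta> x) \<in> L2 \<Omega>"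
    by (intro L2_diff weak_grad_H1 u c)
  show "has_weak_partial \<Omega> i (\<lambda>x. u x - \<eta> x) (\<lambda>x. weak_grad \<Omega> u x $ i - partial_deriv i \<eta> x)"
    unfolding has_weak_partial_def
  proof
    fix \<zeta> assume \<zeta>: "\<zeta> \<in> test_functions \<Omega>"
    have L2: "u \<in> L2 \<Omega>" "\<eta> \<in> L2 \<Omega>" "\<zeta> \<in> L2 \<Omega>" "partial_deriv i \<zeta> \<in> L2 \<Omega>"
      using u \<eta> \<zeta> by (auto simp: H1_def intro!: continuous_L2 test_functionsD)
    have "(LINT x|lebesgue_on \<Omega>. u x * partial_deriv i \<zeta> x - \<eta> x * partial_deriv i \<zeta> x)
        = (LINT x|lebesgue_on \<Omega>. u x * partial_deriv i \<zeta> x) - (LINT x|lebesgue_on \<Omega>. \<eta> x * partial_deriv i \<zeta> x)"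
      using L2 by (intro Bochner_Integration.integral_diff L2_mult_integrable)
    also have "\<dots> = - ((LINT x|lebesgue_on \<Omega>. weak_grad \<Omega> u x $ i * \<zeta> x)
        - (LINT x|lebesgue_on \<Omega>. partial_deriv i \<eta> x * \<zeta> x))"
      using weak_grad_H1(2)[OF u, of i] test_function_has_weak_partial[OF \<eta>, of i] \<zeta>
      unfolding has_weak_partial_def by simp
    also have "(LINT x|lebesgue_on \<Omega>. weak_grad \<Omega> u x $ i * \<zeta> x)
        - (LINT x|lebesgue_on \<Omega>. partial_deriv i \<eta> x * \<zeta> x)
        = (LINT x|lebesgue_on \<Omega>. weak_grad \<Omega> u x $ i * \<zeta> x - partial_deriv i \<eta> x * \<zeta> x)"
      using L2 c weak_grad_H1(1)[OF u] by (intro Bochner_Integration.integral_diff[symmetric] L2_mult_integrable)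
    finally show "(LINT x|lebesgue_on \<Omega>. (u x - \<eta> x) * partial_deriv i \<zeta> x)
        = - (LINT x|lebesgue_on \<Omega>. (weak_grad \<Omega> u x $ i - partial_deriv i \<eta> x) * \<zeta> x)"
      by (simp add: left_diff_distrib)
  qed
qed

lemma diff_test_function_H1:
  assumes u: "u \<in> H1 \<Omega>" and \<eta>: "\<eta> \<in> test_functions \<Omega>"
  shows "(\<lambda>x. u x - \<eta> x) \<in> H1 \<Omega>"
proof -
  have "u \<in> L2 \<Omega>" "\<eta> \<in> L2 \<Omega>"
    using u \<eta> by (auto simp: H1_def intro!: continuous_L2 test_functionsD)
  then have "(\<lambda>x. u x - \<eta> x) \<in> L2 \<Omega>"
    by (rule L2_diff)
  then show ?thesis
    using weak_partial_diff_test_function[OF u \<eta>] unfolding H1_def by blast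
qed

lemma weak_grad_diff_test_function:
  assumes u: "u \<in> H1 \<Omega>" and \<eta>: "\<eta> \<in> test_functions \<Omega>"
  shows "AE x in lebesgue_on \<Omega>. weak_grad \<Omega> (\<lambda>x. u x - \<eta> x) x = weak_grad \<Omega> u x - grad \<eta> x"
proof -
  have "AE x in lebesgue_on \<Omega>. weak_grad \<Omega> (\<lambda>x. u x - \<eta> x) x
      = (\<chi> i. weak_grad \<Omega> u x $ i - partial_deriv i \<eta> x)"
    by (rule weak_grad_unique) (rule weak_partial_diff_test_function[OF u \<eta>])+
  then show ?thesis
    by eventually_elim (simp add: vec_eq_iff)
qed

end

section \<open>Hardy inequalities for test functions and for $C^1$ functions\<close>

definition dirichlet_energy :: "(real^'n::finite) set \<Rightarrow> (real^'n \<Rightarrow> real) \<Rightarrow> ennreal"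
  where "dirichlet_energy \<Omega> f = (\<integral>\<^sup>+x. ennreal ((norm (grad f x))\<^sup>2) \<partial>lebesgue_on \<Omega>)"

text \<open>Both sides are numbers in \<open>[0, \<infinity>]\<close>. If the denominator is infinite and the energy finite, the
  inequality forces \<open>c = 0\<close>, in agreement with the convention that the quotient is then \<open>0\<close>.\<close>

definition hardy_inequality ::
    "(real^'n::finite) set \<Rightarrow> (real^'n) set \<Rightarrow> real \<Rightarrow> (real^'n \<Rightarrow> real) \<Rightarrow> bool"
  where "hardy_inequality \<Omega> S c f \<longleftrightarrow>
    ennreal c * hardy_denominator \<Omega> S f \<le> dirichlet_energy \<Omega> f"

lemma norm_square_vec: "(norm (x::real^'n::finite))\<^sup>2 = (\<Sum>i\<in>UNIV. (x $ i)\<^sup>2)"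
  unfolding power2_norm_eq_inner inner_vec_def by (simp add: power2_eq_square)

text \<open>Young's inequality with a free weight: letting \<open>s\<close> tend to \<open>0\<close> after \<open>y\<close> tends to \<open>g\<close> recovers the
  sharp bound.\<close>

lemma norm_square_le_weighted:
  fixes g y :: "'a::real_normed_vector"
  assumes "s > 0"
  shows "(norm y)\<^sup>2 \<le> (1 + s) * (norm g)\<^sup>2 + (1 + 1 / s) * (norm (g - y))\<^sup>2"
proof -
  define p where "p = norm g"
  define q where "q = norm (g - y)"
  have "norm y \<le> p + q"
    unfolding p_def q_def using norm_triangle_ineq4[of g "g - y"] by simp
  then have "(norm y)\<^sup>2 \<le> (p + q)\<^sup>2"
    by (rule power_mono) simp
  also have "\<dots> = p\<^sup>2 + q\<^sup>2 + 2 * p * q"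
    by (rule power2_sum)
  also have "2 * p * q \<le> s * p\<^sup>2 + q\<^sup>2 / s"
  proof -
    have "0 \<le> (s * p - q)\<^sup>2 / s"
      using assms by simp
    also have "\<dots> = s * p\<^sup>2 + q\<^sup>2 / s - 2 * p * q"
      using assms by (simp add: power2_eq_square field_simps)
    finally show ?thesis by simp
  qed
  finally show ?thesis
    by (simp add: p_def q_def algebra_simps)
qed

context bounded_open_set
begin

text \<open>An open set is disjoint from its frontier, and the frontier is closed.\<close>

lemma infdist_pos:
  assumes "S \<subseteq> frontier \<Omega>" "S \<noteq> {}" "x \<in> \<Omega>"
  shows "infdist x S > 0"
proof -
  have "closure S \<subseteq> frontier \<Omega>"
    using assms(1) by (intro closure_minimal) auto
  moreover have "\<Omega> \<inter> frontier \<Omega> = {}"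
    using open_dom by (auto simp: frontier_def interior_open)
  ultimately have "x \<notin> closure S"
    using assms(3) by blast
  then show ?thesis
    using assms(2) infdist_nonneg[of x S] by (auto simp: in_closure_iff_infdist_zero less_le)
qed

lemma norm_square_integrable:
  assumes "\<And>i. (\<lambda>x. G x $ i) \<in> L2 \<Omega>"
  shows "integrable (lebesgue_on \<Omega>) (\<lambda>x. (norm (G x))\<^sup>2)"
  unfolding norm_square_vec
  by (intro Bochner_Integration.integrable_sum L2_square_integrable assms)

lemma grad_L2: "Ck 1 f \<Longrightarrow> (\<lambda>x. grad f x $ i) \<in> L2 \<Omega>"
  by (intro continuous_L2) simp

lemma dirichlet_energy_eq:
  assumes "Ck 1 f"
  shows "dirichlet_energy \<Omega> f = ennreal (LINT x|lebesgue_on \<Omega>. (norm (grad f x))\<^sup>2)"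
  unfolding dirichlet_energy_def
  by (rule nn_integral_eq_integral[OF norm_square_integrable[OF grad_L2[OF assms]]]) simp

lemma borel_measurable_hardy_integrand:
  assumes "u \<in> borel_measurable (lebesgue_on \<Omega>)"
  shows "(\<lambda>x. ennreal ((u x)\<^sup>2 / (infdist x S)\<^sup>2)) \<in> borel_measurable (lebesgue_on \<Omega>)"
proof -
  have "(\<lambda>x. infdist x S) \<in> borel_measurable (lebesgue_on \<Omega>)"
    by (intro continuous_measurable continuous_on_infdist continuous_on_id)
  with assms show ?thesis
    by measurable
qed

text \<open>The energies on the right converge. On the left a subsequence converges almost everywhere, and
  Fatou's lemma bounds the denominator of the limit; in particular a limit with infinite denominator
  is covered.\<close>

lemma hardy_inequality_closure:
  assumes c: "0 \<le> c" and hardy: "\<And>\<eta>. \<eta> \<in> test_functions \<Omega> \<Longrightarrow> hardy_inequality \<Omega> S c \<eta>"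
    and u: "u \<in> L2 \<Omega>" and G: "\<And>i. (\<lambda>x. G x $ i) \<in> L2 \<Omega>"
    and \<eta>: "\<And>n. \<eta> n \<in> test_functions \<Omega>"
    and u_lim: "(\<lambda>n. LINT x|lebesgue_on \<Omega>. (u x - \<eta> n x)\<^sup>2) \<longlonglongrightarrow> 0"
    and G_lim: "(\<lambda>n. LINT x|lebesgue_on \<Omega>. (norm (G x - grad (\<eta> n) x))\<^sup>2) \<longlonglongrightarrow> 0"
  shows "ennreal c * hardy_denominator \<Omega> S u \<le> ennreal (LINT x|lebesgue_on \<Omega>. (norm (G x))\<^sup>2)"
proof (cases "c = 0")
  case False
  with c have cpos: "c > 0" by simp
  define I where "I = (LINT x|lebesgue_on \<Omega>. (norm (G x))\<^sup>2)"
  define a where "a n = (LINT x|lebesgue_on \<Omega>. (norm (G x - grad (\<eta> n) x))\<^sup>2)" for n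
  have \<eta>1: "Ck 1 (\<eta> n)" for n
    using \<eta> by (rule test_functionsD)
  have \<eta>L2: "\<eta> n \<in> L2 \<Omega>" for n
    by (intro continuous_L2 test_functionsD(2) \<eta>)
  have iG: "integrable (lebesgue_on \<Omega>) (\<lambda>x. (norm (G x))\<^sup>2)"
    by (rule norm_square_integrable[OF G])
  have ia: "integrable (lebesgue_on \<Omega>) (\<lambda>x. (norm (G x - grad (\<eta> n) x))\<^sup>2)" for n
  proof (rule norm_square_integrable)
    show "(\<lambda>x. (G x - grad (\<eta> n) x) $ i) \<in> L2 \<Omega>" for i
      unfolding vector_minus_component by (intro L2_diff G grad_L2 \<eta>1)
  qed
  have energy_le: "dirichlet_energy \<Omega> (\<eta> n) \<le> ennreal ((1 + s) * I + (1 + 1 / s) * a n)" if "s > 0" for s n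
  proof -
    have "(LINT x|lebesgue_on \<Omega>. (norm (grad (\<eta> n) x))\<^sup>2)
        \<le> (LINT x|lebesgue_on \<Omega>. (1 + s) * (norm (G x))\<^sup>2 + (1 + 1 / s) * (norm (G x - grad (\<eta> n) x))\<^sup>2)"
      by (intro integral_mono norm_square_integrable[OF grad_L2[OF \<eta>1]] norm_square_le_weighted that
          Bochner_Integration.integrable_add integrable_mult_right iG ia)
    also have "\<dots> = (1 + s) * I + (1 + 1 / s) * a n"
      using iG ia by (simp add: I_def a_def)
    finally show ?thesis
      by (simp add: dirichlet_energy_eq[OF \<eta>1] ennreal_leI)
  qed
  obtain r :: "nat \<Rightarrow> nat" where r: "strict_mono r"
    and AE0: "AE x in lebesgue_on \<Omega>. (\<lambda>n. (u x - \<eta> (r n) x)\<^sup>2) \<longlonglongrightarrow> 0"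
  proof -
    have "\<exists>r::nat\<Rightarrow>nat. strict_mono r \<and> (AE x in lebesgue_on \<Omega>. (\<lambda>n. (u x - \<eta> (r n) x)\<^sup>2) \<longlonglongrightarrow> 0)"
    proof (rule tendsto_L1_AE_subseq)
      show "integrable (lebesgue_on \<Omega>) (\<lambda>x. (u x - \<eta> n x)\<^sup>2)" for n
        by (intro L2_square_integrable L2_diff u \<eta>L2)
      show "(\<lambda>n. LINT x|lebesgue_on \<Omega>. norm ((u x - \<eta> n x)\<^sup>2)) \<longlonglongrightarrow> 0"
        using u_lim by simp
    qed
    then show ?thesis
      using that by blast
  qed
  have AE1: "AE x in lebesgue_on \<Omega>. (\<lambda>n. \<eta> (r n) x) \<longlonglongrightarrow> u x"
    using AE0
  proof eventually_elim
    case (elim x)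
    then have "(\<lambda>n. sqrt ((u x - \<eta> (r n) x)\<^sup>2)) \<longlonglongrightarrow> sqrt 0"
      by (rule tendsto_real_sqrt)
    then have "(\<lambda>n. u x - \<eta> (r n) x) \<longlonglongrightarrow> 0"
      by (simp add: tendsto_rabs_zero_iff)
    then have "(\<lambda>n. u x - (u x - \<eta> (r n) x)) \<longlonglongrightarrow> u x - 0"
      by (intro tendsto_diff tendsto_const)
    then show ?case by simp
  qed
  have meas: "(\<lambda>x. ennreal ((\<eta> n x)\<^sup>2 / (infdist x S)\<^sup>2)) \<in> borel_measurable (lebesgue_on \<Omega>)" for n
    by (intro borel_measurable_hardy_integrand continuous_measurable test_functionsD(2) \<eta>)
  have Fatou: "hardy_denominator \<Omega> S u \<le> liminf (\<lambda>n. hardy_denominator \<Omega> S (\<eta> (r n)))"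
  proof -
    have "hardy_denominator \<Omega> S u
        = (\<integral>\<^sup>+x. liminf (\<lambda>n. ennreal ((\<eta> (r n) x)\<^sup>2 / (infdist x S)\<^sup>2)) \<partial>lebesgue_on \<Omega>)"
      unfolding hardy_denominator_def
    proof (rule nn_integral_cong_AE)
      show "AE x in lebesgue_on \<Omega>. ennreal ((u x)\<^sup>2 / (infdist x S)\<^sup>2)
          = liminf (\<lambda>n. ennreal ((\<eta> (r n) x)\<^sup>2 / (infdist x S)\<^sup>2))"
        using AE1
      proof eventually_elim
        case (elim x)
        have "(\<lambda>n. (\<eta> (r n) x)\<^sup>2 / (infdist x S)\<^sup>2) \<longlonglongrightarrow> (u x)\<^sup>2 / (infdist x S)\<^sup>2"
          unfolding divide_inverse by (intro tendsto_mult_right tendsto_power elim)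
        then have "(\<lambda>n. ennreal ((\<eta> (r n) x)\<^sup>2 / (infdist x S)\<^sup>2)) \<longlonglongrightarrow> ennreal ((u x)\<^sup>2 / (infdist x S)\<^sup>2)"
          by (rule tendsto_ennrealI)
        then show ?case
          by (rule lim_imp_Liminf[OF sequentially_bot, symmetric])
      qed
    qed
    also have "\<dots> \<le> liminf (\<lambda>n. hardy_denominator \<Omega> S (\<eta> (r n)))"
      unfolding hardy_denominator_def by (rule nn_integral_liminf[OF meas])
    finally show ?thesis .
  qed
  have cancel: "ennreal (1 / c) * (ennreal c * D) = D" for D
    using cpos by (simp add: mult.assoc[symmetric] ennreal_mult[symmetric])
  have bound: "hardy_denominator \<Omega> S u \<le> ennreal ((1 + s) * I / c)" if s: "s > 0" for s
  proof -
    let ?R = "\<lambda>n. ((1 + s) * I + (1 + 1 / s) * a (r n)) / c"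
    have "hardy_denominator \<Omega> S (\<eta> (r n)) \<le> ennreal (?R n)" for n
    proof -
      have "ennreal c * hardy_denominator \<Omega> S (\<eta> (r n)) \<le> ennreal ((1 + s) * I + (1 + 1 / s) * a (r n))"
        using hardy[OF \<eta>] energy_le[OF s] unfolding hardy_inequality_def by (rule order_trans)
      then have "ennreal (1 / c) * (ennreal c * hardy_denominator \<Omega> S (\<eta> (r n)))
          \<le> ennreal (1 / c) * ennreal ((1 + s) * I + (1 + 1 / s) * a (r n))"
        by (rule mult_left_mono) simp
      also have "\<dots> = ennreal (?R n)"
        using cpos by (simp add: ennreal_mult'[symmetric])
      finally show ?thesis
        by (simp only: cancel)
    qed
    then have "liminf (\<lambda>n. hardy_denominator \<Omega> S (\<eta> (r n))) \<le> liminf (\<lambda>n. ennreal (?R n))"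
      by (intro Liminf_mono always_eventually allI)
    also have "\<dots> = ennreal ((1 + s) * I / c)"
    proof (rule lim_imp_Liminf[OF sequentially_bot])
      have "(\<lambda>n. a (r n)) \<longlonglongrightarrow> 0"
        using LIMSEQ_subseq_LIMSEQ[OF G_lim r] by (simp add: a_def o_def)
      then have "?R \<longlonglongrightarrow> ((1 + s) * I + (1 + 1 / s) * 0) / c"
        using cpos by (intro tendsto_divide tendsto_add tendsto_mult tendsto_const) simp_all
      then show "(\<lambda>n. ennreal (?R n)) \<longlonglongrightarrow> ennreal ((1 + s) * I / c)"
        by (intro tendsto_ennrealI) simp
    qed
    finally show ?thesis
      using Fatou by (rule order_trans[rotated])
  qed
  have "hardy_denominator \<Omega> S u \<le> ennreal (I / c)"
  proof (rule LIMSEQ_le_const)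
    have "(\<lambda>n. (1 + 1 / real (Suc n)) * I / c) \<longlonglongrightarrow> (1 + 0) * I / c"
      using cpos by (intro tendsto_divide tendsto_add tendsto_mult tendsto_const LIMSEQ_Suc[OF lim_1_over_n]) simp_all
    then show "(\<lambda>n. ennreal ((1 + 1 / real (Suc n)) * I / c)) \<longlonglongrightarrow> ennreal (I / c)"
      by (intro tendsto_ennrealI) simp
    show "\<exists>N. \<forall>n\<ge>N. hardy_denominator \<Omega> S u \<le> ennreal ((1 + 1 / real (Suc n)) * I / c)"
      by (intro exI[of _ 0] allI impI bound) simp
  qed
  then have "ennreal c * hardy_denominator \<Omega> S u \<le> ennreal c * ennreal (I / c)"
    by (rule mult_left_mono) simp
  also have "\<dots> = ennreal I"
    using cpos by (simp add: ennreal_mult'[symmetric])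
  finally show ?thesis
    by (simp add: I_def)
qed simp

lemma zero_test_function: "(\<lambda>x. 0) \<in> test_functions \<Omega>"
  by (simp add: test_functions_def Ck_const)

lemma test_function_H1:
  assumes "\<eta> \<in> test_functions \<Omega>"
  shows "\<eta> \<in> H1 \<Omega>"
proof -
  have "\<eta> \<in> L2 \<Omega>" "partial_deriv i \<eta> \<in> L2 \<Omega>" for i
    by (rule continuous_L2[OF test_functionsD(2)[OF assms]] continuous_L2[OF test_functionsD(4)[OF assms]])+
  then show ?thesis
    using test_function_has_weak_partial[OF assms] unfolding H1_def by blast
qed

text \<open>The approximating sequence is constant. That \<^const>\<open>H1_norm\<close> vanishes at \<open>0\<close> still requires
  uniqueness of the weak gradient.\<close>

lemma test_function_H1_0:
  assumes "\<eta> \<in> test_functions \<Omega>"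
  shows "\<eta> \<in> H1_0 \<Omega>"
proof -
  have g0: "grad (\<lambda>x. 0) x = 0" for x :: "real^'n"
    by (rule grad_eqI) simp
  have "(LINT x|lebesgue_on \<Omega>. (norm (weak_grad \<Omega> (\<lambda>x. 0) x))\<^sup>2) = 0"
  proof (rule integral_eq_zero_AE)
    show "AE x in lebesgue_on \<Omega>. (norm (weak_grad \<Omega> (\<lambda>x. 0) x))\<^sup>2 = 0"
      using weak_grad_test_function[OF zero_test_function] by eventually_elim (simp add: g0)
  qed
  then have "H1_norm \<Omega> (\<lambda>x. \<eta> x - \<eta> x) = 0"
    by (simp add: H1_norm_def)
  then show ?thesis
    using assms test_function_H1[OF assms] unfolding H1_0_def by force
qed

lemma hardy_quotient_nonneg: "0 \<le> hardy_quotient \<Omega> S u"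
  by (simp add: hardy_quotient_def)

text \<open>A test function that does not vanish almost everywhere is a competitor in the infimum.\<close>

lemma hardy_constant_imp_test_inequality:
  assumes c: "0 \<le> c" "c \<le> hardy_constant \<Omega> S" and \<eta>: "\<eta> \<in> test_functions \<Omega>"
  shows "hardy_inequality \<Omega> S c \<eta>"
proof (cases "AE x in lebesgue_on \<Omega>. \<eta> x = 0")
  case True
  then have "AE x in lebesgue_on \<Omega>. ennreal ((\<eta> x)\<^sup>2 / (infdist x S)\<^sup>2) = 0"
    by eventually_elim simp
  then have "hardy_denominator \<Omega> S \<eta> = (\<integral>\<^sup>+x. 0 \<partial>lebesgue_on \<Omega>)"
    unfolding hardy_denominator_def by (rule nn_integral_cong_AE)
  then show ?thesis
    by (simp add: hardy_inequality_def)
next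
  case False
  let ?D = "hardy_denominator \<Omega> S \<eta>"
  let ?E = "LINT x|lebesgue_on \<Omega>. (norm (grad \<eta> x))\<^sup>2"
  have \<eta>1: "Ck 1 \<eta>"
    using \<eta> by (rule test_functionsD)
  have "hardy_constant \<Omega> S \<le> hardy_quotient \<Omega> S \<eta>"
    unfolding hardy_constant_def
  proof (rule cInf_lower)
    show "hardy_quotient \<Omega> S \<eta> \<in> {hardy_quotient \<Omega> S u |u. u \<in> H1_0 \<Omega> \<and> \<not> (AE x in lebesgue_on \<Omega>. u x = 0)}"
      using False test_function_H1_0[OF \<eta>] by blast
    show "bdd_below {hardy_quotient \<Omega> S u |u. u \<in> H1_0 \<Omega> \<and> \<not> (AE x in lebesgue_on \<Omega>. u x = 0)}"
      by (rule bdd_belowI[of _ 0]) (auto simp: hardy_quotient_nonneg)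
  qed
  with c have cq: "c \<le> hardy_quotient \<Omega> S \<eta>"
    by simp
  have energy: "(LINT x|lebesgue_on \<Omega>. (norm (weak_grad \<Omega> \<eta> x))\<^sup>2) = ?E"
  proof (rule integral_cong_AE)
    show "(\<lambda>x. (norm (weak_grad \<Omega> \<eta> x))\<^sup>2) \<in> borel_measurable (lebesgue_on \<Omega>)"
      by (intro borel_measurable_integrable norm_square_integrable weak_grad_H1 test_function_H1 \<eta>)
    show "(\<lambda>x. (norm (grad \<eta> x))\<^sup>2) \<in> borel_measurable (lebesgue_on \<Omega>)"
      by (intro borel_measurable_integrable norm_square_integrable grad_L2 \<eta>1)
    show "AE x in lebesgue_on \<Omega>. (norm (weak_grad \<Omega> \<eta> x))\<^sup>2 = (norm (grad \<eta> x))\<^sup>2"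
      using weak_grad_test_function[OF \<eta>] by eventually_elim simp
  qed
  from cq have cE: "c \<le> (if ?D = \<infinity> then 0 else ?E / enn2real ?D)"
    by (simp only: hardy_quotient_def energy)
  have "ennreal c * ?D \<le> ennreal ?E"
  proof (cases "?D = \<infinity>")
    case True
    with cE c have "c = 0" by simp
    then show ?thesis by simp
  next
    case False
    then obtain d where d: "?D = ennreal d" "0 \<le> d"
      by (cases ?D) auto
    show ?thesis
    proof (cases "d = 0")
      case False
      with cE d have "c * d \<le> ?E"
        by (simp add: field_simps)
      then show ?thesis
        using c d by (simp add: ennreal_mult[symmetric] ennreal_leI)
    qed (simp add: d)
  qed
  then show ?thesis
    by (simp add: hardy_inequality_def dirichlet_energy_eq[OF \<eta>1])
qed

text \<open>This makes the set of competitors non-empty, without which its infimum would carry no information.\<close>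

lemma nonzero_test_function_exists:
  assumes "\<Omega> \<noteq> {}"
  obtains \<eta> where "\<eta> \<in> test_functions \<Omega>" "\<not> (AE x in lebesgue_on \<Omega>. \<eta> x = 0)"
proof -
  obtain x0 where x0: "x0 \<in> \<Omega>"
    using assms by blast
  have K: "compact {x0}" "{x0} \<subseteq> \<Omega>" "{x0} \<noteq> {}"
    using x0 by auto
  obtain f :: "nat \<Rightarrow> real^'n \<Rightarrow> real" where f: "\<And>m. continuous_on UNIV (f m)" "\<And>m. compact (closure {x. f m x \<noteq> 0})"
    "\<And>m. closure {x. f m x \<noteq> 0} \<subseteq> \<Omega>" "\<And>x. (\<lambda>m. f m x) \<longlonglongrightarrow> indicator {x0} x"
    by (rule approximate_indicator[OF K(1) open_dom K(2,3)]) (rule that)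
  have "eventually (\<lambda>m. f m x0 > 1 / 2) sequentially"
    using f(4)[of x0] by (intro order_tendstoD) auto
  then obtain m where m: "f m x0 > 1 / 2"
    unfolding eventually_sequentially by blast
  obtain \<eta> where \<eta>: "\<eta> \<in> test_functions \<Omega>" "\<And>x. \<bar>\<eta> x - f m x\<bar> \<le> 1 / 4"
    by (rule test_function_approximation[OF open_dom f(1-3)[of m], of "1 / 4"]) (simp, rule that)
  let ?U = "{x \<in> \<Omega>. \<eta> x > 0}"
  have "open (\<Omega> \<inter> {x. 0 < \<eta> x})"
    by (intro open_Int open_dom open_Collect_less continuous_on_const test_functionsD(2)[OF \<eta>(1)])
  moreover have "?U = \<Omega> \<inter> {x. 0 < \<eta> x}"
    by blast
  ultimately have "open ?U"
    by simp
  moreover have "\<eta> x0 > 0"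
    using m \<eta>(2)[of x0] by linarith
  ultimately have nn: "\<not> negligible ?U"
    using open_not_negligible x0 by blast
  show ?thesis
  proof
    show "\<eta> \<in> test_functions \<Omega>" by fact
    show "\<not> (AE x in lebesgue_on \<Omega>. \<eta> x = 0)"
    proof
      assume "AE x in lebesgue_on \<Omega>. \<eta> x = 0"
      then have "AE x in lebesgue. x \<in> \<Omega> \<longrightarrow> \<eta> x = 0"
        by (simp add: AE_restrict_space_iff)
      then have "AE x in lebesgue. x \<notin> ?U"
        by eventually_elim auto
      then have "?U \<in> null_sets lebesgue"
        using AE_iff_null_sets[of ?U lebesgue] borel_open[OF \<open>open ?U\<close>] by simp
      with nn show False
        by (simp add: negligible_iff_null_sets)
    qed
  qed
qed

text \<open>Every competitor is by definition an \<open>H\<^sup>1\<close> limit of test functions, so it inherits their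
  inequality. A competitor has a positive denominator, and dividing by it gives the bound on the
  quotient.\<close>

lemma test_inequality_imp_hardy_constant:
  assumes "\<Omega> \<noteq> {}" "S \<subseteq> frontier \<Omega>" "S \<noteq> {}" and c: "0 \<le> c"
    and hardy: "\<And>\<eta>. \<eta> \<in> test_functions \<Omega> \<Longrightarrow> hardy_inequality \<Omega> S c \<eta>"
  shows "c \<le> hardy_constant \<Omega> S"
  unfolding hardy_constant_def
proof (rule cInf_greatest)
  obtain \<eta> where "\<eta> \<in> test_functions \<Omega>" "\<not> (AE x in lebesgue_on \<Omega>. \<eta> x = 0)"
    using nonzero_test_function_exists[OF assms(1)] .
  then show "{hardy_quotient \<Omega> S u |u. u \<in> H1_0 \<Omega> \<and> \<not> (AE x in lebesgue_on \<Omega>. u x = 0)} \<noteq> {}"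
    using test_function_H1_0 by blast
next
  fix q assume "q \<in> {hardy_quotient \<Omega> S u |u. u \<in> H1_0 \<Omega> \<and> \<not> (AE x in lebesgue_on \<Omega>. u x = 0)}"
  then obtain u where q: "q = hardy_quotient \<Omega> S u" and u0: "u \<in> H1_0 \<Omega>"
    and nz: "\<not> (AE x in lebesgue_on \<Omega>. u x = 0)"
    by blast
  let ?D = "hardy_denominator \<Omega> S u"
  let ?E = "LINT x|lebesgue_on \<Omega>. (norm (weak_grad \<Omega> u x))\<^sup>2"
  have u: "u \<in> H1 \<Omega>" and uL2: "u \<in> L2 \<Omega>"
    using u0 by (simp_all add: H1_0_def H1_def)
  have "\<exists>\<eta>\<in>test_functions \<Omega>. H1_norm \<Omega> (\<lambda>x. u x - \<eta> x) < e" if "e > 0" for e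
    using u0 that by (simp add: H1_0_def)
  then have "\<exists>\<eta>. \<eta> \<in> test_functions \<Omega> \<and> H1_norm \<Omega> (\<lambda>x. u x - \<eta> x) < 1 / real (Suc n)" for n
    using zero_less_divide_1_iff[of "real (Suc n)"] of_nat_0_less_iff[of "Suc n"] by (meson zero_less_Suc)
  then obtain \<eta> where \<eta>: "\<And>n. \<eta> n \<in> test_functions \<Omega>"
      and small: "\<And>n. H1_norm \<Omega> (\<lambda>x. u x - \<eta> n x) < 1 / real (Suc n)"
    by metis
  have zero: "(\<lambda>n. (1 / real (Suc n))\<^sup>2) \<longlonglongrightarrow> 0"
    by (rule tendsto_power[OF LIMSEQ_Suc[OF lim_1_over_n], of 2, unfolded zero_power2])
  have parts: "(LINT x|lebesgue_on \<Omega>. (u x - \<eta> n x)\<^sup>2) \<le> (1 / real (Suc n))\<^sup>2"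
    "(LINT x|lebesgue_on \<Omega>. (norm (weak_grad \<Omega> (\<lambda>x. u x - \<eta> n x) x))\<^sup>2) \<le> (1 / real (Suc n))\<^sup>2" for n
  proof -
    let ?A = "LINT x|lebesgue_on \<Omega>. (u x - \<eta> n x)\<^sup>2"
    let ?B = "LINT x|lebesgue_on \<Omega>. (norm (weak_grad \<Omega> (\<lambda>x. u x - \<eta> n x) x))\<^sup>2"
    have nonneg: "0 \<le> ?A" "0 \<le> ?B"
      by simp_all
    have "sqrt (?A + ?B) < 1 / real (Suc n)"
      using small[of n] by (simp only: H1_norm_def)
    then have "(sqrt (?A + ?B))\<^sup>2 \<le> (1 / real (Suc n))\<^sup>2"
      using nonneg by (intro power_mono) simp_all
    moreover have "(sqrt (?A + ?B))\<^sup>2 = ?A + ?B"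
      using nonneg by (intro real_sqrt_pow2) simp
    ultimately have "?A + ?B \<le> (1 / real (Suc n))\<^sup>2"
      by simp
    with nonneg show "?A \<le> (1 / real (Suc n))\<^sup>2" "?B \<le> (1 / real (Suc n))\<^sup>2"
      by linarith+
  qed
  have gradeq: "(LINT x|lebesgue_on \<Omega>. (norm (weak_grad \<Omega> u x - grad (\<eta> n) x))\<^sup>2)
      = (LINT x|lebesgue_on \<Omega>. (norm (weak_grad \<Omega> (\<lambda>x. u x - \<eta> n x) x))\<^sup>2)" for n
  proof (rule integral_cong_AE)
    show "(\<lambda>x. (norm (weak_grad \<Omega> u x - grad (\<eta> n) x))\<^sup>2) \<in> borel_measurable (lebesgue_on \<Omega>)"
    proof (intro borel_measurable_integrable norm_square_integrable)
      show "(\<lambda>x. (weak_grad \<Omega> u x - grad (\<eta> n) x) $ i) \<in> L2 \<Omega>" for i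
        using weak_partial_diff_test_function(1)[OF u \<eta>] by simp
    qed
    show "(\<lambda>x. (norm (weak_grad \<Omega> (\<lambda>x. u x - \<eta> n x) x))\<^sup>2) \<in> borel_measurable (lebesgue_on \<Omega>)"
      by (intro borel_measurable_integrable norm_square_integrable weak_grad_H1 diff_test_function_H1 u \<eta>)
    show "AE x in lebesgue_on \<Omega>. (norm (weak_grad \<Omega> u x - grad (\<eta> n) x))\<^sup>2
        = (norm (weak_grad \<Omega> (\<lambda>x. u x - \<eta> n x) x))\<^sup>2"
      using weak_grad_diff_test_function[OF u \<eta>[of n]] by eventually_elim simp
  qed
  have main: "ennreal c * ?D \<le> ennreal ?E"
  proof (rule hardy_inequality_closure[OF c hardy uL2 weak_grad_H1(1)[OF u] \<eta>])
    show "(\<lambda>n. LINT x|lebesgue_on \<Omega>. (u x - \<eta> n x)\<^sup>2) \<longlonglongrightarrow> 0"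
      by (rule tendsto_sandwich[OF _ _ tendsto_const zero]) (use parts(1) in \<open>auto intro!: always_eventually\<close>)
    show "(\<lambda>n. LINT x|lebesgue_on \<Omega>. (norm (weak_grad \<Omega> u x - grad (\<eta> n) x))\<^sup>2) \<longlonglongrightarrow> 0"
      unfolding gradeq
      by (rule tendsto_sandwich[OF _ _ tendsto_const zero]) (use parts(2) in \<open>auto intro!: always_eventually\<close>)
  qed
  have "?D \<noteq> 0"
  proof
    assume "?D = 0"
    then have "AE x in lebesgue_on \<Omega>. ennreal ((u x)\<^sup>2 / (infdist x S)\<^sup>2) = 0"
      unfolding hardy_denominator_def
      using nn_integral_0_iff_AE[OF borel_measurable_hardy_integrand[OF L2_borel[OF uL2]]] by simp
    then have "AE x in lebesgue_on \<Omega>. u x = 0"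
      using AE_space
    proof eventually_elim
      case (elim x)
      then have "infdist x S > 0" "(u x)\<^sup>2 / (infdist x S)\<^sup>2 \<le> 0"
        using infdist_pos[OF assms(2,3)] by (auto simp: ennreal_eq_0_iff)
      then show ?case
        by (simp add: divide_le_0_iff)
    qed
    with nz show False by simp
  qed
  show "c \<le> q"
  proof (cases "?D = \<infinity>")
    case True
    with main have "\<not> c > 0"
      by (auto simp: ennreal_mult_top top_unique)
    with c True q show ?thesis
      by (simp add: hardy_quotient_def)
  next
    case False
    then obtain d where d: "?D = ennreal d" "0 \<le> d"
      by (cases ?D) auto
    with \<open>?D \<noteq> 0\<close> have "d > 0"
      by (cases "d = 0") auto
    moreover have "c * d \<le> ?E"
      using main c d by (simp add: ennreal_mult[symmetric])
    moreover have "q = ?E / d"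
      using d q False by (simp add: hardy_quotient_def)
    ultimately show ?thesis
      by (simp only: pos_le_divide_eq)
  qed
qed

text \<open>A \<open>C\<^sup>1\<close> function and its gradient are uniform limits of test functions and their gradients, and
  on a bounded set uniform convergence implies convergence in \<open>L\<^sup>2\<close>.\<close>

lemma hardy_constant_imp_C1_inequality:
  assumes c: "0 \<le> c" "c \<le> hardy_constant \<Omega> S"
    and f: "Ck 1 f" "compact (closure {x. f x \<noteq> 0})" "closure {x. f x \<noteq> 0} \<subseteq> \<Omega>"
  shows "hardy_inequality \<Omega> S c f"
proof -
  have fc: "continuous_on UNIV f"
    using f(1) by (rule Ck_imp_continuous)
  have "\<exists>\<eta>. \<eta> \<in> test_functions \<Omega> \<and> (\<forall>x. \<bar>\<eta> x - f x\<bar> \<le> 1 / real (Suc n)) \<and>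
      (\<forall>x. norm (grad \<eta> x - grad f x) \<le> 1 / real (Suc n))" for n
    by (rule test_function_approximation[OF open_dom fc f(2,3), of "1 / real (Suc n)"]) (simp, use f(1) in blast)
  then obtain \<eta> where \<eta>: "\<And>n. \<eta> n \<in> test_functions \<Omega>"
    and close: "\<And>n x. \<bar>\<eta> n x - f x\<bar> \<le> 1 / real (Suc n)"
      "\<And>n x. norm (grad (\<eta> n) x - grad f x) \<le> 1 / real (Suc n)"
    by metis
  let ?m = "measure (lebesgue_on \<Omega>) (space (lebesgue_on \<Omega>))"
  have bound: "(\<lambda>n. LINT x|lebesgue_on \<Omega>. h n x) \<longlonglongrightarrow> 0"
    if h: "\<And>n. integrable (lebesgue_on \<Omega>) (h n)" "\<And>n x. 0 \<le> h n x" "\<And>n x. h n x \<le> (1 / real (Suc n))\<^sup>2"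
    for h :: "nat \<Rightarrow> real^'n \<Rightarrow> real"
  proof (rule tendsto_sandwich[OF _ _ tendsto_const])
    have "(\<lambda>n. ?m * (1 / real (Suc n))\<^sup>2) \<longlonglongrightarrow> ?m * 0\<^sup>2"
      by (intro tendsto_mult tendsto_power tendsto_const LIMSEQ_Suc[OF lim_1_over_n])
    then show "(\<lambda>n. ?m * (1 / real (Suc n))\<^sup>2) \<longlonglongrightarrow> 0"
      by simp
    show "eventually (\<lambda>n. 0 \<le> (LINT x|lebesgue_on \<Omega>. h n x)) sequentially"
      by (intro always_eventually allI Bochner_Integration.integral_nonneg h)
    have "(LINT x|lebesgue_on \<Omega>. h n x) \<le> (LINT x|lebesgue_on \<Omega>. (1 / real (Suc n))\<^sup>2)" for n
      by (intro integral_mono h finite_measure.integrable_const dom_finite_measure)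
    then show "eventually (\<lambda>n. (LINT x|lebesgue_on \<Omega>. h n x) \<le> ?m * (1 / real (Suc n))\<^sup>2) sequentially"
      by (intro always_eventually allI) simp
  qed
  have "ennreal c * hardy_denominator \<Omega> S f \<le> ennreal (LINT x|lebesgue_on \<Omega>. (norm (grad f x))\<^sup>2)"
  proof (rule hardy_inequality_closure[OF c(1) hardy_constant_imp_test_inequality[OF c] continuous_L2[OF fc]
        grad_L2[OF f(1)] \<eta>])
    show "(\<lambda>n. LINT x|lebesgue_on \<Omega>. (f x - \<eta> n x)\<^sup>2) \<longlonglongrightarrow> 0"
    proof (rule bound)
      show "integrable (lebesgue_on \<Omega>) (\<lambda>x. (f x - \<eta> n x)\<^sup>2)" for n
        by (intro L2_square_integrable L2_diff continuous_L2 fc test_functionsD(2)[OF \<eta>])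
      show "(f x - \<eta> n x)\<^sup>2 \<le> (1 / real (Suc n))\<^sup>2" for n x
        using power_mono[OF close(1)[of n x] abs_ge_zero, of 2] by (simp add: power2_commute)
    qed simp
    show "(\<lambda>n. LINT x|lebesgue_on \<Omega>. (norm (grad f x - grad (\<eta> n) x))\<^sup>2) \<longlonglongrightarrow> 0"
    proof (rule bound)
      show "integrable (lebesgue_on \<Omega>) (\<lambda>x. (norm (grad f x - grad (\<eta> n) x))\<^sup>2)" for n
      proof (rule norm_square_integrable)
        show "(\<lambda>x. (grad f x - grad (\<eta> n) x) $ i) \<in> L2 \<Omega>" for i
          unfolding vector_minus_component by (intro L2_diff grad_L2 f(1) test_functionsD(1)[OF \<eta>])
      qed
      show "(norm (grad f x - grad (\<eta> n) x))\<^sup>2 \<le> (1 / real (Suc n))\<^sup>2" for n x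
        using power_mono[OF close(2)[of n x] norm_ge_zero, of 2] by (simp add: norm_minus_commute)
    qed simp
  qed
  then show ?thesis
    by (simp add: hardy_inequality_def dirichlet_energy_eq[OF f(1)])
qed

end

section \<open>Volumes of Lipschitz images\<close>

lemma homeomorphism_UNIV_image:
  assumes "homeomorphism UNIV UNIV T g"
  shows "T ` A = g -` A"
proof
  show "T ` A \<subseteq> g -` A"
    using homeomorphism_apply1[OF assms] by auto
  show "g -` A \<subseteq> T ` A"
  proof
    fix y assume "y \<in> g -` A"
    then have "T (g y) \<in> T ` A" by simp
    then show "y \<in> T ` A"
      using homeomorphism_apply2[OF assms] by simp
  qed
qed

lemma homeomorphism_UNIV_open_image:
  assumes "homeomorphism UNIV UNIV T g" "open U"
  shows "open (T ` U)"
proof -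
  have "continuous_on UNIV g"
    using assms(1) by (simp add: homeomorphism_def)
  with assms(2) show ?thesis
    unfolding homeomorphism_UNIV_image[OF assms(1)] by (rule open_vimage)
qed

lemma homeomorphism_UNIV_borel_image:
  assumes "homeomorphism UNIV UNIV T g" "A \<in> sets borel"
  shows "T ` A \<in> sets borel"
proof -
  have "g \<in> borel_measurable borel"
    using assms(1) by (intro borel_measurable_continuous_onI) (simp add: homeomorphism_def)
  from measurable_sets[OF this assms(2)] show ?thesis
    by (simp add: homeomorphism_UNIV_image[OF assms(1)])
qed

text \<open>By the Vitali covering theorem \<open>U\<close> is, up to a null set, a disjoint union of balls. The image of a
  ball lies in a ball whose radius is larger by the factor \<open>b\<close>, and the image of the null set is a
  null set. The images of the balls are again disjoint since \<open>T\<close> is injective.\<close>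

lemma lborel_lipschitz_image_open:
  fixes T :: "'a::euclidean_space \<Rightarrow> 'a"
  assumes hom: "homeomorphism UNIV UNIV T g" and U: "open U" and b: "b > 0"
    and lip: "\<And>x y. x \<in> U \<Longrightarrow> y \<in> U \<Longrightarrow> dist (T x) (T y) \<le> b * dist x y"
  shows "emeasure lborel (T ` U) \<le> ennreal (b ^ DIM('a)) * emeasure lborel U"
proof -
  define K where "K = {(x, r::real). x \<in> U \<and> 0 < r \<and> ball x r \<subseteq> U}"
  have Vitali: "\<exists>i. i \<in> K \<and> x \<in> ball (fst i) (snd i) \<and> snd i < d" if "x \<in> U" "0 < d" for x d
  proof -
    obtain e where e: "e > 0" "ball x e \<subseteq> U"
      using U \<open>x \<in> U\<close> open_contains_ball by blast
    let ?r = "min e (d / 2)"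
    have "ball x ?r \<subseteq> U"
      using e(2) subset_ball[of ?r e x] by auto
    then have "(x, ?r) \<in> K \<and> x \<in> ball (fst (x, ?r)) (snd (x, ?r)) \<and> snd (x, ?r) < d"
      using e(1) that by (simp add: K_def min_less_iff_disj)
    then show ?thesis by blast
  qed
  obtain C where C: "countable C" "C \<subseteq> K"
    "pairwise (\<lambda>i j. disjnt (ball (fst i) (snd i)) (ball (fst j) (snd j))) C"
    "negligible (U - (\<Union>i\<in>C. ball (fst i) (snd i)))"
    using Vitali_covering_theorem_balls[of U K fst snd, OF Vitali] by blast
  let ?B = "\<lambda>i. ball (fst i) (snd i)"
  let ?N = "U - (\<Union>i\<in>C. ?B i)"
  have inj: "inj T"
    by (rule inj_on_inverseI) (rule homeomorphism_apply1[OF hom], simp)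
  have disj: "disjoint_family_on ?B C"
    using C(3) by (auto simp: disjoint_family_on_def pairwise_def disjnt_def)
  have disjT: "disjoint_family_on (\<lambda>i. T ` ?B i) C"
    using disj by (auto simp: disjoint_family_on_def image_Int[OF inj, symmetric])
  have BU: "?B i \<subseteq> U" if "i \<in> C" for i
    using subsetD[OF C(2) that] by (cases i) (simp add: K_def)
  have Nb: "?N \<in> sets borel"
    using U by (intro sets.Diff borel_open open_UN) auto
  have "negligible (T ` ?N)"
  proof (rule negligible_locally_Lipschitz_image[OF order_refl C(4)])
    fix x assume "x \<in> ?N"
    then show "\<exists>V B. open V \<and> x \<in> V \<and> (\<forall>y\<in>?N \<inter> V. norm (T y - T x) \<le> B * norm (y - x))"
      using lip by (intro exI[of _ UNIV] exI[of _ b]) (auto simp: dist_norm)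
  qed
  then have TN: "emeasure lborel (T ` ?N) = 0"
    using homeomorphism_UNIV_borel_image[OF hom Nb]
    by (simp add: negligible_iff_null_sets null_sets_completion_iff null_sets_def)
  have TBb: "T ` ?B i \<in> sets lborel" for i
    using homeomorphism_UNIV_borel_image[OF hom, of "?B i"] by simp
  have ball_le: "emeasure lborel (T ` ?B i) \<le> ennreal (b ^ DIM('a)) * emeasure lborel (?B i)" if "i \<in> C" for i
  proof -
    have r: "snd i > 0" and x: "fst i \<in> U"
      using subsetD[OF C(2) that] by (cases i, simp add: K_def)+
    have "T ` ?B i \<subseteq> cball (T (fst i)) (b * snd i)"
    proof
      fix y assume "y \<in> T ` ?B i"
      then obtain z where z: "y = T z" "z \<in> ?B i" by blast
      then have "dist (T (fst i)) (T z) \<le> b * dist (fst i) z"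
        using BU[OF that] x by (intro lip) auto
      also have "\<dots> \<le> b * snd i"
        using z(2) b by simp
      finally show "y \<in> cball (T (fst i)) (b * snd i)"
        using z(1) by simp
    qed
    then have "emeasure lborel (T ` ?B i) \<le> emeasure lborel (cball (T (fst i)) (b * snd i))"
      by (intro emeasure_mono) auto
    also have "\<dots> = ennreal (b ^ DIM('a)) * emeasure lborel (?B i)"
      using r b by (simp add: emeasure_cball emeasure_ball power_mult_distrib ennreal_mult[symmetric] mult_ac)
    finally show ?thesis .
  qed
  have "T ` U = T ` ?N \<union> (\<Union>i\<in>C. T ` ?B i)"
    using BU by blast
  then have "emeasure lborel (T ` U) \<le> emeasure lborel (T ` ?N) + emeasure lborel (\<Union>i\<in>C. T ` ?B i)"
  proof (simp only:, intro emeasure_subadditive)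
    show "T ` ?N \<in> sets lborel"
      using homeomorphism_UNIV_borel_image[OF hom Nb] by simp
    show "(\<Union>i\<in>C. T ` ?B i) \<in> sets lborel"
      by (rule sets.countable_UN''[OF C(1)]) (rule TBb)
  qed
  also have "\<dots> = (\<integral>\<^sup>+i. emeasure lborel (T ` ?B i) \<partial>count_space C)"
    using emeasure_UN_countable[OF _ C(1) disjT, of lborel] TBb TN by simp
  also have "\<dots> \<le> (\<integral>\<^sup>+i. ennreal (b ^ DIM('a)) * emeasure lborel (?B i) \<partial>count_space C)"
    by (intro nn_integral_mono ball_le) simp
  also have "\<dots> = ennreal (b ^ DIM('a)) * (\<integral>\<^sup>+i. emeasure lborel (?B i) \<partial>count_space C)"
    by (rule nn_integral_cmult) simp
  also have "\<dots> = ennreal (b ^ DIM('a)) * emeasure lborel (\<Union>i\<in>C. ?B i)"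
    using emeasure_UN_countable[OF _ C(1) disj, of lborel] by simp
  also have "\<dots> \<le> ennreal (b ^ DIM('a)) * emeasure lborel U"
    using BU U by (intro mult_left_mono emeasure_mono) auto
  finally show ?thesis .
qed

text \<open>Outer regularity reduces Borel sets to open sets.\<close>

lemma lborel_lipschitz_image_borel:
  fixes T :: "'a::euclidean_space \<Rightarrow> 'a"
  assumes hom: "homeomorphism UNIV UNIV T g" and U: "open U" and b: "b > 0"
    and lip: "\<And>x y. x \<in> U \<Longrightarrow> y \<in> U \<Longrightarrow> dist (T x) (T y) \<le> b * dist x y"
    and A: "A \<in> sets borel" "A \<subseteq> U"
  shows "emeasure lborel (T ` A) \<le> ennreal (b ^ DIM('a)) * emeasure lborel A"
proof -
  have "emeasure lborel (T ` A) \<le> ennreal (b ^ DIM('a)) * (emeasure lborel A + ennreal e)" if e: "e > 0" for e :: real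
  proof -
    obtain V where V: "open V" "A \<subseteq> V" "emeasure lborel (V - A) < ennreal e"
      using outer_regular_lborel[OF A(1) e] .
    have UV: "open (U \<inter> V)"
      using U V(1) by (rule open_Int)
    have "emeasure lborel (T ` A) \<le> emeasure lborel (T ` (U \<inter> V))"
      using A(2) V(2) homeomorphism_UNIV_open_image[OF hom UV] by (intro emeasure_mono image_mono) auto
    also have "\<dots> \<le> ennreal (b ^ DIM('a)) * emeasure lborel (U \<inter> V)"
      using lip by (intro lborel_lipschitz_image_open[OF hom UV b]) auto
    also have "emeasure lborel (U \<inter> V) \<le> emeasure lborel (A \<union> (V - A))"
      using A V by (intro emeasure_mono) auto
    also have "\<dots> \<le> emeasure lborel A + emeasure lborel (V - A)"
      using A V by (intro emeasure_subadditive) auto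
    also have "\<dots> \<le> emeasure lborel A + ennreal e"
      using V(3) by (intro add_left_mono) simp
    finally show ?thesis
      by (simp add: mult_left_mono)
  qed
  then have *: "emeasure lborel (T ` A) \<le> ennreal (b ^ DIM('a)) * (emeasure lborel A + ennreal (1 / real (Suc n)))" for n
    by simp
  have "(\<lambda>n. ennreal (b ^ DIM('a)) * (emeasure lborel A + ennreal (1 / real (Suc n))))
      \<longlonglongrightarrow> ennreal (b ^ DIM('a)) * (emeasure lborel A + ennreal 0)"
    by (intro ennreal_tendsto_cmult tendsto_add tendsto_const tendsto_ennrealI LIMSEQ_Suc[OF lim_1_over_n]) simp
  from LIMSEQ_le_const[OF this] * show ?thesis
    by auto
qed

text \<open>The inequality between volumes says that one measure on \<open>U\<close>, the pull-back of Lebesgue measure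
  along \<open>T\<close>, is dominated by another one, a multiple of Lebesgue measure. Integrals are monotone in
  the measure.\<close>

lemma nn_integral_lipschitz_image:
  fixes T :: "'a::euclidean_space \<Rightarrow> 'a"
  assumes hom: "homeomorphism UNIV UNIV T g" and U: "open U" and b: "b > 0"
    and lip: "\<And>x y. x \<in> U \<Longrightarrow> y \<in> U \<Longrightarrow> dist (T x) (T y) \<le> b * dist x y"
    and h: "h \<in> borel_measurable borel"
  shows "(\<integral>\<^sup>+y. h y * indicator (T ` U) y \<partial>lborel)
    \<le> ennreal (b ^ DIM('a)) * (\<integral>\<^sup>+x. h (T x) * indicator U x \<partial>lborel)"
proof -
  define M where "M = distr (density lborel (indicator (T ` U))) borel g"
  define N where "N = density lborel (\<lambda>x. ennreal (b ^ DIM('a)) * indicator U x)"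
  have g: "g \<in> borel_measurable borel" and T: "T \<in> borel_measurable borel"
    using hom by (auto intro!: borel_measurable_continuous_onI simp: homeomorphism_def)
  have TU: "T ` U \<in> sets borel" and Ub: "U \<in> sets borel"
    using homeomorphism_UNIV_open_image[OF hom U] U by auto
  have kh: "(\<lambda>x. h (T x)) \<in> borel_measurable borel"
    using measurable_compose[OF T h] .
  have "M \<le> N"
  proof (subst le_measure)
    show "sets M = sets N" by (simp add: M_def N_def)
    show "\<forall>A\<in>sets M. emeasure M A \<le> emeasure N A"
    proof
      fix A assume "A \<in> sets M"
      then have A: "A \<in> sets borel" by (simp add: M_def)
      have gA: "g -` A \<in> sets borel"
        using measurable_sets[OF g A] by simp
      have "emeasure M A = emeasure (density lborel (indicator (T ` U))) (g -` A)"
        using g A by (simp add: M_def emeasure_distr)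
      also have "\<dots> = (\<integral>\<^sup>+y. indicator (T ` U) y * indicator (g -` A) y \<partial>lborel)"
        using gA TU by (intro emeasure_density) auto
      also have "\<dots> = (\<integral>\<^sup>+y. indicator (T ` (A \<inter> U)) y \<partial>lborel)"
        unfolding homeomorphism_UNIV_image[OF hom] by (intro nn_integral_cong) (auto simp: indicator_def)
      also have "\<dots> = emeasure lborel (T ` (A \<inter> U))"
        using homeomorphism_UNIV_borel_image[OF hom sets.Int[OF A Ub]] by (intro nn_integral_indicator) simp
      also have "\<dots> \<le> ennreal (b ^ DIM('a)) * emeasure lborel (A \<inter> U)"
        using A Ub by (intro lborel_lipschitz_image_borel[OF hom U b lip]) auto
      also have "\<dots> = (\<integral>\<^sup>+x. ennreal (b ^ DIM('a)) * indicator (A \<inter> U) x \<partial>lborel)"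
        using A Ub by (simp add: nn_integral_cmult)
      also have "\<dots> = (\<integral>\<^sup>+x. ennreal (b ^ DIM('a)) * indicator U x * indicator A x \<partial>lborel)"
        by (intro nn_integral_cong) (auto simp: indicator_def)
      also have "\<dots> = emeasure N A"
        unfolding N_def using A Ub by (intro emeasure_density[symmetric]) auto
      finally show "emeasure M A \<le> emeasure N A" .
    qed
  qed
  then have "(\<integral>\<^sup>+x. h (T x) \<partial>M) \<le> (\<integral>\<^sup>+x. h (T x) \<partial>N)"
    by (rule nn_integral_mono_measure[rotated]) (simp add: M_def N_def)
  moreover have "(\<integral>\<^sup>+x. h (T x) \<partial>M) = (\<integral>\<^sup>+y. h y * indicator (T ` U) y \<partial>lborel)"
  proof -
    have "(\<integral>\<^sup>+x. h (T x) \<partial>M) = (\<integral>\<^sup>+y. h (T (g y)) \<partial>density lborel (indicator (T ` U)))"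
      unfolding M_def using g kh by (intro nn_integral_distr) auto
    also have "\<dots> = (\<integral>\<^sup>+y. indicator (T ` U) y * h (T (g y)) \<partial>lborel)"
      using TU measurable_compose[OF g kh] by (intro nn_integral_density) auto
    finally show ?thesis
      using homeomorphism_apply2[OF hom] by (simp add: mult.commute)
  qed
  moreover have "(\<integral>\<^sup>+x. h (T x) \<partial>N) = ennreal (b ^ DIM('a)) * (\<integral>\<^sup>+x. h (T x) * indicator U x \<partial>lborel)"
  proof -
    have "(\<integral>\<^sup>+x. h (T x) \<partial>N) = (\<integral>\<^sup>+x. ennreal (b ^ DIM('a)) * indicator U x * h (T x) \<partial>lborel)"
      unfolding N_def using Ub kh by (intro nn_integral_density) auto
    also have "\<dots> = (\<integral>\<^sup>+x. ennreal (b ^ DIM('a)) * (h (T x) * indicator U x) \<partial>lborel)"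
      by (simp add: mult_ac)
    also have "\<dots> = ennreal (b ^ DIM('a)) * (\<integral>\<^sup>+x. h (T x) * indicator U x \<partial>lborel)"
      using Ub kh by (intro nn_integral_cmult) auto
    finally show ?thesis .
  qed
  ultimately show ?thesis by simp
qed

lemma nn_integral_lebesgue_on:
  assumes "U \<in> sets borel"
  shows "(\<integral>\<^sup>+x. h x \<partial>lebesgue_on U) = (\<integral>\<^sup>+x. h x * indicator U x \<partial>lborel)"
proof -
  have "U \<inter> space lebesgue \<in> sets lebesgue"
    using assms by (simp add: sets_completionI_sets)
  then show ?thesis
    by (simp add: nn_integral_restrict_space nn_integral_completion)
qed

section \<open>Energy and weight under a change of variables\<close>

lemma Ck_1_has_derivative:
  fixes f :: "real^'n::finite \<Rightarrow> 'b::real_normed_vector"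
  assumes "Ck 1 f"
  shows "(f has_derivative (\<lambda>h. \<Sum>i\<in>UNIV. h $ i *\<^sub>R partial_deriv i f x)) (at x)"
proof -
  have "f differentiable (at x)"
    using assms by simp
  then have d: "(f has_derivative frechet_derivative f (at x)) (at x)"
    by (rule has_derivative_frechet)
  have "frechet_derivative f (at x) = (\<lambda>h. \<Sum>i\<in>UNIV. h $ i *\<^sub>R partial_deriv i f x)"
    unfolding partial_deriv_def by (rule ext, rule linear_axis_expansion[OF has_derivative_linear[OF d]])
  with d show ?thesis by simp
qed

lemma Ck_1_compose:
  fixes f :: "real^'m::finite \<Rightarrow> 'b::real_normed_vector" and T :: "real^'n::finite \<Rightarrow> real^'m"
  assumes f: "Ck 1 f" and T: "Ck 1 T"
  shows "Ck 1 (\<lambda>x. f (T x))"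
proof (rule Ck_1I)
  have d: "T differentiable (at x)" for x
    using T by simp
  show "((\<lambda>x. f (T x)) has_derivative
      (\<lambda>h. \<Sum>j\<in>UNIV. frechet_derivative T (at x) h $ j *\<^sub>R partial_deriv j f (T x))) (at x)" for x
    by (rule has_derivative_compose[OF has_derivative_frechet[OF d] Ck_1_has_derivative[OF f]])
  show "continuous_on UNIV (\<lambda>x. \<Sum>j\<in>UNIV. frechet_derivative T (at x) (axis i 1) $ j *\<^sub>R
      partial_deriv j f (T x))" for i
  proof (rule continuous_on_sum, rule continuous_on_scaleR)
    show "continuous_on UNIV (\<lambda>x. frechet_derivative T (at x) (axis i 1) $ j)" for j
      using continuous_on_component[OF Ck_1_partial_continuous[OF T, of i], of j]
      by (simp add: partial_deriv_def)
    show "continuous_on UNIV (\<lambda>x. partial_deriv j f (T x))" for j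
      by (rule continuous_on_compose2[OF Ck_1_partial_continuous[OF f] Ck_imp_continuous[OF T] subset_UNIV])
  qed
qed

text \<open>The difference quotients in direction \<open>h\<close> are bounded by \<open>b * norm h\<close>, and so is their limit.\<close>

lemma derivative_norm_le_lipschitz:
  fixes T :: "'a::real_normed_vector \<Rightarrow> 'b::real_normed_vector"
  assumes "open U" "x \<in> U" "(T has_derivative T') (at x)"
    and lip: "\<And>x y. x \<in> U \<Longrightarrow> y \<in> U \<Longrightarrow> dist (T x) (T y) \<le> b * dist x y"
  shows "norm (T' h) \<le> b * norm h"
proof -
  have lin: "linear T'"
    using assms(3) by (rule has_derivative_linear)
  have "((\<lambda>t::real. x + t *\<^sub>R h) has_derivative (\<lambda>t. t *\<^sub>R h)) (at 0)"
    using has_derivative_add[OF has_derivative_const[of x] has_derivative_scaleR_left[OF has_derivative_ident]]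
    by simp
  moreover have "(T has_derivative T') (at (x + 0 *\<^sub>R h))"
    using assms(3) by simp
  ultimately have "((\<lambda>t::real. T (x + t *\<^sub>R h)) has_derivative (\<lambda>t. T' (t *\<^sub>R h))) (at 0)"
    by (rule has_derivative_compose)
  then have "((\<lambda>t. (T (x + t *\<^sub>R h) - T x) /\<^sub>R t - T' h) \<longlongrightarrow> 0) (at 0)"
    unfolding has_derivative_at
  proof (elim conjE)
    assume "(\<lambda>t. norm (T (x + (0 + t) *\<^sub>R h) - T (x + 0 *\<^sub>R h) - T' (t *\<^sub>R h)) / norm t) \<midarrow>0\<rightarrow> 0"
    then have "((\<lambda>t. norm ((T (x + t *\<^sub>R h) - T x) /\<^sub>R t - T' h)) \<longlongrightarrow> 0) (at 0)"
    proof (rule Lim_transform_eventually)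
      have "norm (T (x + (0 + t) *\<^sub>R h) - T (x + 0 *\<^sub>R h) - T' (t *\<^sub>R h)) / norm t
          = norm ((T (x + t *\<^sub>R h) - T x) /\<^sub>R t - T' h)" if "t \<noteq> 0" for t :: real
      proof -
        have "(T (x + t *\<^sub>R h) - T x) /\<^sub>R t - T' h = (T (x + t *\<^sub>R h) - T x - T' (t *\<^sub>R h)) /\<^sub>R t"
          using that by (simp add: linear_cmul[OF lin] scaleR_diff_right)
        then show ?thesis
          by (simp add: divide_inverse mult.commute)
      qed
      then show "eventually (\<lambda>t. norm (T (x + (0 + t) *\<^sub>R h) - T (x + 0 *\<^sub>R h) - T' (t *\<^sub>R h)) / norm t
          = norm ((T (x + t *\<^sub>R h) - T x) /\<^sub>R t - T' h)) (at 0)"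
        by (simp add: eventually_at_filter)
    qed
    then show ?thesis
      by (rule tendsto_norm_zero_cancel)
  qed
  then have "((\<lambda>t. (T (x + t *\<^sub>R h) - T x) /\<^sub>R t) \<longlongrightarrow> T' h) (at 0)"
    by (rule LIM_zero_cancel)
  then have lim: "((\<lambda>t. norm ((T (x + t *\<^sub>R h) - T x) /\<^sub>R t)) \<longlongrightarrow> norm (T' h)) (at 0)"
    by (rule tendsto_norm)
  have "((\<lambda>t::real. x + t *\<^sub>R h) \<longlongrightarrow> x + 0 *\<^sub>R h) (at 0)"
    by (intro tendsto_add tendsto_const tendsto_scaleR tendsto_ident_at)
  then have "eventually (\<lambda>t::real. x + t *\<^sub>R h \<in> U) (at 0)"
    using assms(1,2) by (intro topological_tendstoD) auto
  moreover have "eventually (\<lambda>t::real. t \<noteq> 0) (at 0)"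
    by (simp add: eventually_at_filter)
  ultimately have "eventually (\<lambda>t. norm ((T (x + t *\<^sub>R h) - T x) /\<^sub>R t) \<le> b * norm h) (at 0)"
  proof eventually_elim
    case (elim t)
    then have "norm (T (x + t *\<^sub>R h) - T x) \<le> b * norm (t *\<^sub>R h)"
      using lip[of "x + t *\<^sub>R h" x] assms(2) by (simp add: dist_norm)
    moreover have "norm ((T (x + t *\<^sub>R h) - T x) /\<^sub>R t) = norm (T (x + t *\<^sub>R h) - T x) / \<bar>t\<bar>"
      by (simp only: norm_scaleR abs_inverse divide_inverse mult.commute)
    ultimately show ?case
      using elim(2) by (simp add: pos_divide_le_eq mult_ac)
  qed
  with lim show ?thesis
    by (rule tendsto_upperbound) simp
qed

text \<open>Evaluating the derivative of \<open>f \<circ> T\<close> in the direction \<open>v\<close> of its own gradient yields \<open>|v|\<^sup>2\<close>,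
  which the Cauchy-Schwarz inequality bounds by \<open>b |v|\<close> times the norm of the gradient of \<open>f\<close>.\<close>

lemma grad_compose_bound:
  fixes f :: "real^'n::finite \<Rightarrow> real" and T :: "real^'n \<Rightarrow> real^'n"
  assumes U: "open U" "x \<in> U" and T: "Ck 1 T" and f: "Ck 1 f" and "b > 0"
    and lip: "\<And>x y. x \<in> U \<Longrightarrow> y \<in> U \<Longrightarrow> dist (T x) (T y) \<le> b * dist x y"
  shows "norm (grad (\<lambda>x. f (T x)) x) \<le> b * norm (grad f (T x))"
proof -
  define v where "v = grad (\<lambda>x. f (T x)) x"
  have "T differentiable (at x)" "f differentiable (at (T x))" "(\<lambda>x. f (T x)) differentiable (at x)"
    using T f Ck_1_compose[OF f T] by simp_all
  note d = has_derivative_frechet[OF this(1)] grad_has_derivative[OF this(2)] grad_has_derivative[OF this(3)]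
  have "(\<lambda>h. v \<bullet> h) = (\<lambda>h. grad f (T x) \<bullet> frechet_derivative T (at x) h)"
    using has_derivative_unique[OF d(3) has_derivative_compose[OF d(1,2)]] by (simp add: v_def)
  then have "v \<bullet> v = grad f (T x) \<bullet> frechet_derivative T (at x) v"
    by (rule fun_cong)
  also have "\<dots> \<le> norm (grad f (T x)) * norm (frechet_derivative T (at x) v)"
    by (rule norm_cauchy_schwarz)
  also have "\<dots> \<le> norm (grad f (T x)) * (b * norm v)"
    by (intro mult_left_mono derivative_norm_le_lipschitz[OF U d(1) lip]) auto
  finally have "norm v * norm v \<le> (b * norm (grad f (T x))) * norm v"
    by (simp add: power2_norm_eq_inner[symmetric] power2_eq_square mult_ac)
  then have "norm v \<le> b * norm (grad f (T x))"
    using \<open>b > 0\<close> by (cases "v = 0") simp_all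
  then show ?thesis by (simp add: v_def)
qed

lemma infdist_image_lower:
  fixes T :: "'a::metric_space \<Rightarrow> 'b::metric_space"
  assumes "S \<noteq> {}" "a > 0" and lower: "\<And>y. y \<in> S \<Longrightarrow> a * dist x y \<le> dist (T x) (T y)"
  shows "a * infdist x S \<le> infdist (T x) (T ` S)"
proof -
  have "a * infdist x S \<le> dist (T x) z" if z: "z \<in> T ` S" for z
  proof -
    obtain y where y: "z = T y" "y \<in> S"
      using z by blast
    have "a * infdist x S \<le> a * dist x y"
      using \<open>a > 0\<close> infdist_le[OF y(2), of x] by simp
    also have "\<dots> \<le> dist (T x) z"
      using lower[OF y(2)] y(1) by simp
    finally show ?thesis .
  qed
  then show ?thesis
    using assms(1) by (simp add: infdist_notempty cINF_greatest)
qed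

text \<open>The factor \<open>b\<^sup>2\<close> comes from the chain rule; the factor \<open>1 / a ^ n\<close> bounds volumes under the inverse
  map, which is Lipschitz with constant \<open>1 / a\<close>.\<close>

lemma dirichlet_energy_bilipschitz:
  fixes T g :: "real^'n::finite \<Rightarrow> real^'n"
  assumes hom: "homeomorphism UNIV UNIV T g" and T: "Ck 1 T" and U: "open U" and ab: "a > 0" "b > 0"
    and upper: "\<And>x y. x \<in> U \<Longrightarrow> y \<in> U \<Longrightarrow> dist (T x) (T y) \<le> b * dist x y"
    and lower: "\<And>x y. x \<in> U \<Longrightarrow> y \<in> U \<Longrightarrow> a * dist x y \<le> dist (T x) (T y)"
    and f: "Ck 1 f"
  shows "dirichlet_energy U (\<lambda>x. f (T x)) \<le> ennreal (b\<^sup>2 / a ^ CARD('n)) * dirichlet_energy (T ` U) f"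
proof -
  have TU: "open (T ` U)"
    using homeomorphism_UNIV_open_image[OF hom U] .
  have gT: "g ` T ` U = U"
    using homeomorphism_apply1[OF hom] by (simp add: image_image)
  have hom': "homeomorphism UNIV UNIV g T"
    using hom by (rule homeomorphism_symD)
  have Tc: "continuous_on UNIV T"
    using T by (rule Ck_imp_continuous)
  let ?e = "\<lambda>y. ennreal ((norm (grad f y))\<^sup>2)"
  have "continuous_on UNIV (\<lambda>x. (norm (grad f (T x)))\<^sup>2)"
    by (intro continuous_on_power continuous_on_norm continuous_on_compose2[OF continuous_grad[OF f] Tc] subset_UNIV)
  then have em: "(\<lambda>x. ?e (T x)) \<in> borel_measurable borel"
    by (intro measurable_compose[OF borel_measurable_continuous_onI measurable_ennreal])
  have "dirichlet_energy U (\<lambda>x. f (T x)) \<le> (\<integral>\<^sup>+x. ennreal (b\<^sup>2) * (?e (T x) * indicator U x) \<partial>lborel)"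
    unfolding dirichlet_energy_def nn_integral_lebesgue_on[OF borel_open[OF U]]
  proof (intro nn_integral_mono)
    fix x
    show "ennreal ((norm (grad (\<lambda>x. f (T x)) x))\<^sup>2) * indicator U x \<le> ennreal (b\<^sup>2) * (?e (T x) * indicator U x)"
    proof (cases "x \<in> U")
      case True
      have "(norm (grad (\<lambda>x. f (T x)) x))\<^sup>2 \<le> (b * norm (grad f (T x)))\<^sup>2"
        using grad_compose_bound[OF U True T f ab(2) upper] by (intro power_mono) auto
      then show ?thesis
        using True by (simp add: power_mult_distrib ennreal_mult[symmetric] ennreal_leI)
    qed simp
  qed
  also have "\<dots> = ennreal (b\<^sup>2) * (\<integral>\<^sup>+x. ?e (T x) * indicator U x \<partial>lborel)"
    using em borel_open[OF U] by (intro nn_integral_cmult) auto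
  also have "(\<integral>\<^sup>+x. ?e (T x) * indicator U x \<partial>lborel)
      \<le> ennreal ((1 / a) ^ CARD('n)) * (\<integral>\<^sup>+y. ?e (T (g y)) * indicator (T ` U) y \<partial>lborel)"
  proof -
    have lip: "dist (g y) (g z) \<le> 1 / a * dist y z" if "y \<in> T ` U" "z \<in> T ` U" for y z
    proof -
      obtain x w where xw: "y = T x" "z = T w" "x \<in> U" "w \<in> U"
        using \<open>y \<in> T ` U\<close> \<open>z \<in> T ` U\<close> by blast
      then show ?thesis
        using lower[OF xw(3,4)] ab(1) homeomorphism_apply1[OF hom] by (simp add: field_simps)
    qed
    from nn_integral_lipschitz_image[OF hom' TU _ lip em] show ?thesis
      using ab(1) by (simp add: gT)
  qed
  also have "(\<integral>\<^sup>+y. ?e (T (g y)) * indicator (T ` U) y \<partial>lborel) = dirichlet_energy (T ` U) f"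
    using homeomorphism_apply2[OF hom]
    by (simp add: dirichlet_energy_def nn_integral_lebesgue_on[OF borel_open[OF TU]])
  finally show ?thesis
    using ab by (simp add: mult_left_mono mult.assoc[symmetric] ennreal_mult[symmetric] power_one_over)
qed

text \<open>The factor \<open>b ^ n\<close> bounds volumes under \<open>T\<close>, and \<open>1 / a\<^sup>2\<close> comes from the weight, because \<open>T\<close>
  shrinks distances to \<open>S\<close> at most by the factor \<open>a\<close>.\<close>

lemma hardy_denominator_bilipschitz:
  fixes T g :: "real^'n::finite \<Rightarrow> real^'n"
  assumes hom: "homeomorphism UNIV UNIV T g" and U: "open U" and ab: "a > 0" "b > 0"
    and S: "S \<noteq> {}" "\<And>x. x \<in> U \<Longrightarrow> infdist x S > 0"
    and upper: "\<And>x y. x \<in> U \<Longrightarrow> y \<in> U \<Longrightarrow> dist (T x) (T y) \<le> b * dist x y"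
    and lower: "\<And>x y. x \<in> U \<Longrightarrow> y \<in> S \<Longrightarrow> a * dist x y \<le> dist (T x) (T y)"
    and f: "continuous_on UNIV f"
  shows "hardy_denominator (T ` U) (T ` S) f
    \<le> ennreal (b ^ CARD('n) / a\<^sup>2) * hardy_denominator U S (\<lambda>x. f (T x))"
proof -
  have TU: "open (T ` U)"
    using homeomorphism_UNIV_open_image[OF hom U] .
  have Tc: "continuous_on UNIV T"
    using hom by (simp add: homeomorphism_def)
  let ?e = "\<lambda>y. ennreal ((f y)\<^sup>2 / (infdist y (T ` S))\<^sup>2)"
  let ?d = "\<lambda>x. ennreal ((f (T x))\<^sup>2 / (infdist x S)\<^sup>2)"
  have fm: "f \<in> borel_measurable borel" and Tm: "T \<in> borel_measurable borel"
    and im: "(\<lambda>x. infdist x A) \<in> borel_measurable borel" for A :: "(real^'n) set"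
    using f Tc by (intro borel_measurable_continuous_onI continuous_on_infdist continuous_on_id; simp)+
  have em: "?e \<in> borel_measurable borel"
    using fm im[of "T ` S"] by measurable
  have dm: "?d \<in> borel_measurable borel"
    using measurable_compose[OF Tm fm] im[of S] by measurable
  have "hardy_denominator (T ` U) (T ` S) f
      \<le> ennreal (b ^ CARD('n)) * (\<integral>\<^sup>+x. ?e (T x) * indicator U x \<partial>lborel)"
    unfolding hardy_denominator_def nn_integral_lebesgue_on[OF borel_open[OF TU]]
    using nn_integral_lipschitz_image[OF hom U ab(2) upper em] by simp
  also have "(\<integral>\<^sup>+x. ?e (T x) * indicator U x \<partial>lborel)
      \<le> (\<integral>\<^sup>+x. ennreal (1 / a\<^sup>2) * (?d x * indicator U x) \<partial>lborel)"
  proof (intro nn_integral_mono)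
    fix x
    show "?e (T x) * indicator U x \<le> ennreal (1 / a\<^sup>2) * (?d x * indicator U x)"
    proof (cases "x \<in> U")
      case True
      have pos: "0 < a * infdist x S"
        using ab(1) S(2)[OF True] by simp
      have le: "a * infdist x S \<le> infdist (T x) (T ` S)"
        by (rule infdist_image_lower[OF S(1) ab(1) lower[OF True]])
      have "(f (T x))\<^sup>2 / (infdist (T x) (T ` S))\<^sup>2 \<le> (f (T x))\<^sup>2 / (a * infdist x S)\<^sup>2"
      proof (rule divide_left_mono)
        show "(a * infdist x S)\<^sup>2 \<le> (infdist (T x) (T ` S))\<^sup>2"
          using pos le by (intro power_mono) simp_all
        show "0 < (infdist (T x) (T ` S))\<^sup>2 * (a * infdist x S)\<^sup>2"
          using pos less_le_trans[OF pos le] by (intro mult_pos_pos[of "(infdist (T x) (T ` S))\<^sup>2"] zero_less_power)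
      qed simp
      also have "\<dots> = 1 / a\<^sup>2 * ((f (T x))\<^sup>2 / (infdist x S)\<^sup>2)"
        by (simp add: power_mult_distrib)
      finally show ?thesis
        using True by (simp add: ennreal_mult'[symmetric] ennreal_leI)
    qed simp
  qed
  also have "\<dots> = ennreal (1 / a\<^sup>2) * (\<integral>\<^sup>+x. ?d x * indicator U x \<partial>lborel)"
    using dm borel_open[OF U] by (intro nn_integral_cmult) auto
  also have "(\<integral>\<^sup>+x. ?d x * indicator U x \<partial>lborel) = hardy_denominator U S (\<lambda>x. f (T x))"
    by (simp add: hardy_denominator_def nn_integral_lebesgue_on[OF borel_open[OF U]])
  finally show ?thesis
    using ab by (simp add: mult_left_mono mult.assoc[symmetric] ennreal_mult[symmetric])
qed

section \<open>Hardy constants of bi-Lipschitz images\<close>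

lemma homeomorphism_UNIV_frontier_image:
  assumes hom: "homeomorphism UNIV UNIV T g" and U: "open U" and S: "S \<subseteq> frontier U"
  shows "T ` S \<subseteq> frontier (T ` U)"
proof
  fix z assume "z \<in> T ` S"
  then obtain y where y: "z = T y" "y \<in> frontier U"
    using S by blast
  then have "y \<in> closure U" "y \<notin> U"
    using U by (auto simp: frontier_def interior_open)
  have "continuous_on (closure U) T"
    by (rule continuous_on_subset[OF homeomorphism_cont1[OF hom] subset_UNIV])
  then have "T ` closure U \<subseteq> closure (T ` U)"
    by (intro image_closure_subset closed_closure closure_subset)
  then have "z \<in> closure (T ` U)"
    using y(1) \<open>y \<in> closure U\<close> by blast
  moreover have "z \<notin> T ` U"
    using y(1) \<open>y \<notin> U\<close> homeomorphism_apply1[OF hom] by (metis UNIV_I imageE)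
  moreover have "interior (T ` U) = T ` U"
    using homeomorphism_UNIV_open_image[OF hom U] by (rule interior_open)
  ultimately show "z \<in> frontier (T ` U)"
    by (simp add: frontier_def)
qed

lemma bounded_open_set_image:
  fixes T :: "real^'n::finite \<Rightarrow> real^'n"
  assumes hom: "homeomorphism UNIV UNIV T g" and U: "bounded_open_set U"
  shows "bounded_open_set (T ` U)"
proof
  interpret bounded_open_set U by (rule U)
  show "open (T ` U)"
    by (rule homeomorphism_UNIV_open_image[OF hom open_dom])
  have "continuous_on (closure U) T"
    by (rule continuous_on_subset[OF homeomorphism_cont1[OF hom] subset_UNIV])
  moreover have "compact (closure U)"
    using bounded_dom by (simp add: compact_closure)
  ultimately have "compact (T ` closure U)"
    by (rule compact_continuous_image)
  from compact_imp_bounded[OF this] show "bounded (T ` U)"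
    by (rule bounded_subset) (intro image_mono closure_subset)
qed

lemma hardy_constant_nonneg:
  assumes "bounded_open_set \<Omega>" "\<Omega> \<noteq> {}" "S \<subseteq> frontier \<Omega>" "S \<noteq> {}"
  shows "0 \<le> hardy_constant \<Omega> S"
  by (rule bounded_open_set.test_inequality_imp_hardy_constant[OF assms order_refl])
    (simp add: hardy_inequality_def)

text \<open>A test function on the image is pulled back to a \<open>C\<^sup>1\<close> function on \<open>\<Omega>\<close>, where the inequality with
  the constant of \<open>\<Omega>\<close> is available. Bounding the denominator from above and the energy of the
  pull-back by that on the image loses \<open>b ^ n / a\<^sup>2\<close> and \<open>b\<^sup>2 / a ^ n\<close>.\<close>

lemma hardy_constant_bilipschitz:
  fixes T g :: "real^'n::finite \<Rightarrow> real^'n"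
  assumes \<Omega>: "bounded_open_set \<Omega>" "\<Omega> \<noteq> {}" and S: "S \<subseteq> frontier \<Omega>" "S \<noteq> {}"
    and hom: "homeomorphism UNIV UNIV T g" and T: "Ck 1 T" and ab: "a > 0" "b > 0"
    and upper: "\<And>x y. x \<in> \<Omega> \<Longrightarrow> y \<in> \<Omega> \<union> S \<Longrightarrow> dist (T x) (T y) \<le> b * dist x y"
    and lower: "\<And>x y. x \<in> \<Omega> \<Longrightarrow> y \<in> \<Omega> \<union> S \<Longrightarrow> a * dist x y \<le> dist (T x) (T y)"
  shows "(a / b) ^ (CARD('n) + 2) * hardy_constant \<Omega> S \<le> hardy_constant (T ` \<Omega>) (T ` S)"
proof -
  let ?c = "hardy_constant \<Omega> S" and ?n = "CARD('n)"
  interpret bounded_open_set \<Omega> by (rule \<Omega>(1))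
  interpret V: bounded_open_set "T ` \<Omega>" by (rule bounded_open_set_image[OF hom \<Omega>(1)])
  have c: "0 \<le> ?c"
    by (rule hardy_constant_nonneg[OF \<Omega> S])
  show ?thesis
  proof (rule V.test_inequality_imp_hardy_constant)
    show "T ` \<Omega> \<noteq> {}" "T ` S \<noteq> {}"
      using \<Omega>(2) S(2) by simp_all
    show "T ` S \<subseteq> frontier (T ` \<Omega>)"
      by (rule homeomorphism_UNIV_frontier_image[OF hom open_dom S(1)])
    show "0 \<le> (a / b) ^ (?n + 2) * ?c"
      using ab c by simp
    fix \<eta> assume \<eta>: "\<eta> \<in> test_functions (T ` \<Omega>)"
    have \<eta>1: "Ck 1 \<eta>" and \<eta>c: "continuous_on UNIV \<eta>"
      using \<eta> by (rule V.test_functionsD)+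
    have K: "compact (closure {y. \<eta> y \<noteq> 0})" "closure {y. \<eta> y \<noteq> 0} \<subseteq> T ` \<Omega>"
      using \<eta> by (simp_all add: test_functions_def)
    let ?F = "\<lambda>x. \<eta> (T x)" and ?gK = "g ` closure {y. \<eta> y \<noteq> 0}"
    have gK: "compact ?gK"
      by (rule compact_continuous_image[OF continuous_on_subset[OF homeomorphism_cont2[OF hom] subset_UNIV] K(1)])
    have supp: "closure {x. ?F x \<noteq> 0} \<subseteq> ?gK"
    proof (rule closure_minimal[OF _ compact_imp_closed[OF gK]])
      show "{x. ?F x \<noteq> 0} \<subseteq> ?gK"
      proof
        fix x assume "x \<in> {x. ?F x \<noteq> 0}"
        then have "T x \<in> closure {y. \<eta> y \<noteq> 0}"
          using closure_subset[of "{y. \<eta> y \<noteq> 0}"] by blast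
        then have "g (T x) \<in> ?gK"
          by (rule imageI)
        then show "x \<in> ?gK"
          using homeomorphism_apply1[OF hom] by simp
      qed
    qed
    have "?gK \<subseteq> g ` T ` \<Omega>"
      using K(2) by (rule image_mono)
    also have "g ` T ` \<Omega> = \<Omega>"
      using homeomorphism_apply1[OF hom] by (simp add: image_image)
    finally have "?gK \<subseteq> \<Omega>" .
    with supp have "closure {x. ?F x \<noteq> 0} \<subseteq> \<Omega>"
      by (rule order_trans)
    then have F: "hardy_inequality \<Omega> S ?c ?F"
      by (intro hardy_constant_imp_C1_inequality c order_refl Ck_1_compose[OF \<eta>1 T]
          compact_closure_subset[OF supp gK])
    have "ennreal ((a / b) ^ (?n + 2) * ?c) * hardy_denominator (T ` \<Omega>) (T ` S) \<eta>
        \<le> ennreal ((a / b) ^ (?n + 2) * ?c) * (ennreal (b ^ ?n / a\<^sup>2) * hardy_denominator \<Omega> S ?F)"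
      using upper lower
      by (intro mult_left_mono hardy_denominator_bilipschitz[OF hom open_dom ab S(2) infdist_pos[OF S] _ _ \<eta>c]) auto
    also have "\<dots> = ennreal (a ^ ?n / b\<^sup>2) * (ennreal ?c * hardy_denominator \<Omega> S ?F)"
    proof -
      have "(a / b) ^ (?n + 2) * ?c * (b ^ ?n / a\<^sup>2) = a ^ ?n / b\<^sup>2 * ?c"
        using ab by (simp add: power_add power_divide field_simps power2_eq_square)
      then show ?thesis
        using ab c by (simp add: mult.assoc[symmetric] ennreal_mult[symmetric])
    qed
    also have "\<dots> \<le> ennreal (a ^ ?n / b\<^sup>2) * dirichlet_energy \<Omega> ?F"
      using F unfolding hardy_inequality_def by (rule mult_left_mono) simp
    also have "\<dots> \<le> ennreal (a ^ ?n / b\<^sup>2) * (ennreal (b\<^sup>2 / a ^ ?n) * dirichlet_energy (T ` \<Omega>) \<eta>)"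
      using upper lower
      by (intro mult_left_mono dirichlet_energy_bilipschitz[OF hom T open_dom ab _ _ \<eta>1]) auto
    also have "\<dots> = dirichlet_energy (T ` \<Omega>) \<eta>"
      using ab by (simp add: mult.assoc[symmetric] ennreal_mult[symmetric])
    finally show "hardy_inequality (T ` \<Omega>) (T ` S) ((a / b) ^ (?n + 2) * ?c) \<eta>"
      unfolding hardy_inequality_def .
  qed
qed

section \<open>The weak $C^1$ topology\<close>

text \<open>A strict inequality \<open>|f| > E\<close> at a point of the closed ball persists on an open set that meets the
  interior of the ball, and such a set is not null. Hence the essential supremum bounds \<open>f\<close> at every
  point, including the boundary of the ball.\<close>

lemma norm_le_Linf_norm:
  fixes f :: "real^'n::finite \<Rightarrow> 'b::real_normed_vector"
  assumes f: "continuous_on UNIV f" and R: "R > 0" and x0: "x0 \<in> cball 0 R"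
  shows "norm (f x0) \<le> Linf_norm (cball 0 R) f"
proof -
  let ?K = "cball (0::real^'n) R"
  define E where "E = esssup (lebesgue_on ?K) (\<lambda>x. ereal (norm (f x)))"
  have K: "?K \<in> sets lebesgue"
    by (intro sets_completionI_sets) simp
  have nc: "continuous_on UNIV (\<lambda>x. norm (f x))"
    using f by (rule continuous_on_norm)
  have ec: "continuous_on UNIV (\<lambda>x. ereal (norm (f x)))"
    using nc by (rule continuous_on_ereal)
  have le: "ereal (norm (f x0)) \<le> E"
  proof (rule ccontr)
    assume "\<not> ?thesis"
    then have E: "E < ereal (norm (f x0))" by simp
    have "open {x. E < ereal (norm (f x))}"
      using ec by (intro open_Collect_less continuous_on_const)
    then obtain d where d: "d > 0" "ball x0 d \<subseteq> {x. E < ereal (norm (f x))}"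
      using E open_contains_ball by blast
    let ?U = "ball x0 d \<inter> ball 0 R"
    have "closure (ball (0::real^'n) R) = ?K"
      using R by (rule closure_ball)
    then have "ball 0 R \<inter> ball x0 d \<noteq> {}"
      using x0 d(1) closure_iff_nhds_not_empty by (metis Int_commute centre_in_ball open_ball order_refl)
    then have nn: "\<not> negligible ?U"
      by (intro open_not_negligible) (auto simp: Int_commute)
    have "AE x in lebesgue_on ?K. ereal (norm (f x)) \<le> E"
      unfolding E_def by (rule esssup_AE)
    then have "AE x in lebesgue. x \<in> ?K \<longrightarrow> ereal (norm (f x)) \<le> E"
      using K by (simp add: AE_restrict_space_iff)
    then have "AE x in lebesgue. x \<notin> ?U"
    proof eventually_elim
      case (elim x)
      show ?case
      proof
        assume x: "x \<in> ?U"
        then have "E < ereal (norm (f x))"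
          using d(2) by blast
        with elim x show False
          by simp
      qed
    qed
    moreover have "?U \<in> sets lebesgue"
      by (intro sets_completionI_sets) simp
    ultimately have "?U \<in> null_sets lebesgue"
      using AE_iff_null_sets by blast
    with nn show False
      by (simp add: negligible_iff_null_sets)
  qed
  have "compact ((\<lambda>x. norm (f x)) ` ?K)"
    by (intro compact_continuous_image continuous_on_subset[OF nc]) auto
  from compact_imp_bounded[OF this] obtain B where "\<forall>y\<in>(\<lambda>x. norm (f x)) ` ?K. norm y \<le> B"
    unfolding bounded_iff by blast
  then have B: "norm (f x) \<le> B" if "x \<in> ?K" for x
    using that by simp
  have "E \<le> ereal B"
    unfolding E_def
  proof (rule esssup_I)
    show "(\<lambda>x. ereal (norm (f x))) \<in> borel_measurable (lebesgue_on ?K)"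
      by (rule continuous_imp_measurable_on_sets_lebesgue[OF continuous_on_subset[OF ec subset_UNIV] K])
    show "AE x in lebesgue_on ?K. ereal (norm (f x)) \<le> ereal B"
      using B by (intro AE_I2) simp
  qed
  with le have "norm (f x0) \<le> real_of_ereal E"
    by (cases E) auto
  then show ?thesis
    by (simp add: Linf_norm_def E_def)
qed

lemma Ck_1_diff:
  assumes f: "Ck 1 f" and g: "Ck 1 g"
  shows "Ck 1 (\<lambda>x. f x - g x)"
proof (rule Ck_1I)
  have "f differentiable (at x)" "g differentiable (at x)" for x
    using f g by simp_all
  then show "((\<lambda>x. f x - g x) has_derivative
      (\<lambda>h. frechet_derivative f (at x) h - frechet_derivative g (at x) h)) (at x)" for x
    by (intro has_derivative_diff has_derivative_frechet)
  show "continuous_on UNIV (\<lambda>x. frechet_derivative f (at x) (axis i 1) - frechet_derivative g (at x) (axis i 1))" for i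
    using continuous_on_diff[OF Ck_1_partial_continuous[OF f, of i] Ck_1_partial_continuous[OF g, of i]]
    by (simp add: partial_deriv_def)
qed

lemma partial_deriv_le_C1_norm:
  fixes w :: "real^'n::finite \<Rightarrow> 'b::real_normed_vector"
  assumes w: "Ck 1 w" and R: "R > 0" and x: "x \<in> cball 0 R"
  shows "norm (partial_deriv i w x) \<le> C1_norm (cball 0 R) w"
proof -
  have pc: "continuous_on UNIV (partial_deriv j w)" for j
    using w by (rule Ck_1_partial_continuous)
  have nonneg: "0 \<le> Linf_norm (cball 0 R) f" if "continuous_on UNIV f" for f :: "real^'n \<Rightarrow> 'b"
    using norm_le_Linf_norm[OF that R x] norm_ge_zero[of "f x"] by linarith
  have "norm (partial_deriv i w x) \<le> Linf_norm (cball 0 R) (partial_deriv i w)"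
    by (rule norm_le_Linf_norm[OF pc R x])
  also have "\<dots> \<le> (\<Sum>j\<in>UNIV. Linf_norm (cball 0 R) (partial_deriv j w))"
    by (rule member_le_sum) (auto intro: nonneg pc)
  also have "\<dots> \<le> C1_norm (cball 0 R) w"
    using nonneg[OF Ck_imp_continuous[OF w]] by (simp add: C1_norm_def)
  finally show ?thesis .
qed

lemma norm_derivative_le_partials:
  fixes p :: "'n::finite \<Rightarrow> 'b::real_normed_vector"
  assumes "\<And>i. norm (p i) \<le> M"
  shows "norm (\<Sum>i\<in>UNIV. h $ i *\<^sub>R p i) \<le> real CARD('n) * M * norm (h :: real^'n)"
proof -
  have "norm (\<Sum>i\<in>UNIV. h $ i *\<^sub>R p i) \<le> (\<Sum>i\<in>(UNIV::'n set). norm h * M)"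
    by (intro sum_norm_le)
      (auto intro!: mult_mono assms component_le_norm_cart)
  then show ?thesis
    by (simp add: mult_ac)
qed

lemma Diff1_c_homeomorphism:
  assumes "\<phi> \<in> Diff1_c"
  shows "homeomorphism UNIV UNIV \<phi> (inv \<phi>)"
proof -
  have "bij \<phi>" "Ck 1 \<phi>" "Ck 1 (inv \<phi>)"
    using assms unfolding Diff1_c_def by blast+
  then show ?thesis
    by (intro homeomorphismI Ck_imp_continuous[of 1])
      (simp_all add: bij_is_inj bij_is_surj surj_f_inv_f del: Ck.simps One_nat_def)
qed

text \<open>The displacement \<open>w = (\<psi> - \<phi>) \<circ> \<phi>\<inverse>\<close> is considered on a ball that contains \<open>\<phi> ` A\<close>. Since the
  ball is convex, the mean value inequality applies on it. The derivative of \<open>w\<close>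
  is small as soon as the partial derivatives of \<open>\<psi> - \<phi>\<close> are small on the preimage of the ball,
  which lies in a ball \<open>K\<close> that depends on \<open>\<phi>\<close> and \<open>A\<close> only.\<close>

lemma C1_close_imp_relative_lipschitz:
  fixes \<phi> :: "real^'n::finite \<Rightarrow> real^'n"
  assumes \<phi>: "\<phi> \<in> Diff1_c" and A: "bounded A" and \<delta>: "\<delta> > 0"
  obtains K \<epsilon> where "compact K" "\<epsilon> > 0"
    "\<And>\<psi> x y. \<psi> \<in> C1_nbhd \<phi> K \<epsilon> \<Longrightarrow> x \<in> A \<Longrightarrow> y \<in> A \<Longrightarrow>
      norm ((\<psi> x - \<phi> x) - (\<psi> y - \<phi> y)) \<le> \<delta> * norm (\<phi> x - \<phi> y)"
proof -
  let ?\<theta> = "inv \<phi>" and ?N = "real CARD('n)"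
  have \<phi>1: "Ck 1 \<phi>" and \<theta>1: "Ck 1 ?\<theta>" and "bij \<phi>"
    using \<phi> unfolding Diff1_c_def by blast+
  have \<theta>\<phi>: "?\<theta> (\<phi> x) = x" for x
    using \<open>bij \<phi>\<close> by (simp add: bij_is_inj)
  have "compact (\<phi> ` closure A)"
    using A by (intro compact_continuous_image continuous_on_subset[OF Ck_imp_continuous[OF \<phi>1]])
      (auto simp: compact_closure)
  from compact_imp_bounded[OF this] obtain \<rho> where "\<forall>z\<in>\<phi> ` closure A. norm z \<le> \<rho>"
    unfolding bounded_iff by blast
  then have \<rho>: "\<phi> x \<in> cball 0 \<rho>" if "x \<in> A" for x
    using that closure_subset[of A] by auto
  have "compact (?\<theta> ` cball 0 \<rho>)"
    by (intro compact_continuous_image continuous_on_subset[OF Ck_imp_continuous[OF \<theta>1]]) auto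
  from compact_imp_bounded[OF this] obtain R where R: "R > 0" "\<forall>z\<in>?\<theta> ` cball 0 \<rho>. norm z \<le> R"
    unfolding bounded_pos by blast
  have "compact (\<Union>i. partial_deriv i ?\<theta> ` cball 0 \<rho>)"
    by (intro compact_UN compact_continuous_image
        continuous_on_subset[OF Ck_1_partial_continuous[OF \<theta>1]]) auto
  from compact_imp_bounded[OF this] obtain M where M: "M > 0"
    "\<forall>z\<in>(\<Union>i. partial_deriv i ?\<theta> ` cball 0 \<rho>). norm z \<le> M"
    unfolding bounded_pos by blast
  \<comment> \<open>A derivative whose \<open>n\<close> partial derivatives are bounded by \<open>M\<close> has norm at most \<open>n M\<close>; this is
    applied to \<open>\<psi> - \<phi>\<close> and to \<open>\<phi>\<inverse>\<close>.\<close>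
  define \<epsilon> where "\<epsilon> = \<delta> / (?N * (?N * M))"
  have N: "?N > 0" by simp
  have \<epsilon>: "\<epsilon> > 0"
    using \<delta> M(1) N by (simp add: \<epsilon>_def)
  show ?thesis
  proof
    show "compact (cball (0::real^'n) R)" by simp
    show "\<epsilon> > 0" by fact
    fix \<psi> x y
    assume \<psi>: "\<psi> \<in> C1_nbhd \<phi> (cball 0 R) \<epsilon>" and xy: "x \<in> A" "y \<in> A"
    let ?w = "\<lambda>x. \<psi> x - \<phi> x"
    have "Ck 1 \<psi>" and wn: "C1_norm (cball 0 R) ?w < \<epsilon>"
      using \<psi> unfolding C1_nbhd_def Diff1_c_def by blast+
    then have w1: "Ck 1 ?w"
      using \<phi>1 by (intro Ck_1_diff)
    let ?W' = "\<lambda>z h. \<Sum>j\<in>UNIV. (\<Sum>i\<in>UNIV. h $ i *\<^sub>R partial_deriv i ?\<theta> z) $ j *\<^sub>R partial_deriv j ?w (?\<theta> z)"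
    have "norm (?w (?\<theta> (\<phi> x)) - ?w (?\<theta> (\<phi> y))) \<le> \<delta> * norm (\<phi> x - \<phi> y)"
    proof (rule differentiable_bound[OF convex_cball _ _ \<rho>[OF xy(1)] \<rho>[OF xy(2)]])
      fix z :: "real^'n" assume z: "z \<in> cball 0 \<rho>"
      show "((\<lambda>z. ?w (?\<theta> z)) has_derivative ?W' z) (at z within cball 0 \<rho>)"
        by (rule has_derivative_at_withinI)
          (rule has_derivative_compose[OF Ck_1_has_derivative[OF \<theta>1] Ck_1_has_derivative[OF w1]])
      show "onorm (?W' z) \<le> \<delta>"
      proof (rule onorm_bound)
        show "0 \<le> \<delta>" using \<delta> by simp
        fix h :: "real^'n"
        have "norm (partial_deriv j ?w (?\<theta> z)) \<le> \<epsilon>" for j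
          using partial_deriv_le_C1_norm[OF w1 R(1), of "?\<theta> z" j] R(2) z wn by auto
        then have "norm (?W' z h) \<le> ?N * \<epsilon> * norm (\<Sum>i\<in>UNIV. h $ i *\<^sub>R partial_deriv i ?\<theta> z)"
          by (rule norm_derivative_le_partials)
        also have "\<dots> \<le> ?N * \<epsilon> * (?N * M * norm h)"
          using M(2) z \<epsilon> by (intro mult_left_mono norm_derivative_le_partials) auto
        also have "\<dots> = \<delta> * norm h"
          using M(1) N by (simp add: \<epsilon>_def)
        finally show "norm (?W' z h) \<le> \<delta> * norm h" .
      qed
    qed
    then show "norm ((\<psi> x - \<phi> x) - (\<psi> y - \<phi> y)) \<le> \<delta> * norm (\<phi> x - \<phi> y)"
      by (simp only: \<theta>\<phi>)
  qed
qed

text \<open>\<open>hardy_constant_bilipschitz\<close> for \<open>T = \<psi> \<circ> \<phi>\<inverse>\<close>. In terms of \<open>\<phi>\<close> and \<open>\<psi>\<close> the hypotheses are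
  symmetric up to replacing \<open>a\<close> and \<open>b\<close> by \<open>1 / b\<close> and \<open>1 / a\<close>, so that the lemma can be used in
  both directions.\<close>

lemma hardy_constant_relative_lipschitz:
  fixes \<phi> \<psi> :: "real^'n::finite \<Rightarrow> real^'n"
  assumes \<Omega>: "bounded_open_set \<Omega>" "\<Omega> \<noteq> {}" and S: "S \<subseteq> frontier \<Omega>" "S \<noteq> {}"
    and \<phi>: "\<phi> \<in> Diff1_c" and \<psi>: "\<psi> \<in> Diff1_c" and ab: "a > 0" "b > 0"
    and upper: "\<And>x y. x \<in> \<Omega> \<union> S \<Longrightarrow> y \<in> \<Omega> \<union> S \<Longrightarrow> dist (\<psi> x) (\<psi> y) \<le> b * dist (\<phi> x) (\<phi> y)"
    and lower: "\<And>x y. x \<in> \<Omega> \<union> S \<Longrightarrow> y \<in> \<Omega> \<union> S \<Longrightarrow> a * dist (\<phi> x) (\<phi> y) \<le> dist (\<psi> x) (\<psi> y)"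
  shows "(a / b) ^ (CARD('n) + 2) * hardy_constant (\<phi> ` \<Omega>) (\<phi> ` S) \<le> hardy_constant (\<psi> ` \<Omega>) (\<psi> ` S)"
proof -
  have hom: "homeomorphism UNIV UNIV \<phi> (inv \<phi>)" "homeomorphism UNIV UNIV \<psi> (inv \<psi>)"
    by (rule Diff1_c_homeomorphism[OF \<phi>] Diff1_c_homeomorphism[OF \<psi>])+
  have c: "Ck 1 \<psi>" "Ck 1 (inv \<phi>)"
    using \<phi> \<psi> unfolding Diff1_c_def by blast+
  have inv: "inv \<phi> (\<phi> x) = x" for x
    using homeomorphism_apply1[OF hom(1)] by simp
  have homT: "homeomorphism UNIV UNIV (\<lambda>z. \<psi> (inv \<phi> z)) (\<lambda>z. \<phi> (inv \<psi> z))"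
    using homeomorphism_compose[OF homeomorphism_symD[OF hom(1)] hom(2)] by (simp add: o_def)
  have "(a / b) ^ (CARD('n) + 2) * hardy_constant (\<phi> ` \<Omega>) (\<phi> ` S)
      \<le> hardy_constant ((\<lambda>z. \<psi> (inv \<phi> z)) ` \<phi> ` \<Omega>) ((\<lambda>z. \<psi> (inv \<phi> z)) ` \<phi> ` S)"
  proof (rule hardy_constant_bilipschitz[OF bounded_open_set_image[OF hom(1) \<Omega>(1)] _ _ _ homT _ ab])
    show "\<phi> ` \<Omega> \<noteq> {}" "\<phi> ` S \<noteq> {}"
      using \<Omega>(2) S(2) by simp_all
    show "\<phi> ` S \<subseteq> frontier (\<phi> ` \<Omega>)"
      by (rule homeomorphism_UNIV_frontier_image[OF hom(1) bounded_open_set.open_dom[OF \<Omega>(1)] S(1)])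
    show "Ck 1 (\<lambda>z. \<psi> (inv \<phi> z))"
      by (rule Ck_1_compose[OF c])
    fix z w assume "z \<in> \<phi> ` \<Omega>" "w \<in> \<phi> ` \<Omega> \<union> \<phi> ` S"
    then obtain x y where xy: "z = \<phi> x" "w = \<phi> y" "x \<in> \<Omega> \<union> S" "y \<in> \<Omega> \<union> S"
      by blast
    show "dist (\<psi> (inv \<phi> z)) (\<psi> (inv \<phi> w)) \<le> b * dist z w"
      "a * dist z w \<le> dist (\<psi> (inv \<phi> z)) (\<psi> (inv \<phi> w))"
      using upper[OF xy(3,4)] lower[OF xy(3,4)] by (simp_all add: xy inv)
  qed
  then show ?thesis
    by (simp only: image_image inv)
qed

text \<open>With \<open>q = ((1 - \<delta>) / (1 + \<delta>)) ^ (n + 2)\<close> the two directions give \<open>q H(\<phi>) \<le> H(\<psi>) \<le> H(\<phi>) / q\<close>, and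
  both bounds tend to \<open>H(\<phi>)\<close> as \<open>\<delta>\<close> tends to \<open>0\<close>.\<close>

lemma hardy_constant_C1_close:
  fixes \<Omega> \<Sigma> :: "(real^'n::finite) set"
  assumes \<Omega>: "bounded_open_set \<Omega>" "\<Omega> \<noteq> {}" and \<Sigma>: "\<Sigma> \<subseteq> frontier \<Omega>" "\<Sigma> \<noteq> {}"
    and \<phi>: "\<phi> \<in> Diff1_c" and e: "e > 0"
  shows "\<exists>K \<epsilon>. compact K \<and> \<epsilon> > 0 \<and>
    (\<forall>\<psi>\<in>C1_nbhd \<phi> K \<epsilon>. \<bar>hardy_constant (\<psi> ` \<Omega>) (\<psi> ` \<Sigma>) - hardy_constant (\<phi> ` \<Omega>) (\<phi> ` \<Sigma>)\<bar> < e)"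
proof -
  define H where "H \<phi> = hardy_constant (\<phi> ` \<Omega>) (\<phi> ` \<Sigma>)" for \<phi> :: "real^'n \<Rightarrow> real^'n"
  let ?m = "CARD('n) + 2"
  have "\<Omega> \<union> \<Sigma> \<subseteq> closure \<Omega>"
    using \<Sigma>(1) closure_subset[of \<Omega>] by (auto simp: frontier_def)
  then have bdd: "bounded (\<Omega> \<union> \<Sigma>)"
    using bounded_open_set.bounded_dom[OF \<Omega>(1)] bounded_subset bounded_closure by blast
  let ?q = "\<lambda>\<delta>::real. ((1 - \<delta>) / (1 + \<delta>)) ^ ?m"
  have q1: "(?q \<longlongrightarrow> ((1 - 0) / (1 + 0)) ^ ?m) (at_right 0)"
    by (intro tendsto_power tendsto_divide tendsto_diff tendsto_add tendsto_const tendsto_ident_at) simp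
  have "((\<lambda>\<delta>. ?q \<delta> * H \<phi>) \<longlongrightarrow> H \<phi>) (at_right 0)" "((\<lambda>\<delta>. H \<phi> / ?q \<delta>) \<longlongrightarrow> H \<phi>) (at_right 0)"
    using tendsto_mult_right[OF q1, of "H \<phi>"] tendsto_divide[OF tendsto_const[of "H \<phi>"] q1] by simp_all
  then have "eventually (\<lambda>\<delta>. H \<phi> - e < ?q \<delta> * H \<phi>) (at_right 0)"
    "eventually (\<lambda>\<delta>. H \<phi> / ?q \<delta> < H \<phi> + e) (at_right 0)"
    using e by (auto intro: order_tendstoD)
  moreover have "eventually (\<lambda>\<delta>::real. 0 < \<delta> \<and> \<delta> < 1) (at_right 0)"
    using eventually_at_right_less[of "0::real"] eventually_at_rightI[of 0 1 "\<lambda>\<delta>::real. \<delta> < 1"]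
    by (intro eventually_conj) auto
  ultimately have "eventually (\<lambda>\<delta>. H \<phi> - e < ?q \<delta> * H \<phi> \<and> H \<phi> / ?q \<delta> < H \<phi> + e \<and> 0 < \<delta> \<and> \<delta> < 1) (at_right 0)"
    by eventually_elim simp
  then obtain \<delta> where \<delta>: "H \<phi> - e < ?q \<delta> * H \<phi>" "H \<phi> / ?q \<delta> < H \<phi> + e" "0 < \<delta>" "\<delta> < 1"
    using eventually_happens'[OF trivial_limit_at_right_real] by blast
  obtain K \<epsilon> where K: "compact K" "\<epsilon> > 0" and lip: "\<And>\<psi> x y. \<psi> \<in> C1_nbhd \<phi> K \<epsilon> \<Longrightarrow> x \<in> \<Omega> \<union> \<Sigma> \<Longrightarrow> y \<in> \<Omega> \<union> \<Sigma> \<Longrightarrow>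
      norm ((\<psi> x - \<phi> x) - (\<psi> y - \<phi> y)) \<le> \<delta> * norm (\<phi> x - \<phi> y)"
    by (rule C1_close_imp_relative_lipschitz[OF \<phi> bdd \<delta>(3)]) (rule that)
  have "\<bar>H \<psi> - H \<phi>\<bar> < e" if nb: "\<psi> \<in> C1_nbhd \<phi> K \<epsilon>" for \<psi>
  proof -
    have \<psi>: "\<psi> \<in> Diff1_c"
      using nb by (simp add: C1_nbhd_def)
    have ul: "dist (\<psi> x) (\<psi> y) \<le> (1 + \<delta>) * dist (\<phi> x) (\<phi> y)"
      "(1 - \<delta>) * dist (\<phi> x) (\<phi> y) \<le> dist (\<psi> x) (\<psi> y)"
      if "x \<in> \<Omega> \<union> \<Sigma>" "y \<in> \<Omega> \<union> \<Sigma>" for x y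
    proof -
      have "\<psi> x - \<psi> y = (\<phi> x - \<phi> y) + ((\<psi> x - \<phi> x) - (\<psi> y - \<phi> y))"
        by simp
      then have "norm (\<psi> x - \<psi> y) \<le> norm (\<phi> x - \<phi> y) + norm ((\<psi> x - \<phi> x) - (\<psi> y - \<phi> y))"
        "norm (\<phi> x - \<phi> y) - norm ((\<psi> x - \<phi> x) - (\<psi> y - \<phi> y)) \<le> norm (\<psi> x - \<psi> y)"
        using norm_triangle_ineq norm_diff_ineq by metis+
      then show "dist (\<psi> x) (\<psi> y) \<le> (1 + \<delta>) * dist (\<phi> x) (\<phi> y)"
        "(1 - \<delta>) * dist (\<phi> x) (\<phi> y) \<le> dist (\<psi> x) (\<psi> y)"
        using lip[OF nb that] by (simp_all add: dist_norm algebra_simps)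
    qed
    have pos: "0 < 1 - \<delta>" "0 < 1 + \<delta>" "0 < ?q \<delta>"
      using \<delta> by simp_all
    have 1: "?q \<delta> * H \<phi> \<le> H \<psi>"
      unfolding H_def using ul
      by (intro hardy_constant_relative_lipschitz[OF \<Omega> \<Sigma> \<phi> \<psi> pos(1,2)])
    \<comment> \<open>The same comparison with the roles of \<open>\<phi>\<close> and \<open>\<psi>\<close> exchanged.\<close>
    have "(1 / (1 + \<delta>) / (1 / (1 - \<delta>))) ^ ?m * H \<psi> \<le> H \<phi>"
      unfolding H_def
    proof (rule hardy_constant_relative_lipschitz[OF \<Omega> \<Sigma> \<psi> \<phi>])
      show "0 < 1 / (1 + \<delta>)" "0 < 1 / (1 - \<delta>)"
        using pos by simp_all
      fix x y assume xy: "x \<in> \<Omega> \<union> \<Sigma>" "y \<in> \<Omega> \<union> \<Sigma>"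
      show "dist (\<phi> x) (\<phi> y) \<le> 1 / (1 - \<delta>) * dist (\<psi> x) (\<psi> y)"
        using ul(2)[OF xy] pos by (simp add: field_simps)
      show "1 / (1 + \<delta>) * dist (\<psi> x) (\<psi> y) \<le> dist (\<phi> x) (\<phi> y)"
        using ul(1)[OF xy] pos by (simp add: field_simps)
    qed
    then have "?q \<delta> * H \<psi> \<le> H \<phi>"
      by simp
    then have "H \<psi> \<le> H \<phi> / ?q \<delta>"
      using pos(3) by (simp only: pos_le_divide_eq mult.commute)
    with 1 \<delta>(1,2) show ?thesis
      by linarith
  qed
  with K show ?thesis
    unfolding H_def by blast
qed

text \<open>If \<open>K\<close> is a null set, the essential supremum is \<open>-\<infinity>\<close>, whose real value is \<open>0\<close> as well.\<close>

lemma mem_C1_nbhd_self: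
  fixes \<phi> :: "real^'n::finite \<Rightarrow> real^'n"
  assumes "\<phi> \<in> Diff1_c" "\<epsilon> > 0"
  shows "\<phi> \<in> C1_nbhd \<phi> K \<epsilon>"
proof -
  have zero: "Linf_norm K (\<lambda>x::real^'n. 0::real^'n) = 0"
  proof (cases "emeasure (lebesgue_on K) (space (lebesgue_on K)) = 0")
    case True
    then have "ae_filter (lebesgue_on K) = bot"
      by (simp add: ae_filter_eq_bot_iff)
    then show ?thesis
      by (simp add: Linf_norm_def esssup_def bot_ereal_def)
  next
    case False
    from esssup_const[OF this, of "ereal 0"] show ?thesis
      by (simp add: Linf_norm_def)
  qed
  have "partial_deriv i (\<lambda>x::real^'n. 0::real^'n) = (\<lambda>x. 0)" for i
    using partial_deriv_eq[OF has_derivative_const] by blast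
  with zero assms show ?thesis
    by (simp add: C1_nbhd_def C1_norm_def)
qed

theorem corollary3p1p1:
  fixes \<Omega> \<Sigma> :: "(real^'n::finite) set"
  assumes "open \<Omega>" and "bounded \<Omega>" and "\<Omega> \<noteq> {}"
    and "\<Sigma> \<subseteq> frontier \<Omega>" and "\<Sigma> \<noteq> {}"
  shows "continuous_map weak_C1_topology euclideanreal (\<lambda>\<phi>. hardy_constant (\<phi> ` \<Omega>) (\<phi> ` \<Sigma>))"
proof -
  define H where "H \<phi> = hardy_constant (\<phi> ` \<Omega>) (\<phi> ` \<Sigma>)" for \<phi> :: "real^'n \<Rightarrow> real^'n"
  have bos: "bounded_open_set \<Omega>"
    using assms by unfold_locales
  have "continuous_map weak_C1_topology euclideanreal H"
    unfolding continuous_map_def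
  proof (intro conjI allI impI)
    show "H \<in> topspace weak_C1_topology \<rightarrow> topspace euclideanreal"
      by simp
    fix U :: "real set" assume "openin euclideanreal U"
    then have U: "open U" by simp
    show "openin weak_C1_topology {\<phi> \<in> topspace weak_C1_topology. H \<phi> \<in> U}"
    proof (subst openin_subopen, intro ballI)
      fix \<phi> assume "\<phi> \<in> {\<phi> \<in> topspace weak_C1_topology. H \<phi> \<in> U}"
      then have \<phi>: "\<phi> \<in> Diff1_c" "H \<phi> \<in> U"
        by (simp_all add: topspace_weak_C1_topology)
      obtain e where e: "e > 0" "ball (H \<phi>) e \<subseteq> U"
        using U \<phi>(2) open_contains_ball by blast
      obtain K \<epsilon> where K: "compact K" "\<epsilon> > 0" "\<forall>\<psi>\<in>C1_nbhd \<phi> K \<epsilon>. \<bar>H \<psi> - H \<phi>\<bar> < e"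
        using hardy_constant_C1_close[OF bos assms(3-5) \<phi>(1) e(1)] unfolding H_def by blast
      have "openin weak_C1_topology (C1_nbhd \<phi> K \<epsilon>)"
        unfolding weak_C1_topology_def using \<phi>(1) K(1,2) by (intro topology_generated_by_Basis) blast
      moreover have "C1_nbhd \<phi> K \<epsilon> \<subseteq> {\<phi> \<in> topspace weak_C1_topology. H \<phi> \<in> U}"
      proof
        fix \<psi> assume \<psi>: "\<psi> \<in> C1_nbhd \<phi> K \<epsilon>"
        then have "\<bar>H \<psi> - H \<phi>\<bar> < e"
          using K(3) by blast
        then have "H \<psi> \<in> ball (H \<phi>) e"
          by (simp add: dist_real_def abs_minus_commute)
        then show "\<psi> \<in> {\<phi> \<in> topspace weak_C1_topology. H \<phi> \<in> U}"
          using e(2) \<psi> by (auto simp: topspace_weak_C1_topology C1_nbhd_def)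
      qed
      ultimately show "\<exists>V. openin weak_C1_topology V \<and> \<phi> \<in> V \<and> V \<subseteq> {\<phi> \<in> topspace weak_C1_topology. H \<phi> \<in> U}"
        using mem_C1_nbhd_self[OF \<phi>(1) K(2)] by blast
    qed
  qed
  then show ?thesis
    by (simp add: H_def[abs_def])
qed

end
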